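(* Consider the quantum cluster algebra $\mathcal{A}_{\mathbf v}(b,c)$ for arbitrary $b,c\in\mathbb{Z}_{>0}$. Let $(a_1,a_2)\in\mathbb{Z}^2\setminus \Phi^{im}_+$. (Thus $(a_1,a_2)=s_1\mathbf d_n+s_2\mathbf d_{n+1}$ for some $n\in\mathbb{Z}$ and $s_1,s_2\in\mathbb{Z}_{\ge0}$, and $C[a_1,a_2]=\mathbf v^{s_1s_2}X_n^{s_1}X_{n+1}^{s_2}$ is a cluster monomial.) Let $\{e(p,q)\}$ be the coefficients in $C[a_1,a_2]=\sum_{p,q}e(p,q)X^{(bp-a_1,cq-a_2)}$. Then for $(p,q)\in\mathbb{Z}^2$, $e(p,q)\neq0$ if and only if $(p,q)\in s_1T_n+s_2T_{n+1}$ (Minkowski sum), and for those $(p,q)$, we have $\deg e(p,q)=D(p,q)$.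
   Context: Notation: $[x]_+=\max\{x,0\}$. $\Phi^{im}_+=\{(a_1,a_2)\in\mathbb{Z}_{>0}^2: ca_1^2-bca_1a_2+ba_2^2\le 0\}$ and $D(p,q)=ca_1q+ba_2p-bp^2-bcpq-cq^2$. For a nonzero Laurent polynomial in $\mathbf v$, $\deg$ is the highest exponent of $\mathbf v$ occurring. Quantum cluster algebra $\mathcal{A}_{\mathbf v}(b,c)$: let $\mathbf v$ be an indeterminate, $\mathcal{T}=\mathbb{Z}[\mathbf v^{\pm1}]\langle X_1^{\pm1},X_2^{\pm1}: X_2X_1=\mathbf v^2X_1X_2\rangle$ and let $\mathcal{F}$ be its skew-field of fractions. The cluster variables $X_m\in\mathcal F$ ($m\in\mathbb{Z}$) are defined recursively from $X_1,X_2$ by $X_{m+1}X_{m-1}=\mathbf v^bX_m^b+1$ if $m$ is odd and $X_{m+1}X_{m-1}=\mathbf v^cX_m^c+1$ if $m$ is even. Then $\mathcal{A}_{\mathbf v}(b,c)$ is the $\mathbb{Z}[\mathbf v^{\pm1}]$-subalgebra of $\mathcal F$ generated by all $X_m$; it is contained in $\mathcal T$. For $a_1,a_2\in\mathbb{Z}$ put $X^{(a_1,a_2)}=\mathbf v^{a_1a_2}X_1^{a_1}X_2^{a_2}$. The bar-involution is the $\mathbb{Z}$-linear anti-automorphism of $\mathcal T$ with $\overline{f(\mathbf v)X_1^{a_1}X_2^{a_2}}=f(\mathbf v^{-1})X_2^{a_2}X_1^{a_1}$. Triangular basis: for $\mathbf a=(a_1,a_2)\in\mathbb{Z}^2$ the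 standard monomial is $M[\mathbf a]=\mathbf v^{a_1a_2}X_3^{[a_1]_+}X_1^{[-a_1]_+}X_2^{[-a_2]_+}X_0^{[a_2]_+}$; these form a $\mathbb{Z}[\mathbf v^{\pm1}]$-basis of the algebra. Write $\mathbf a'<\mathbf a$ if $a_i'\le a_i$ for $i=1,2$ and $\mathbf a'\ne\mathbf a$. The triangular basis $\{C[\mathbf a]:\mathbf a\in\mathbb{Z}^2\}$ is the unique collection of elements of the algebra such that each $C[\mathbf a]$ is bar-invariant and $C[\mathbf a]-M[\mathbf a]\in\bigoplus_{\mathbf a'<\mathbf a}\mathbf v\mathbb{Z}[\mathbf v]M[\mathbf a']$. It contains all cluster monomials $\mathbf v^{s_1s_2}X_n^{s_1}X_{n+1}^{s_2}$ ($s_1,s_2\in\mathbb{Z}_{\ge0}$, $n\in\mathbb{Z}$). Every triangular basis element has the form $C[a_1,a_2]=\sum_{p,q}e(p,q)X^{(bp-a_1,cq-a_2)}$ with $0\le p\le[a_2]_+$, $0\le q\le[a_1]_+$, $e(p,q)\in\mathbb{Z}[\mathbf v^{\pm1}]$; put $e(p,q)=0$ for integers $p,q$ outside this range. Denominator vectors $\mathbf d_n=(d_n',d_n'')$, $n\in\mathbb{Z}$: $\mathbf d_1=(-1,0)$, $\mathbf d_2=(0,-1)$, and $\mathbf d_{n+1}+\mathbf d_{n-1}=b[\mathbf d_n]_+$ if $n$ is odd, $=c[\mathbf d_n]_+$ if $n$ is even, where $[(x,y)]_+=([x]_+,[y]_+)$. $T_n\subseteq\mathbb{R}^2$ is the convex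 hull of $\{(0,0),([d_n'']_+,0),(0,[d_n']_+)\}$, and $sT=\{sz: z\in T\}$ for $s\ge0$. *)

theory Defs
  imports "HOL-Analysis.Analysis" "HOL-Library.Poly_Mapping"
begin

section \<open>Laurent polynomials in \<open>v\<close> with integer coefficients\<close>

type_synonym laurent = "int \<Rightarrow>\<^sub>0 int"

definition vpow :: "int \<Rightarrow> laurent" where
  "vpow k = Poly_Mapping.single k 1"

definition ldeg :: "laurent \<Rightarrow> int" where
  "ldeg f = Max (Poly_Mapping.keys f)"

text \<open>The substitution of \<open>v\<close> by its inverse.\<close>

definition lbar :: "laurent \<Rightarrow> laurent" where
  "lbar f = (\<Sum>k\<in>Poly_Mapping.keys f. Poly_Mapping.single (- k) (Poly_Mapping.lookup f k))"

text \<open>The set \<open>v \<int>[v]\<close>.\<close>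

definition vZv :: "laurent set" where
  "vZv = {f. \<forall>k\<in>Poly_Mapping.keys f. k > 0}"

lemma vpow_add: "vpow (j + k) = vpow j * vpow k"
  by (simp add: vpow_def mult_single)

lemma vpow_0: "vpow 0 = 1"
  by (simp add: vpow_def)


section \<open>The quantum torus\<close>

text \<open>The quantum torus is modelled by its normal form: an element is a finite sum of terms
  \<open>f X\<^sub>1\<^bsup>i\<^esup> X\<^sub>2\<^bsup>j\<^esup>\<close>, stored as the coefficient \<open>f\<close> at the index \<open>(i, j)\<close>.
  The relation \<open>X\<^sub>2 X\<^sub>1 = v\<^sup>2 X\<^sub>1 X\<^sub>2\<close> amounts to the multiplication rule
  \<open>X\<^sub>1\<^bsup>i\<^esup> X\<^sub>2\<^bsup>j\<^esup> X\<^sub>1\<^bsup>k\<^esup> X\<^sub>2\<^bsup>l\<^esup> = v\<^bsup>2jk\<^esup> X\<^sub>1\<^bsup>i+k\<^esup> X\<^sub>2\<^bsup>j+l\<^esup>\<close>.\<close>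

typedef qtorus = "UNIV :: (int \<times> int \<Rightarrow>\<^sub>0 laurent) set"
  morphisms qcoeffs QTorus ..

setup_lifting type_definition_qtorus

definition twisted_term :: "int \<times> int \<Rightarrow> int \<times> int \<Rightarrow> laurent \<Rightarrow> laurent
    \<Rightarrow> (int \<times> int \<Rightarrow>\<^sub>0 laurent)" where
  "twisted_term a b f g = Poly_Mapping.single (a + b) (vpow (2 * snd a * fst b) * f * g)"

definition twisted_mult :: "(int \<times> int \<Rightarrow>\<^sub>0 laurent) \<Rightarrow> (int \<times> int \<Rightarrow>\<^sub>0 laurent)
    \<Rightarrow> (int \<times> int \<Rightarrow>\<^sub>0 laurent)" where
  "twisted_mult x y = (\<Sum>a\<in>Poly_Mapping.keys x. \<Sum>b\<in>Poly_Mapping.keys y.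
     twisted_term a b (Poly_Mapping.lookup x a) (Poly_Mapping.lookup y b))"

lemma twisted_mult_superset:
  assumes "finite A" "finite B" "Poly_Mapping.keys x \<subseteq> A" "Poly_Mapping.keys y \<subseteq> B"
  shows "twisted_mult x y = (\<Sum>a\<in>A. \<Sum>b\<in>B.
     twisted_term a b (Poly_Mapping.lookup x a) (Poly_Mapping.lookup y b))"
proof -
  have "(\<Sum>b\<in>Poly_Mapping.keys y. twisted_term a b (Poly_Mapping.lookup x a) (Poly_Mapping.lookup y b))
      = (\<Sum>b\<in>B. twisted_term a b (Poly_Mapping.lookup x a) (Poly_Mapping.lookup y b))" for a
    using assms by (intro sum.mono_neutral_left) (auto simp: twisted_term_def in_keys_iff)
  moreover have "(\<Sum>a\<in>Poly_Mapping.keys x. \<Sum>b\<in>B.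
        twisted_term a b (Poly_Mapping.lookup x a) (Poly_Mapping.lookup y b))
      = (\<Sum>a\<in>A. \<Sum>b\<in>B.
        twisted_term a b (Poly_Mapping.lookup x a) (Poly_Mapping.lookup y b))"
    using assms by (intro sum.mono_neutral_left) (auto simp: twisted_term_def in_keys_iff)
  ultimately show ?thesis by (simp add: twisted_mult_def)
qed

lemma twisted_mult_add_left: "twisted_mult (x + y) z = twisted_mult x z + twisted_mult y z"
proof -
  let ?A = "Poly_Mapping.keys x \<union> Poly_Mapping.keys y"
  have k: "Poly_Mapping.keys (x + y) \<subseteq> ?A" by (rule Poly_Mapping.keys_add)
  show ?thesis
    by (subst (1 2 3) twisted_mult_superset[where A = ?A and B = "Poly_Mapping.keys z"])
      (use k in \<open>auto simp: twisted_term_def lookup_add algebra_simps single_add sum.distrib\<close>)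
qed

lemma twisted_mult_add_right: "twisted_mult z (x + y) = twisted_mult z x + twisted_mult z y"
proof -
  let ?A = "Poly_Mapping.keys x \<union> Poly_Mapping.keys y"
  have k: "Poly_Mapping.keys (x + y) \<subseteq> ?A" by (rule Poly_Mapping.keys_add)
  show ?thesis
    by (subst (1 2 3) twisted_mult_superset[where B = ?A and A = "Poly_Mapping.keys z"])
      (use k in \<open>auto simp: twisted_term_def lookup_add algebra_simps single_add sum.distrib\<close>)
qed

lemma twisted_mult_0 [simp]: "twisted_mult 0 x = 0" "twisted_mult x 0 = 0"
  by (simp_all add: twisted_mult_def)

lemma twisted_mult_single:
  "twisted_mult (Poly_Mapping.single a f) (Poly_Mapping.single b g) = twisted_term a b f g"
  by (subst twisted_mult_superset[where A = "{a}" and B = "{b}"]) auto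

lemma poly_mapping_single_induct:
  assumes "P 0" and "\<And>a f. P (Poly_Mapping.single a f)" and "\<And>x y. P x \<Longrightarrow> P y \<Longrightarrow> P (x + y)"
  shows "P (x :: 'a \<Rightarrow>\<^sub>0 'b::comm_monoid_add)"
proof -
  have "P (\<Sum>a\<in>A. Poly_Mapping.single a (Poly_Mapping.lookup x a))" if "finite A" for A
    using that by (induction A) (auto intro: assms)
  moreover have "x = (\<Sum>a\<in>Poly_Mapping.keys x. Poly_Mapping.single a (Poly_Mapping.lookup x a))"
    by (rule poly_mapping_eqI) (simp add: lookup_sum lookup_single when_def in_keys_iff)
  ultimately show ?thesis by (metis finite_keys)
qed

lemma twisted_mult_assoc: "twisted_mult (twisted_mult x y) z = twisted_mult x (twisted_mult y z)"
proof (induction x rule: poly_mapping_single_induct)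
  case (2 a f)
  show ?case
  proof (induction y rule: poly_mapping_single_induct)
    case (2 b g)
    show ?case
    proof (induction z rule: poly_mapping_single_induct)
      case (2 d h)
      have "vpow (2 * (snd a + snd b) * fst d) * (vpow (2 * snd a * fst b) * f * g) * h
          = vpow (2 * snd a * (fst b + fst d)) * f * (vpow (2 * snd b * fst d) * g * h)"
        by (simp add: distrib_left distrib_right vpow_add ac_simps)
      then show ?case
        by (simp only: twisted_mult_single twisted_term_def add.assoc fst_add snd_add)
    qed (simp_all add: twisted_mult_add_right)
  qed (simp_all add: twisted_mult_add_left twisted_mult_add_right)
qed (simp_all add: twisted_mult_add_left)

lemma twisted_mult_1:
  "twisted_mult (Poly_Mapping.single 0 1) x = x"
  "twisted_mult x (Poly_Mapping.single 0 1) = x"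
  by (induction x rule: poly_mapping_single_induct)
    (simp_all add: twisted_mult_add_left twisted_mult_add_right twisted_mult_single
      twisted_term_def vpow_0 del: single_one)

instantiation qtorus :: ring_1
begin

lift_definition zero_qtorus :: qtorus is 0 .
lift_definition one_qtorus :: qtorus is "Poly_Mapping.single 0 1" .
lift_definition plus_qtorus :: "qtorus \<Rightarrow> qtorus \<Rightarrow> qtorus" is "(+)" .
lift_definition minus_qtorus :: "qtorus \<Rightarrow> qtorus \<Rightarrow> qtorus" is "(-)" .
lift_definition uminus_qtorus :: "qtorus \<Rightarrow> qtorus" is "uminus" .
lift_definition times_qtorus :: "qtorus \<Rightarrow> qtorus \<Rightarrow> qtorus" is twisted_mult .

instance
proof
  fix x y z :: qtorus
  show "x + y + z = x + (y + z)" by transfer (rule add.assoc)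
  show "x + y = y + x" by transfer (rule add.commute)
  show "0 + x = x" by transfer simp
  show "- x + x = 0" by transfer simp
  show "x - y = x + - y" by transfer simp
  show "x * y * z = x * (y * z)" by transfer (rule twisted_mult_assoc)
  show "(x + y) * z = x * z + y * z" by transfer (rule twisted_mult_add_left)
  show "x * (y + z) = x * y + x * z" by transfer (rule twisted_mult_add_right)
  show "1 * x = x" by transfer (rule twisted_mult_1)
  show "x * 1 = x" by transfer (rule twisted_mult_1)
  show "(0::qtorus) \<noteq> 1"
    by transfer (metis lookup_single_eq lookup_zero zero_neq_one)
qed

end

text \<open>\<open>qscal f\<close> is the scalar \<open>f\<close>, and \<open>qmon i j\<close> is \<open>X\<^sub>1\<^bsup>i\<^esup> X\<^sub>2\<^bsup>j\<^esup>\<close> for integers \<open>i, j\<close>.\<close>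

definition qscal :: "laurent \<Rightarrow> qtorus" where
  "qscal f = QTorus (Poly_Mapping.single (0, 0) f)"

definition qmon :: "int \<Rightarrow> int \<Rightarrow> qtorus" where
  "qmon i j = QTorus (Poly_Mapping.single (i, j) 1)"

lemma qtorus_relation: "qmon 0 1 * qmon 1 0 = qscal (vpow 2) * (qmon 1 0 * qmon 0 1)"
  by (simp add: qmon_def qscal_def times_qtorus.abs_eq eq_onp_same_args twisted_mult_single
      twisted_term_def vpow_0)

lemma qmon_inverse:
  "qmon 1 0 * qmon (-1) 0 = 1" "qmon (-1) 0 * qmon 1 0 = 1"
  "qmon 0 1 * qmon 0 (-1) = 1" "qmon 0 (-1) * qmon 0 1 = 1"
  by (simp_all add: qmon_def times_qtorus.abs_eq one_qtorus_def eq_onp_same_args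
      twisted_mult_single twisted_term_def vpow_0 zero_prod_def)

lemma qtorus_normal_form:
  "x = (\<Sum>(i, j)\<in>Poly_Mapping.keys (qcoeffs x). qscal (Poly_Mapping.lookup (qcoeffs x) (i, j)) * qmon i j)"
proof -
  have sum: "QTorus (\<Sum>a\<in>A. g a) = (\<Sum>a\<in>A. QTorus (g a))" if "finite A"
    for A :: "(int \<times> int) set" and g
    using that by (induction A) (simp_all add: zero_qtorus_def plus_qtorus.abs_eq[symmetric] eq_onp_same_args)
  let ?x = "qcoeffs x"
  have "?x = (\<Sum>a\<in>Poly_Mapping.keys ?x. Poly_Mapping.single a (Poly_Mapping.lookup ?x a))"
    by (rule poly_mapping_eqI) (simp add: lookup_sum lookup_single when_def in_keys_iff)
  then have "x = QTorus (\<Sum>a\<in>Poly_Mapping.keys ?x. Poly_Mapping.single a (Poly_Mapping.lookup ?x a))"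
    by (metis qcoeffs_inverse)
  also have "\<dots> = (\<Sum>(i, j)\<in>Poly_Mapping.keys ?x. qscal (Poly_Mapping.lookup ?x (i, j)) * qmon i j)"
    by (subst sum) (auto intro!: sum.cong simp: qscal_def qmon_def times_qtorus.abs_eq
        eq_onp_same_args twisted_mult_single twisted_term_def vpow_0)
  finally show ?thesis .
qed

text \<open>The normalized monomial \<open>X\<^bsup>(i,j)\<^esup> = v\<^bsup>ij\<^esup> X\<^sub>1\<^bsup>i\<^esup> X\<^sub>2\<^bsup>j\<^esup>\<close>.\<close>

definition qX :: "int \<times> int \<Rightarrow> qtorus" where
  "qX a = qscal (vpow (fst a * snd a)) * qmon (fst a) (snd a)"

text \<open>The bar-involution, sending \<open>f X\<^sub>1\<^bsup>i\<^esup> X\<^sub>2\<^bsup>j\<^esup>\<close> to \<open>lbar f X\<^sub>2\<^bsup>j\<^esup> X\<^sub>1\<^bsup>i\<^esup>\<close>.\<close>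

definition qbar :: "qtorus \<Rightarrow> qtorus" where
  "qbar x = (\<Sum>(i, j)\<in>Poly_Mapping.keys (qcoeffs x).
     qscal (lbar (Poly_Mapping.lookup (qcoeffs x) (i, j))) * qmon 0 j * qmon i 0)"


section \<open>The skew-field of fractions\<close>

text \<open>A division ring together with an embedding of the quantum torus such that every element
  is a right fraction. As the quantum torus is an Ore domain, this determines the division ring
  up to a unique isomorphism over the quantum torus.\<close>

definition skew_field_of_fractions :: "(qtorus \<Rightarrow> 'f::division_ring) \<Rightarrow> bool" where
  "skew_field_of_fractions \<iota> \<longleftrightarrow>
     \<iota> 1 = 1 \<and> (\<forall>x y. \<iota> (x + y) = \<iota> x + \<iota> y) \<and> (\<forall>x y. \<iota> (x * y) = \<iota> x * \<iota> y) \<and> inj \<iota> \<and>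
     (\<forall>z. \<exists>x y. y \<noteq> 0 \<and> z = \<iota> x * inverse (\<iota> y))"


section \<open>The quantum cluster algebra of rank two\<close>

definition exch :: "nat \<Rightarrow> nat \<Rightarrow> int \<Rightarrow> nat" where
  "exch b c m = (if odd m then b else c)"

text \<open>The exchange relations
  \<open>X\<^bsub>m+1\<^esub> X\<^bsub>m-1\<^esub> = v\<^bsup>k\<^esup> X\<^sub>m\<^bsup>k\<^esup> + 1\<close> with \<open>k = exch b c m\<close> are solved for \<open>X\<^bsub>m+1\<^esub>\<close> to the right of the
  initial cluster and for \<open>X\<^bsub>m-1\<^esub>\<close> to the left of it.\<close>

function cluster_var :: "(qtorus \<Rightarrow> 'f::division_ring) \<Rightarrow> nat \<Rightarrow> nat \<Rightarrow> int \<Rightarrow> 'f" where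
  "cluster_var \<iota> b c n =
     (if n = 1 then \<iota> (qmon 1 0)
      else if n = 2 then \<iota> (qmon 0 1)
      else if n > 2 then
        (\<iota> (qscal (vpow (int (exch b c (n - 1))))) * cluster_var \<iota> b c (n - 1) ^ exch b c (n - 1) + 1)
          * inverse (cluster_var \<iota> b c (n - 2))
      else
        inverse (cluster_var \<iota> b c (n + 2)) *
        (\<iota> (qscal (vpow (int (exch b c (n + 1))))) * cluster_var \<iota> b c (n + 1) ^ exch b c (n + 1) + 1))"
  by pat_completeness auto
termination
  by (relation "Wellfounded.measure (\<lambda>(_, _, _, n). nat \<bar>2 * n - 3\<bar>)") auto

declare cluster_var.simps [simp del]

lemma cluster_var_exchange:
  assumes "cluster_var \<iota> b c (m - 1) \<noteq> 0" "cluster_var \<iota> b c (m + 1) \<noteq> 0"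
  shows "cluster_var \<iota> b c (m + 1) * cluster_var \<iota> b c (m - 1) =
    \<iota> (qscal (vpow (int (exch b c m)))) * cluster_var \<iota> b c m ^ exch b c m + 1"
proof (cases "m \<ge> 2")
  case True
  then show ?thesis
    using assms by (subst cluster_var.simps) (simp add: mult.assoc)
next
  case False
  then show ?thesis
    using assms by (subst (2) cluster_var.simps) (simp add: mult.assoc[symmetric] add.commute[of 1])
qed

inductive_set quantum_cluster_algebra :: "(qtorus \<Rightarrow> 'f::division_ring) \<Rightarrow> nat \<Rightarrow> nat \<Rightarrow> 'f set"
  for \<iota> :: "qtorus \<Rightarrow> 'f" and b c :: nat where
  scalar: "\<iota> (qscal f) \<in> quantum_cluster_algebra \<iota> b c"
| var: "cluster_var \<iota> b c m \<in> quantum_cluster_algebra \<iota> b c"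
| add: "x \<in> quantum_cluster_algebra \<iota> b c \<Longrightarrow> y \<in> quantum_cluster_algebra \<iota> b c \<Longrightarrow>
    x + y \<in> quantum_cluster_algebra \<iota> b c"
| mult: "x \<in> quantum_cluster_algebra \<iota> b c \<Longrightarrow> y \<in> quantum_cluster_algebra \<iota> b c \<Longrightarrow>
    x * y \<in> quantum_cluster_algebra \<iota> b c"

definition cluster_monomial ::
    "(qtorus \<Rightarrow> 'f::division_ring) \<Rightarrow> nat \<Rightarrow> nat \<Rightarrow> int \<Rightarrow> nat \<Rightarrow> nat \<Rightarrow> 'f" where
  "cluster_monomial \<iota> b c n s1 s2 =
     \<iota> (qscal (vpow (int s1 * int s2))) * cluster_var \<iota> b c n ^ s1 * cluster_var \<iota> b c (n + 1) ^ s2"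


section \<open>The triangular basis\<close>

definition standard_monomial ::
    "(qtorus \<Rightarrow> 'f::division_ring) \<Rightarrow> nat \<Rightarrow> nat \<Rightarrow> int \<times> int \<Rightarrow> 'f" where
  "standard_monomial \<iota> b c a = (case a of (a1, a2) \<Rightarrow>
     \<iota> (qscal (vpow (a1 * a2))) * cluster_var \<iota> b c 3 ^ nat (max a1 0)
       * cluster_var \<iota> b c 1 ^ nat (max (- a1) 0)
       * cluster_var \<iota> b c 2 ^ nat (max (- a2) 0)
       * cluster_var \<iota> b c 0 ^ nat (max a2 0))"

definition below :: "int \<times> int \<Rightarrow> (int \<times> int) set" where
  "below a = {a'. fst a' \<le> fst a \<and> snd a' \<le> snd a \<and> a' \<noteq> a}"

definition lower_part ::
    "(qtorus \<Rightarrow> 'f::division_ring) \<Rightarrow> nat \<Rightarrow> nat \<Rightarrow> int \<times> int \<Rightarrow> 'f set" where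
  "lower_part \<iota> b c a = {(\<Sum>a'\<in>S. \<iota> (qscal (f a')) * standard_monomial \<iota> b c a') | S f.
     finite S \<and> S \<subseteq> below a \<and> (\<forall>a'\<in>S. f a' \<in> vZv)}"

definition bar_invariant :: "(qtorus \<Rightarrow> 'f::division_ring) \<Rightarrow> 'f \<Rightarrow> bool" where
  "bar_invariant \<iota> z \<longleftrightarrow> (\<exists>x. z = \<iota> x \<and> qbar x = x)"

definition triangular_basis ::
    "(qtorus \<Rightarrow> 'f::division_ring) \<Rightarrow> nat \<Rightarrow> nat \<Rightarrow> (int \<times> int \<Rightarrow> 'f) \<Rightarrow> bool" where
  "triangular_basis \<iota> b c C \<longleftrightarrow> (\<forall>a. C a \<in> quantum_cluster_algebra \<iota> b c \<and>
     bar_invariant \<iota> (C a) \<and> C a - standard_monomial \<iota> b c a \<in> lower_part \<iota> b c a)"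

text \<open>\<open>e\<close> is the family of coefficients in the expansion
  \<open>z = \<Sum>\<^bsub>p,q\<^esub> e(p,q) X\<^bsup>(bp - a\<^sub>1, cq - a\<^sub>2)\<^esup>\<close>, extended by zero outside the range of summation.\<close>

definition pointed_coeffs :: "(qtorus \<Rightarrow> 'f::division_ring) \<Rightarrow> nat \<Rightarrow> nat \<Rightarrow> int \<Rightarrow> int \<Rightarrow> 'f \<Rightarrow>
    (int \<Rightarrow> int \<Rightarrow> laurent) \<Rightarrow> bool" where
  "pointed_coeffs \<iota> b c a1 a2 z e \<longleftrightarrow>
     (\<forall>p q. \<not> (0 \<le> p \<and> p \<le> max a2 0 \<and> 0 \<le> q \<and> q \<le> max a1 0) \<longrightarrow> e p q = 0) \<and>
     z = \<iota> (\<Sum>p\<in>{0..max a2 0}. \<Sum>q\<in>{0..max a1 0}.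
       qscal (e p q) * qX (int b * p - a1, int c * q - a2))"


section \<open>Denominator vectors, imaginary roots and supports\<close>

function dvec :: "nat \<Rightarrow> nat \<Rightarrow> int \<Rightarrow> int \<times> int" where
  "dvec b c n =
     (if n = 1 then (-1, 0)
      else if n = 2 then (0, -1)
      else if n > 2 then
        (int (exch b c (n - 1)) * max (fst (dvec b c (n - 1))) 0 - fst (dvec b c (n - 2)),
         int (exch b c (n - 1)) * max (snd (dvec b c (n - 1))) 0 - snd (dvec b c (n - 2)))
      else
        (int (exch b c (n + 1)) * max (fst (dvec b c (n + 1))) 0 - fst (dvec b c (n + 2)),
         int (exch b c (n + 1)) * max (snd (dvec b c (n + 1))) 0 - snd (dvec b c (n + 2))))"
  by pat_completeness auto
termination
  by (relation "Wellfounded.measure (\<lambda>(_, _, n). nat \<bar>2 * n - 3\<bar>)") auto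

declare dvec.simps [simp del]

lemma dvec_recurrence:
  "dvec b c (n + 1) + dvec b c (n - 1) =
    (int (exch b c n) * max (fst (dvec b c n)) 0, int (exch b c n) * max (snd (dvec b c n)) 0)"
proof (cases "n \<ge> 2")
  case True
  then show ?thesis by (subst dvec.simps) (simp add: prod_eq_iff)
next
  case False
  then show ?thesis by (subst (2) dvec.simps) (simp add: prod_eq_iff add.commute[of 1])
qed

definition Phi_im_plus :: "nat \<Rightarrow> nat \<Rightarrow> (int \<times> int) set" where
  "Phi_im_plus b c = {(a1, a2). a1 > 0 \<and> a2 > 0 \<and>
     int c * a1\<^sup>2 - int b * int c * a1 * a2 + int b * a2\<^sup>2 \<le> 0}"

definition Ddeg :: "nat \<Rightarrow> nat \<Rightarrow> int \<Rightarrow> int \<Rightarrow> int \<Rightarrow> int \<Rightarrow> int" where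
  "Ddeg b c a1 a2 p q =
     int c * a1 * q + int b * a2 * p - int b * p\<^sup>2 - int b * int c * p * q - int c * q\<^sup>2"

definition Ttri :: "nat \<Rightarrow> nat \<Rightarrow> int \<Rightarrow> (real \<times> real) set" where
  "Ttri b c n = convex hull
     {(0, 0), (of_int (max (snd (dvec b c n)) 0), 0), (0, of_int (max (fst (dvec b c n)) 0))}"

definition minkowski_support :: "nat \<Rightarrow> nat \<Rightarrow> int \<Rightarrow> nat \<Rightarrow> nat \<Rightarrow> (real \<times> real) set" where
  "minkowski_support b c n s1 s2 =
     {real s1 *\<^sub>R z + real s2 *\<^sub>R w | z w. z \<in> Ttri b c n \<and> w \<in> Ttri b c (n + 1)}"

end

theory Submission
  imports Defs
begin

text \<open>A vector outside the imaginary cone lies in a cone spanned by two consecutive denominator vectors.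
A change of the initial cluster acts on denominator vectors by the piecewise linear map
\<open>(k, m) \<mapsto> (b [k]\<^sub>+ - m, k)\<close>, which preserves the quadratic form of the imaginary cone
on the half plane \<open>k \<ge> 0\<close>. If this form is positive at a positive vector, then undoing one of the
two possible changes lowers the sum of the coordinates, and a vector with a nonpositive coordinate
lies in one of the three cones around the initial cluster (\<open>cluster_cones_cover\<close>).

The triangular basis contains the cluster monomials for the following reason. Let \<open>L\<close> be the
lattice spanned over \<open>\<int>[v]\<close> by the standard monomials. The standard monomials of the cluster
\<open>(X\<^sub>2, X\<^sub>3)\<close> agree modulo \<open>v L\<close> with those of \<open>(X\<^sub>1, X\<^sub>2)\<close>, up to the piecewise linear change of
the index (\<open>shifted_M\<close>). This is a computation with the variable \<open>X\<^sub>4\<close>: multiplication by \<open>X\<^sub>4\<close>,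
rescaled by a power of \<open>v\<close>, maps a standard monomial to a standard monomial modulo \<open>v L\<close>.
As a cluster monomial of the initial cluster is itself a standard monomial, induction on the number
of changes shows that each cluster monomial is congruent to the standard monomial of its denominator
vector. Finally, a bar-invariant element of \<open>v L\<close> vanishes: if \<open>a\<close> is maximal among its indices,
its coefficient at \<open>X\<^bsup>-a\<^esup>\<close> is bar-invariant and lies in \<open>v \<int>[v]\<close>
(\<open>bar_invariant_combination_zero\<close>).

The support and the degrees are followed through the same changes of cluster. An expansion in
\<open>(X\<^sub>2, X\<^sub>3)\<close> is sorted by the powers of \<open>X\<^sub>3\<close>; the coefficient of such a power is a Laurent polynomial
in \<open>X\<^sub>2\<close>, called a row. Substituting \<open>X\<^sub>3 = X\<^sub>1\<^bsup>-1\<^esup> (1 + v\<^bsup>-c\<^esup> X\<^sub>2\<^bsup>c\<^esup>)\<close> multiplies or divides each row by factors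
\<open>1 + v\<^bsup>-c(2t+1)\<^esup> X\<^sub>2\<^bsup>c\<^esup>\<close> (\<open>row_relation\<close>). The degrees in \<open>v\<close> along a row form a strictly concave sequence,
with differences \<open>-c(2t+1)\<close> for \<open>t\<close> in an interval. The factors belong to an interval adjacent to
it or to an initial segment of it. So no cancellation of leading terms occurs, the
interval grows or shrinks, and the degrees stay on the parabola \<open>D\<close> (\<open>row_degrees_times\<close>,
\<open>row_degrees_divide\<close>). The rows of the Minkowski sums of triangles change their lengths by the same
amounts (\<open>support_rows\<close>).

Cluster monomials to the left of the initial cluster are treated by passing to the opposite ring,
in which the sequence of cluster variables is reversed.\<close>

abbreviation (input) "lookup \<equiv> Poly_Mapping.lookup"
abbreviation (input) "keys \<equiv> Poly_Mapping.keys"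
abbreviation (input) "single \<equiv> Poly_Mapping.single"

section \<open>Denominator vectors\<close>

text \<open>The coordinates of the denominator vectors for \<open>(b, c)\<close> are values of a single integer sequence,
up to a factor \<open>b\<close> or \<open>c\<close> at the indices of one parity. With the exchange exponents \<open>1\<close> and \<open>b c\<close>
these factors disappear from the first coordinate.\<close>

definition rank_seq :: "nat \<Rightarrow> int \<Rightarrow> int" where
  "rank_seq N n = fst (dvec 1 N n)"

lemma rank_seq_recurrence:
  "rank_seq N (n + 1) + rank_seq N (n - 1) = (if odd n then 1 else int N) * max (rank_seq N n) 0"
  using arg_cong[OF dvec_recurrence[of 1 N n], of fst]
  by (simp add: rank_seq_def exch_def)

lemma rank_seq_1 [simp]: "rank_seq N 1 = -1"
  and rank_seq_2 [simp]: "rank_seq N 2 = 0"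
  by (simp_all add: rank_seq_def dvec.simps)

lemma rank_seq_up: "rank_seq N (n + 2) = (if odd n then int N else 1) * max (rank_seq N (n + 1)) 0 - rank_seq N n"
  using rank_seq_recurrence[of N "n + 1"] by (auto simp: algebra_simps)

lemma rank_seq_down: "rank_seq N (n - 1) = (if odd n then 1 else int N) * max (rank_seq N n) 0 - rank_seq N (n + 1)"
  using rank_seq_recurrence[of N n] by (auto simp: algebra_simps)

lemma rank_seq_0 [simp]: "rank_seq N 0 = 0"
  using rank_seq_down[of N 1] by simp

lemma two_sided_induct:
  assumes "P 1" "\<And>n::int. P n \<Longrightarrow> P (n + 1)" "\<And>n. P n \<Longrightarrow> P (n - 1)"
  shows "P n"
  using assms by (induction n rule: int_induct[where k = 1]) auto

lemma rank_seq_symmetric: "rank_seq N (2 - n) = rank_seq N n"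
proof -
  have "rank_seq N (2 - n) = rank_seq N n \<and> rank_seq N (1 - n) = rank_seq N (n + 1)"
  proof (induction n rule: two_sided_induct)
    case (2 n)
    have "rank_seq N (1 - n - 1) = rank_seq N (n + 2)"
      unfolding rank_seq_up rank_seq_down[of N "1 - n"] using 2 by simp
    then show ?case using 2 by (simp add: algebra_simps)
  next
    case (3 n)
    have "rank_seq N (1 - n + 2) = rank_seq N (n - 1)"
      unfolding rank_seq_up rank_seq_down[of N n] using 3 by simp
    then show ?case using 3 by (simp add: algebra_simps)
  qed simp
  then show ?thesis by simp
qed

text \<open>The recurrence replaces one of two neighbours by the other root of a quadratic equation in it. The
invariant form behind this is \<open>N x\<^sup>2 - N x y + y\<^sup>2\<close>, where \<open>x\<close> has even and \<open>y\<close> has odd index.\<close>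

definition rank_form :: "nat \<Rightarrow> int \<Rightarrow> int" where
  "rank_form N n = (let x = rank_seq N (if odd n then n + 1 else n); y = rank_seq N (if odd n then n else n + 1)
     in int N * x\<^sup>2 - int N * x * y + y\<^sup>2)"

text \<open>For neighbours of opposite signs all three terms of the form would be positive integers.\<close>

lemma rank_form_signs:
  assumes "N > 0" "rank_form N n = 1"
  shows "rank_seq N n * rank_seq N (n + 1) \<ge> 0"
proof (rule ccontr)
  assume neg: "\<not> ?thesis"
  define x y where "x = rank_seq N (if odd n then n + 1 else n)" and "y = rank_seq N (if odd n then n else n + 1)"
  have "x * y < 0" using neg by (auto simp: x_def y_def mult.commute split: if_splits)
  moreover have "int N * x\<^sup>2 - int N * x * y + y\<^sup>2 = 1"
    using assms(2) by (simp add: rank_form_def x_def y_def Let_def)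
  moreover have "int N * (x * y) \<le> x * y"
    using \<open>x * y < 0\<close> \<open>N > 0\<close> by (smt (verit) mult_le_cancel_right1 mult.commute of_nat_0_less_iff int_one_le_iff_zero_less mult_minus_right)
  moreover have "x \<noteq> 0" "y \<noteq> 0" using \<open>x * y < 0\<close> by auto
  then have "x\<^sup>2 > 0" "y\<^sup>2 > 0" by auto
  moreover have "int N * x\<^sup>2 > 0" using \<open>x\<^sup>2 > 0\<close> \<open>N > 0\<close> by simp
  ultimately show False by (simp add: mult.assoc)
qed

text \<open>A step over a nonnegative term preserves the form. A negative term has
neighbours that are neither positive (by the form) nor negative (by induction), so that they vanish.
This argument treats finite and infinite types alike.\<close>

lemma rank_seq_signs:
  assumes "N > 0"
  shows "rank_form N n = 1 \<and> \<not> (rank_seq N n < 0 \<and> rank_seq N (n + 1) < 0)"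
proof (induction n rule: two_sided_induct)
  case 1
  then show ?case by (simp add: rank_form_def)
next
  case (2 n)
  note s = rank_form_signs[OF assms conjunct1[OF 2]]
  show ?case
  proof (cases "rank_seq N (n + 1) < 0")
    case True
    then have "rank_seq N n = 0" using s 2 by (smt (verit) mult_less_0_iff)
    then have "rank_seq N (n + 2) = rank_seq N n" using True by (simp add: rank_seq_up)
    then show ?thesis using 2 True \<open>rank_seq N n = 0\<close>
      by (cases "odd n") (simp_all add: rank_form_def add.assoc Let_def)
  next
    case False
    then have "rank_seq N (n + 2) = (if odd n then int N else 1) * rank_seq N (n + 1) - rank_seq N n"
      by (simp add: rank_seq_up)
    then have "rank_form N (n + 1) = rank_form N n"
      by (auto simp: rank_form_def add.assoc Let_def) (simp_all add: algebra_simps power2_eq_square)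
    then show ?thesis using 2 False by simp
  qed
next
  case (3 n)
  note s = rank_form_signs[OF assms conjunct1[OF 3]]
  show ?case
  proof (cases "rank_seq N n < 0")
    case True
    then have "rank_seq N (n + 1) = 0" using s 3 by (smt (verit) mult_less_0_iff)
    then have "rank_seq N (n - 1) = rank_seq N (n + 1)" using True by (simp add: rank_seq_down)
    then show ?thesis using 3 True \<open>rank_seq N (n + 1) = 0\<close>
      by (cases "odd n") (simp_all add: rank_form_def Let_def)
  next
    case False
    then have "rank_seq N (n - 1) = (if odd n then 1 else int N) * rank_seq N n - rank_seq N (n + 1)"
      by (simp add: rank_seq_down)
    then have "rank_form N (n - 1) = rank_form N n"
      by (auto simp: rank_form_def add.assoc Let_def) (simp_all add: algebra_simps power2_eq_square)
    then show ?thesis using 3 False by simp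
  qed
qed

lemma rank_seq_product_nonneg: "N > 0 \<Longrightarrow> rank_seq N n * rank_seq N (n + 1) \<ge> 0"
  using rank_form_signs rank_seq_signs by blast

lemma rank_seq_negative:
  assumes "N > 0" "rank_seq N n < 0"
  shows "rank_seq N n = -1" "rank_seq N (n - 1) = 0" "rank_seq N (n + 1) = 0" "even n \<Longrightarrow> N = 1"
proof -
  show next0: "rank_seq N (n + 1) = 0"
    using rank_seq_product_nonneg[OF assms(1), of n] rank_seq_signs[OF assms(1), of n] assms(2)
    by (smt (verit) mult_less_0_iff)
  then show "rank_seq N (n - 1) = 0" using assms by (simp add: rank_seq_down)
  have "rank_form N n = 1" using rank_seq_signs[OF assms(1)] by blast
  then have "(rank_seq N n)\<^sup>2 = 1 \<and> (even n \<longrightarrow> N = 1)"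
    using next0 by (cases "odd n") (auto simp: rank_form_def zmult_eq_1_iff)
  then show "rank_seq N n = -1" "even n \<Longrightarrow> N = 1" using assms(2) by (auto simp: power2_eq_1_iff)
qed

lemma max_nat_mult: "max (int k * x) 0 = int k * max x 0"
  by (auto simp: max_def mult_le_0_iff zero_le_mult_iff)

lemma dvec_rank_seq:
  "dvec b c n = (if odd n then (rank_seq (b * c) n, int c * rank_seq (b * c) (n - 1))
     else (int b * rank_seq (b * c) n, rank_seq (b * c) (n - 1)))"
proof -
  let ?u = "rank_seq (b * c)"
  let ?D = "\<lambda>n. if odd n then (?u n, int c * ?u (n - 1)) else (int b * ?u n, ?u (n - 1))"
  have step: "?D (n + 1) + ?D (n - 1) =
      (int (exch b c n) * max (fst (?D n)) 0, int (exch b c n) * max (snd (?D n)) 0)" for n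
    using rank_seq_recurrence[of "b * c" n] rank_seq_recurrence[of "b * c" "n - 1"]
    by (auto simp: exch_def max_nat_mult algebra_simps simp flip: distrib_left)
  define D where "D = ?D"
  have D_step: "D (n + 1) + D (n - 1) = dvec b c (n + 1) + dvec b c (n - 1)" if "dvec b c n = D n" for n
    unfolding dvec_recurrence that unfolding D_def by (rule step)
  have "dvec b c n = D n \<and> dvec b c (n + 1) = D (n + 1)"
  proof (induction n rule: two_sided_induct)
    case 1
    then show ?case by (simp add: D_def dvec.simps)
  next
    case (2 n)
    then show ?case using D_step[of "n + 1"] by (simp add: add.assoc)
  next
    case (3 n)
    then show ?case using D_step[of n] by simp
  qed
  then show ?thesis by (simp add: D_def)
qed

text \<open>The denominator vectors for two adjacent initial clusters differ by a piecewise linear map.\<close>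

lemma dvec_shift:
  "dvec b c (n + 1) = (int b * max (fst (dvec c b n)) 0 - snd (dvec c b n), fst (dvec c b n))"
proof -
  show ?thesis
    using rank_seq_recurrence[of "b * c" n]
    by (auto simp: dvec_rank_seq max_nat_mult mult.commute[of c b] algebra_simps simp flip: distrib_left)
qed

lemma dvec_reflect: "dvec b c (3 - n) = prod.swap (dvec c b n)"
proof -
  have "rank_seq (b * c) (3 - n) = rank_seq (b * c) (n - 1)"
    using rank_seq_symmetric[of "b * c" "n - 1"] by (simp add: algebra_simps)
  then show ?thesis
    using rank_seq_symmetric[of "b * c" n]
    by (auto simp: dvec_rank_seq mult.commute[of c b] algebra_simps)
qed

definition real_or_initial :: "int \<times> int \<Rightarrow> bool" where
  "real_or_initial d \<longleftrightarrow> fst d \<ge> 0 \<and> snd d \<ge> 0 \<or> d = (-1, 0) \<or> d = (0, -1)"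

lemma dvec_real_or_initial:
  assumes "b > 0" "c > 0"
  shows "real_or_initial (dvec b c n)"
proof -
  have N: "b * c > 0" using assms by simp
  note neg = rank_seq_negative[OF N]
  show ?thesis
    using neg[of n] neg[of "n - 1"] assms
    by (cases "rank_seq (b * c) n < 0"; cases "rank_seq (b * c) (n - 1) < 0")
      (auto simp: real_or_initial_def dvec_rank_seq)
qed

text \<open>Consecutive denominator vectors never have coordinates of strictly opposite signs, hence positive
parts are additive on the cones that they span.\<close>

lemma dvec_sign_coherent:
  assumes "b > 0" "c > 0"
  shows "max (int s1 * fst (dvec b c n) + int s2 * fst (dvec b c (n + 1))) 0 =
      int s1 * max (fst (dvec b c n)) 0 + int s2 * max (fst (dvec b c (n + 1))) 0" (is ?fst)
    and "max (int s1 * snd (dvec b c n) + int s2 * snd (dvec b c (n + 1))) 0 =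
      int s1 * max (snd (dvec b c n)) 0 + int s2 * max (snd (dvec b c (n + 1))) 0" (is ?snd)
proof -
  have N: "b * c > 0" using assms by simp
  have add: "max (int s1 * x + int s2 * y) 0 = int s1 * max x 0 + int s2 * max y 0" if "x * y \<ge> 0" for x y
  proof (cases "x \<ge> 0 \<and> y \<ge> 0")
    case True
    then show ?thesis by simp
  next
    case False
    then have "x \<le> 0 \<and> y \<le> 0" using that by (auto simp: zero_le_mult_iff)
    then have "int s1 * x \<le> 0" "int s2 * y \<le> 0" by (simp_all add: mult_nonneg_nonpos)
    then show ?thesis using \<open>x \<le> 0 \<and> y \<le> 0\<close> by simp
  qed
  have pr: "rank_seq (b * c) n * rank_seq (b * c) (n + 1) \<ge> 0"
      "rank_seq (b * c) (n - 1) * rank_seq (b * c) n \<ge> 0"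
    using rank_seq_product_nonneg[OF N, of n] rank_seq_product_nonneg[OF N, of "n - 1"] by simp_all
  have "fst (dvec b c n) * fst (dvec b c (n + 1)) = int b * (rank_seq (b * c) n * rank_seq (b * c) (n + 1))"
    "snd (dvec b c n) * snd (dvec b c (n + 1)) = int c * (rank_seq (b * c) (n - 1) * rank_seq (b * c) n)"
    by (auto simp: dvec_rank_seq)
  then show ?fst ?snd using pr by (auto intro!: add simp del: mult_eq_0_iff)
qed

section \<open>The cones of consecutive denominator vectors\<close>

definition in_cluster_cone :: "nat \<Rightarrow> nat \<Rightarrow> int \<Rightarrow> nat \<Rightarrow> nat \<Rightarrow> int \<times> int \<Rightarrow> bool" where
  "in_cluster_cone b c n s1 s2 a \<longleftrightarrow>
     fst a = int s1 * fst (dvec b c n) + int s2 * fst (dvec b c (n + 1)) \<and>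
     snd a = int s1 * snd (dvec b c n) + int s2 * snd (dvec b c (n + 1))"

lemma in_cluster_cone_shift:
  assumes "b > 0" "c > 0" "in_cluster_cone c b n s1 s2 a"
  shows "in_cluster_cone b c (n + 1) s1 s2 (int b * max (fst a) 0 - snd a, fst a)"
  using dvec_sign_coherent(1)[OF assms(2,1), of s1 n s2] assms(3)
  unfolding in_cluster_cone_def dvec_shift[of b c n] dvec_shift[of b c "n + 1"]
  by (simp add: algebra_simps)

lemma in_cluster_cone_reflect:
  assumes "in_cluster_cone c b n s1 s2 a"
  shows "in_cluster_cone b c (2 - n) s2 s1 (prod.swap a)"
  using assms dvec_reflect[of b c n] dvec_reflect[of b c "n + 1"]
  by (simp add: in_cluster_cone_def algebra_simps)

lemma dvec_initial: "dvec b c 0 = (0, 1)" "dvec b c 1 = (-1, 0)" "dvec b c 2 = (0, -1)" "dvec b c 3 = (1, 0)"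
  using dvec_shift[of b c 2] dvec_reflect[of c b 3] by (simp_all add: dvec.simps)

lemma in_cluster_cone_nonpositive:
  assumes "fst a \<le> 0 \<or> snd a \<le> 0"
  shows "\<exists>n s1 s2. in_cluster_cone b c n s1 s2 a"
proof -
  consider "fst a \<le> 0" "snd a \<le> 0" | "fst a \<ge> 0" "snd a \<le> 0" | "fst a \<le> 0" "snd a \<ge> 0"
    using assms by linarith
  then show ?thesis
  proof cases
    case 1
    then have "in_cluster_cone b c 1 (nat (- fst a)) (nat (- snd a)) a"
      by (simp add: in_cluster_cone_def dvec_initial)
    then show ?thesis by blast
  next
    case 2
    then have "in_cluster_cone b c 2 (nat (- snd a)) (nat (fst a)) a"
      by (simp add: in_cluster_cone_def dvec_initial)
    then show ?thesis by blast
  next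
    case 3
    then have "in_cluster_cone b c 0 (nat (snd a)) (nat (- fst a)) a"
      by (simp add: in_cluster_cone_def dvec_initial)
    then show ?thesis by blast
  qed
qed

text \<open>The exchange \<open>(x, y) \<mapsto> (y, b y - x)\<close> preserves the quadratic form that defines the imaginary cone
and lowers the sum of the coordinates if \<open>b y < 2 x\<close>. If neither this nor the mirrored inequality
holds, then the form is nonpositive.\<close>

lemma cluster_cones_cover:
  assumes "b > 0" "c > 0" "a \<notin> Phi_im_plus b c"
  shows "\<exists>n s1 s2. in_cluster_cone b c n s1 s2 a"
  using assms
proof (induction "nat (fst a + snd a)" arbitrary: a b c rule: less_induct)
  case less
  show ?case
  proof (cases "fst a \<le> 0 \<or> snd a \<le> 0")
    case True
    then show ?thesis by (rule in_cluster_cone_nonpositive)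
  next
    case pos: False
    \<comment> \<open>\<open>(x, y)\<close> is the image of \<open>(y, b' y - x)\<close> under an exchange of the initial cluster.\<close>
    have descend: "\<exists>n s1 s2. in_cluster_cone b' c' n s1 s2 (x, y)"
      if "b' > 0" "c' > 0" "(x, y) \<notin> Phi_im_plus b' c'" "x > 0" "y > 0" "x + y = fst a + snd a" "int b' * y < 2 * x"
      for b' c' x y
    proof -
      have "\<exists>n s1 s2. in_cluster_cone c' b' n s1 s2 (y, int b' * y - x)"
      proof (rule less.hyps)
        show "nat (fst (y, int b' * y - x) + snd (y, int b' * y - x)) < nat (fst a + snd a)"
          using that by simp
        have "int b' * y\<^sup>2 - int c' * int b' * y * (int b' * y - x) + int c' * (int b' * y - x)\<^sup>2 =
            int c' * x\<^sup>2 - int b' * int c' * x * y + int b' * y\<^sup>2"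
          by (simp add: power2_eq_square algebra_simps)
        then show "(y, int b' * y - x) \<notin> Phi_im_plus c' b'"
          using that by (auto simp: Phi_im_plus_def)
      qed (use that in auto)
      then show ?thesis
        using in_cluster_cone_shift[OF that(1,2)] that by fastforce
    qed
    show ?thesis
    proof (cases "int b * snd a < 2 * fst a")
      case True
      then show ?thesis using descend[of b c "fst a" "snd a"] less.prems pos by auto
    next
      case b_large: False
      have "int c * fst a < 2 * snd a"
      proof (rule ccontr)
        assume c_large: "\<not> ?thesis"
        have "int c * fst a * (2 * fst a - int b * snd a) + int b * snd a * (2 * snd a - int c * fst a) \<le> 0"
          using b_large c_large pos by (intro add_nonpos_nonpos mult_nonneg_nonpos) auto
        then have "int c * (fst a)\<^sup>2 - int b * int c * fst a * snd a + int b * (snd a)\<^sup>2 \<le> 0"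
          by (simp add: power2_eq_square algebra_simps)
        then show False using less.prems pos by (auto simp: Phi_im_plus_def case_prod_beta)
      qed
      moreover have "(snd a, fst a) \<notin> Phi_im_plus c b"
        using less.prems by (auto simp: Phi_im_plus_def case_prod_beta algebra_simps)
      ultimately have "\<exists>n s1 s2. in_cluster_cone c b n s1 s2 (snd a, fst a)"
        using descend[of c b "snd a" "fst a"] less.prems pos by auto
      then show ?thesis using in_cluster_cone_reflect by fastforce
    qed
  qed
qed

section \<open>Rows of the Minkowski sums\<close>

text \<open>The inequalities of a multiple of the triangle of \<open>d\<close>. The upper bounds on \<open>x\<close> and \<open>y\<close>
serve the triangles with a leg of length zero, which the last inequality does not cut out.\<close>

definition scaled_triangle :: "real \<Rightarrow> int \<times> int \<Rightarrow> real \<Rightarrow> real \<Rightarrow> bool" where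
  "scaled_triangle s d x y \<longleftrightarrow> (let k = of_int (max (snd d) 0); m = of_int (max (fst d) 0) in
     0 \<le> x \<and> x \<le> s * k \<and> 0 \<le> y \<and> y \<le> s * m \<and> x * m + y * k \<le> s * m * k)"

lemma scaled_triangle_iff:
  assumes "s \<ge> 0"
  shows "scaled_triangle s (dvec b c n) x y \<longleftrightarrow> (\<exists>z\<in>Ttri b c n. (x, y) = s *\<^sub>R z)"
proof -
  define k m :: real where "k = of_int (max (snd (dvec b c n)) 0)" and "m = of_int (max (fst (dvec b c n)) 0)"
  have km: "k \<ge> 0" "m \<ge> 0" by (simp_all add: k_def m_def)
  have hull: "(u, w) \<in> Ttri b c n \<longleftrightarrow> (\<exists>\<beta> \<gamma>. 0 \<le> \<beta> \<and> 0 \<le> \<gamma> \<and> \<beta> + \<gamma> \<le> 1 \<and> u = \<beta> * k \<and> w = \<gamma> * m)" for u w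
  proof
    assume "(u, w) \<in> Ttri b c n"
    then show "\<exists>\<beta> \<gamma>. 0 \<le> \<beta> \<and> 0 \<le> \<gamma> \<and> \<beta> + \<gamma> \<le> 1 \<and> u = \<beta> * k \<and> w = \<gamma> * m"
      unfolding Ttri_def k_def[symmetric] m_def[symmetric] convex_hull_3 by (auto simp: algebra_simps) force
  next
    assume "\<exists>\<beta> \<gamma>. 0 \<le> \<beta> \<and> 0 \<le> \<gamma> \<and> \<beta> + \<gamma> \<le> 1 \<and> u = \<beta> * k \<and> w = \<gamma> * m"
    then obtain \<beta> \<gamma> where *: "0 \<le> \<beta>" "0 \<le> \<gamma>" "\<beta> + \<gamma> \<le> 1" "u = \<beta> * k" "w = \<gamma> * m" by blast
    show "(u, w) \<in> Ttri b c n"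
      unfolding Ttri_def k_def[symmetric] m_def[symmetric] convex_hull_3 mem_Collect_eq
      by (rule exI[of _ "1 - \<beta> - \<gamma>"], rule exI[of _ \<beta>], rule exI[of _ \<gamma>]) (use * in auto)
  qed
  show ?thesis
  proof
    assume L: "scaled_triangle s (dvec b c n) x y"
    then have bd: "0 \<le> x" "x \<le> s * k" "0 \<le> y" "y \<le> s * m" "x * m + y * k \<le> s * m * k"
      by (auto simp: scaled_triangle_def k_def m_def Let_def)
    show "\<exists>z\<in>Ttri b c n. (x, y) = s *\<^sub>R z"
    proof (cases "s = 0")
      case True
      have "(0, 0) \<in> Ttri b c n" unfolding hull by (intro exI[of _ 0]) simp
      then show ?thesis using bd True by (intro bexI[of _ "(0, 0)"]) auto
    next
      case False
      define \<beta> \<gamma> where "\<beta> = x / (s * k)" and "\<gamma> = y / (s * m)"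
      have s: "s > 0" using False assms by simp
      have "0 \<le> \<beta>" "0 \<le> \<gamma>" using bd s km by (simp_all add: \<beta>_def \<gamma>_def)
      moreover have "\<beta> + \<gamma> \<le> 1"
      proof (cases "k = 0 \<or> m = 0")
        case True
        then show ?thesis using bd s km by (auto simp: \<beta>_def \<gamma>_def divide_le_eq_1)
      next
        case False
        then have "\<beta> + \<gamma> = (x * m + y * k) / (s * m * k)" using s by (simp add: \<beta>_def \<gamma>_def field_simps)
        also have "\<dots> \<le> 1" using bd s km False by (simp add: divide_le_eq_1)
        finally show ?thesis .
      qed
      moreover have "x / s = \<beta> * k" "y / s = \<gamma> * m"
        using bd s by (auto simp: \<beta>_def \<gamma>_def)
      ultimately have "(x / s, y / s) \<in> Ttri b c n" unfolding hull by blast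
      then show ?thesis using s by (intro bexI[of _ "(x / s, y / s)"]) auto
    qed
  next
    assume "\<exists>z\<in>Ttri b c n. (x, y) = s *\<^sub>R z"
    then obtain \<beta> \<gamma> where bg: "0 \<le> \<beta>" "0 \<le> \<gamma>" "\<beta> + \<gamma> \<le> 1" and xy: "x = s * (\<beta> * k)" "y = s * (\<gamma> * m)"
      using hull by fastforce
    have "\<beta> \<le> 1" "\<gamma> \<le> 1" using bg by auto
    then have "\<beta> * k \<le> k" "\<gamma> * m \<le> m" using km by (simp_all add: mult_left_le_one_le bg)
    moreover have "x * m + y * k = (s * m * k) * (\<beta> + \<gamma>)" by (simp add: xy algebra_simps)
    moreover have "(s * m * k) * (\<beta> + \<gamma>) \<le> s * m * k" using bg km assms by (simp add: mult_left_le)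
    ultimately show "scaled_triangle s (dvec b c n) x y"
      using bg km assms unfolding scaled_triangle_def k_def[symmetric] m_def[symmetric] Let_def
      by (simp add: xy mult_left_mono)
  qed
qed

lemma minkowski_support_iff:
  "(x, y) \<in> minkowski_support b c n s1 s2 \<longleftrightarrow>
    (\<exists>x1 y1 x2 y2. x = x1 + x2 \<and> y = y1 + y2 \<and>
      scaled_triangle (real s1) (dvec b c n) x1 y1 \<and> scaled_triangle (real s2) (dvec b c (n + 1)) x2 y2)"
proof -
  have "(x, y) \<in> minkowski_support b c n s1 s2 \<longleftrightarrow> (\<exists>z\<in>Ttri b c n. \<exists>w\<in>Ttri b c (n + 1).
      (x, y) = real s1 *\<^sub>R z + real s2 *\<^sub>R w)"
    unfolding minkowski_support_def by blast
  also have "\<dots> \<longleftrightarrow> (\<exists>x1 y1 x2 y2. (x, y) = (x1, y1) + (x2, y2) \<and>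
      (\<exists>z\<in>Ttri b c n. (x1, y1) = real s1 *\<^sub>R z) \<and> (\<exists>w\<in>Ttri b c (n + 1). (x2, y2) = real s2 *\<^sub>R w))"
    by (simp add: Bex_def) (metis add_Pair surj_pair)
  finally show ?thesis by (simp add: scaled_triangle_iff)
qed


text \<open>The mutation turns the triangle of \<open>(k, m)\<close> into that of \<open>(b [k]\<^sub>+ - m, k)\<close> row by row: the row at height
\<open>q\<close> becomes the column at \<open>s [k]\<^sub>+ - q\<close>, and its length changes by the affine function
\<open>b q - s m\<close>. For \<open>k > 0\<close> the two lengths are \<open>m (s - q / k)\<close> and
\<open>(b k - m) q / k\<close>.\<close>

lemma triangle_rows:
  assumes ok: "real_or_initial (k, m)" "real_or_initial (int b * max k 0 - m, k)"
    and s: "s \<ge> 0" and q: "0 \<le> q" "q \<le> s * of_int (max k 0)"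
  obtains \<eta> where "0 \<le> \<eta>" "0 \<le> \<eta> + (real b * q - s * of_int m)"
    "\<And>t. scaled_triangle s (k, m) t q \<longleftrightarrow> 0 \<le> t \<and> t \<le> \<eta>"
    "\<And>u. scaled_triangle s (int b * max k 0 - m, k) (s * of_int (max k 0) - q) u \<longleftrightarrow>
        0 \<le> u \<and> u \<le> \<eta> + (real b * q - s * of_int m)"
proof (cases "k > 0 \<and> s > 0")
  case True
  then have k: "k > 0" and s0: "s > 0" by auto
  have m: "m \<ge> 0" using ok(1) k by (auto simp: real_or_initial_def)
  have bk: "int b * k - m \<ge> 0" using ok(2) k by (auto simp: real_or_initial_def)
  define K M where "K = (of_int k :: real)" and "M = (of_int m :: real)"
  have K: "K > 0" "M \<ge> 0" "real b * K - M \<ge> 0"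
  proof -
    show "K > 0" "M \<ge> 0" using k m by (simp_all add: K_def M_def)
    have "real_of_int (int b * k - m) \<ge> 0" using bk by (simp only: of_int_0_le_iff)
    then show "real b * K - M \<ge> 0" by (simp add: K_def M_def)
  qed
  define \<eta> where "\<eta> = M * (s - q / K)"
  have qK: "q / K \<le> s" "0 \<le> q / K" using q k K by (simp_all add: K_def field_simps)
  have e0: "0 \<le> \<eta>" using K qK by (simp add: \<eta>_def)
  have new: "\<eta> + (real b * q - s * M) = (real b * K - M) * (q / K)"
    using K by (simp add: \<eta>_def field_simps)
  have "0 \<le> M * (q / K)" using K qK by (intro mult_nonneg_nonneg) auto
  then have "M * (s - q / K) \<le> s * M" by (simp add: algebra_simps)
  then have le_old: "t \<le> \<eta> \<Longrightarrow> t \<le> s * M" for t by (simp add: \<eta>_def)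
  have eqv_old: "t * K + q * M \<le> s * K * M \<longleftrightarrow> t \<le> \<eta>" for t
    using K by (simp add: \<eta>_def field_simps)
  have old_iff: "scaled_triangle s (k, m) t q \<longleftrightarrow> 0 \<le> t \<and> t \<le> \<eta>" for t
  proof -
    have "real_of_int (max (fst (k, m)) 0) = K" "real_of_int (max (snd (k, m)) 0) = M" "real_of_int (max k 0) = K"
      using k m by (simp_all add: K_def M_def)
    then show ?thesis
      using q le_old[of t] eqv_old[of t] unfolding scaled_triangle_def Let_def by auto
  qed
  have "(real b * K - M) * (q / K) \<le> (real b * K - M) * s" using K qK by (intro mult_left_mono) auto
  then have le: "u \<le> (real b * K - M) * (q / K) \<Longrightarrow> u \<le> s * (real b * K - M)" for u
    by (simp add: mult.commute)
  have eqv: "(s * K - q) * (real b * K - M) + u * K \<le> s * (real b * K - M) * K \<longleftrightarrow> u \<le> (real b * K - M) * (q / K)" for u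
    using K by (simp add: field_simps)
  have new_iff: "scaled_triangle s (int b * max k 0 - m, k) (s * of_int (max k 0) - q) u \<longleftrightarrow>
        0 \<le> u \<and> u \<le> (real b * K - M) * (q / K)" for u
  proof -
    have "real_of_int (max (fst (int b * max k 0 - m, k)) 0) = real b * K - M"
      "real_of_int (max (snd (int b * max k 0 - m, k)) 0) = K" "real_of_int (max k 0) = K"
      using k bk by (simp_all add: K_def M_def)
    then show ?thesis
      using q k le[of u] eqv[of u] unfolding scaled_triangle_def Let_def by (auto simp: K_def)
  qed
  show thesis
  proof (rule that[of \<eta>])
    have new': "\<eta> + (real b * q - s * of_int m) = (real b * K - M) * (q / K)"
      using new unfolding M_def .
    show "0 \<le> \<eta> + (real b * q - s * of_int m)" unfolding new' using K qK by (intro mult_nonneg_nonneg)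
    show "scaled_triangle s (int b * max k 0 - m, k) (s * of_int (max k 0) - q) u \<longleftrightarrow>
        0 \<le> u \<and> u \<le> \<eta> + (real b * q - s * of_int m)" for u
      unfolding new' by (rule new_iff)
  qed (rule e0 old_iff)+
next
  case False
  then have q0: "q = 0" using q s by (cases "k > 0") (auto simp: max_def split: if_splits)
  show thesis
  proof (cases "s = 0")
    case True
    show thesis by (rule that[of 0]) (auto simp: scaled_triangle_def Let_def q0 True)
  next
    case False
    then have k: "k \<le> 0" using \<open>\<not> (k > 0 \<and> s > 0)\<close> s by auto
    have "k = 0 \<and> m \<in> {0, 1, -1} \<or> (k, m) = (-1, 0)"
      using ok k by (auto simp: real_or_initial_def)
    then consider "k = 0" "m = 0" | "k = 0" "m = 1" | "k = 0" "m = -1" | "k = -1" "m = 0" by auto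
    then show thesis
    proof cases
      case 1 show thesis by (rule that[of 0]) (auto simp: scaled_triangle_def Let_def q0 1)
    next
      case 2 show thesis by (rule that[of s]) (use s in \<open>auto simp: scaled_triangle_def Let_def q0 2\<close>)
    next
      case 3 show thesis by (rule that[of 0]) (use s in \<open>auto simp: scaled_triangle_def Let_def q0 3\<close>)
    next
      case 4 show thesis by (rule that[of 0]) (auto simp: scaled_triangle_def Let_def q0 4)
    qed
  qed
qed

lemma scaled_triangle_bounds:
  assumes "scaled_triangle s d x y"
  shows "0 \<le> x" "x \<le> s * of_int (max (snd d) 0)" "0 \<le> y" "y \<le> s * of_int (max (fst d) 0)"
  using assms by (auto simp: scaled_triangle_def Let_def)

lemma split_interval_sum:
  fixes \<eta>1 \<eta>2 t :: real
  assumes "0 \<le> \<eta>1" "0 \<le> \<eta>2" "0 \<le> t" "t \<le> \<eta>1 + \<eta>2"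
  obtains t1 t2 where "t = t1 + t2" "0 \<le> t1" "t1 \<le> \<eta>1" "0 \<le> t2" "t2 \<le> \<eta>2"
  using that[of "min t \<eta>1" "t - min t \<eta>1"] assms by auto

lemma scaled_triangle_shrink:
  assumes "scaled_triangle s d x y" "0 \<le> x'" "x' \<le> x" "0 \<le> y'" "y' \<le> y"
  shows "scaled_triangle s d x' y'"
proof -
  define k m where "k = real_of_int (max (snd d) 0)" and "m = real_of_int (max (fst d) 0)"
  have "0 \<le> k" "0 \<le> m" by (simp_all add: k_def m_def)
  then have "x' * m \<le> x * m" "y' * k \<le> y * k" using assms by (simp_all add: mult_right_mono)
  then show ?thesis
    using assms unfolding scaled_triangle_def Let_def k_def[symmetric] m_def[symmetric] by linarith
qed

lemma minkowski_support_shrink: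
  assumes "(x, y) \<in> minkowski_support b c n s1 s2" "0 \<le> x'" "x' \<le> x" "0 \<le> y'" "y' \<le> y"
  shows "(x', y') \<in> minkowski_support b c n s1 s2"
proof -
  obtain x1 y1 x2 y2 where *: "x = x1 + x2" "y = y1 + y2"
      "scaled_triangle (real s1) (dvec b c n) x1 y1" "scaled_triangle (real s2) (dvec b c (n + 1)) x2 y2"
    using assms(1) unfolding minkowski_support_iff by blast
  note b1 = scaled_triangle_bounds[OF *(3)] and b2 = scaled_triangle_bounds[OF *(4)]
  obtain x1' x2' where x': "x' = x1' + x2'" "0 \<le> x1'" "x1' \<le> x1" "0 \<le> x2'" "x2' \<le> x2"
    using split_interval_sum[of x1 x2 x'] b1 b2 assms *(1) by metis
  obtain y1' y2' where y': "y' = y1' + y2'" "0 \<le> y1'" "y1' \<le> y1" "0 \<le> y2'" "y2' \<le> y2"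
    using split_interval_sum[of y1 y2 y'] b1 b2 assms *(2) by metis
  show ?thesis
    unfolding minkowski_support_iff
    by (rule exI[of _ x1'], rule exI[of _ y1'], rule exI[of _ x2'], rule exI[of _ y2'], intro conjI)
      (fact x'(1) y'(1) scaled_triangle_shrink[OF *(3) x'(2,3) y'(2,3)] scaled_triangle_shrink[OF *(4) x'(4,5) y'(4,5)])+
qed

lemma minkowski_support_axes:
  fixes b c s1 s2 :: nat and n :: int
  assumes "b > 0" "c > 0"
  defines "A1 \<equiv> max (int s1 * fst (dvec b c n) + int s2 * fst (dvec b c (n + 1))) 0"
    and "A2 \<equiv> max (int s1 * snd (dvec b c n) + int s2 * snd (dvec b c (n + 1))) 0"
  shows "(x, y) \<in> minkowski_support b c n s1 s2 \<Longrightarrow> 0 \<le> x \<and> x \<le> of_int A2 \<and> 0 \<le> y \<and> y \<le> of_int A1"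
    and "0 \<le> x \<Longrightarrow> x \<le> of_int A2 \<Longrightarrow> (x, 0) \<in> minkowski_support b c n s1 s2"
    and "0 \<le> y \<Longrightarrow> y \<le> of_int A1 \<Longrightarrow> (0, y) \<in> minkowski_support b c n s1 s2"
proof -
  define k1 m1 k2 m2 where d: "k1 = max (snd (dvec b c n)) 0" "m1 = max (fst (dvec b c n)) 0"
    "k2 = max (snd (dvec b c (n + 1))) 0" "m2 = max (fst (dvec b c (n + 1))) 0"
  have nn: "k1 \<ge> 0" "m1 \<ge> 0" "k2 \<ge> 0" "m2 \<ge> 0" by (simp_all add: d)
  have A: "of_int A1 = real s1 * of_int m1 + real s2 * of_int m2" "of_int A2 = real s1 * of_int k1 + real s2 * of_int k2"
    unfolding A1_def A2_def dvec_sign_coherent[OF assms(1,2)] d by (simp_all only: of_int_add of_int_mult of_int_of_nat_eq)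
  show "(x, y) \<in> minkowski_support b c n s1 s2 \<Longrightarrow> 0 \<le> x \<and> x \<le> of_int A2 \<and> 0 \<le> y \<and> y \<le> of_int A1"
  proof -
    assume "(x, y) \<in> minkowski_support b c n s1 s2"
    then obtain x1 y1 x2 y2 where *: "x = x1 + x2" "y = y1 + y2"
      "scaled_triangle (real s1) (dvec b c n) x1 y1" "scaled_triangle (real s2) (dvec b c (n + 1)) x2 y2"
      unfolding minkowski_support_iff by blast
    show ?thesis
      using scaled_triangle_bounds[OF *(3)] scaled_triangle_bounds[OF *(4)] unfolding *(1,2) A d by linarith
  qed
  show "(x, 0) \<in> minkowski_support b c n s1 s2" if x: "0 \<le> x" "x \<le> of_int A2"
  proof -
    obtain x1 x2 where "x = x1 + x2" "0 \<le> x1" "x1 \<le> real s1 * of_int k1" "0 \<le> x2" "x2 \<le> real s2 * of_int k2"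
      by (rule split_interval_sum[OF _ _ x(1) x(2)[unfolded A]]) (use nn in auto)
    moreover from this have "x1 * of_int m1 \<le> real s1 * of_int k1 * of_int m1"
      "x2 * of_int m2 \<le> real s2 * of_int k2 * of_int m2" using nn by (simp_all add: mult_right_mono)
    ultimately show ?thesis unfolding minkowski_support_iff
      by (intro exI[of _ x1] exI[of _ 0] exI[of _ x2])
        (use nn in \<open>simp add: scaled_triangle_def Let_def mult.assoc mult.commute[of "real_of_int _" "real_of_int _"] flip: d\<close>)
  qed
  show "(0, y) \<in> minkowski_support b c n s1 s2" if y: "0 \<le> y" "y \<le> of_int A1"
  proof -
    obtain x1 x2 where "y = x1 + x2" "0 \<le> x1" "x1 \<le> real s1 * of_int m1" "0 \<le> x2" "x2 \<le> real s2 * of_int m2"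
      by (rule split_interval_sum[OF _ _ y(1) y(2)[unfolded A]]) (use nn in auto)
    moreover from this have "x1 * of_int k1 \<le> real s1 * of_int m1 * of_int k1"
      "x2 * of_int k2 \<le> real s2 * of_int m2 * of_int k2" using nn by (simp_all add: mult_right_mono)
    ultimately show ?thesis unfolding minkowski_support_iff
      by (intro exI[of _ x1] exI[of _ 0] exI[of _ x2])
        (use nn in \<open>simp add: scaled_triangle_def Let_def flip: d\<close>)
  qed
qed

lemma minkowski_support_reflect:
  "(x, y) \<in> minkowski_support b c (2 - n) s2 s1 \<longleftrightarrow> (y, x) \<in> minkowski_support c b n s1 s2"
proof -
  have "dvec b c (2 - n) = prod.swap (dvec c b (n + 1))" "dvec b c (2 - n + 1) = prod.swap (dvec c b n)"
    using dvec_reflect[of b c n] dvec_reflect[of b c "n + 1"] by (simp_all add: algebra_simps)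
  moreover have "scaled_triangle s (prod.swap d) x y \<longleftrightarrow> scaled_triangle s d y x" for s d x y
    by (auto simp: scaled_triangle_def Let_def algebra_simps)
  ultimately have "(x, y) \<in> minkowski_support b c (2 - n) s2 s1 \<longleftrightarrow>
    (\<exists>x1 y1 x2 y2. x = x1 + x2 \<and> y = y1 + y2 \<and>
      scaled_triangle (real s2) (dvec c b (n + 1)) y1 x1 \<and> scaled_triangle (real s1) (dvec c b n) y2 x2)"
    unfolding minkowski_support_iff by (simp only:)
  also have "\<dots> \<longleftrightarrow> (\<exists>y2 x2 y1 x1. y = y1 + y2 \<and> x = x1 + x2 \<and>
      scaled_triangle (real s1) (dvec c b n) y2 x2 \<and> scaled_triangle (real s2) (dvec c b (n + 1)) y1 x1)"
    by blast
  finally show ?thesis unfolding minkowski_support_iff by (simp only: add.commute)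
qed

context
  fixes b c :: nat and n :: int and s1 s2 :: nat
  assumes bc: "b > 0" "c > 0"
begin

text \<open>The coordinates of the cone vector with respect to the cluster before the exchange.\<close>

definition "fst_before = int s1 * fst (dvec c b n) + int s2 * fst (dvec c b (n + 1))"
definition "snd_before = int s1 * snd (dvec c b n) + int s2 * snd (dvec c b (n + 1))"

text \<open>The change of length is affine, so that it adds up in Minkowski sums, and only the total length
of the two summands matters.\<close>

lemma minkowski_support_transfer:
  fixes t q :: real
  assumes t: "0 \<le> t" and ti: "0 \<le> t + (real b * q - of_int snd_before)"
  shows "(t, q) \<in> minkowski_support c b n s1 s2 \<longleftrightarrow>
    (of_int (max fst_before 0) - q, t + (real b * q - of_int snd_before)) \<in> minkowski_support b c (n + 1) s1 s2"
proof -
  define k1 m1 k2 m2 where d: "k1 = fst (dvec c b n)" "m1 = snd (dvec c b n)"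
    "k2 = fst (dvec c b (n + 1))" "m2 = snd (dvec c b (n + 1))"
  have dv: "dvec c b n = (k1, m1)" "dvec c b (n + 1) = (k2, m2)" by (simp_all add: d)
  have dv': "dvec b c (n + 1) = (int b * max k1 0 - m1, k1)" "dvec b c (n + 1 + 1) = (int b * max k2 0 - m2, k2)"
    unfolding d using dvec_shift[of b c n] dvec_shift[of b c "n + 1"] by simp_all
  note ok = dvec_real_or_initial[OF bc(2,1), of n] dvec_real_or_initial[OF bc(2,1), of "n + 1"]
    dvec_real_or_initial[OF bc, of "n + 1"] dvec_real_or_initial[OF bc, of "n + 1 + 1"]
  note rows1 = triangle_rows[OF ok(1)[unfolded dv] ok(3)[unfolded dv'] of_nat_0_le_iff, of _ s1]
  note rows2 = triangle_rows[OF ok(2)[unfolded dv] ok(4)[unfolded dv'] of_nat_0_le_iff, of _ s2]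
  have "max fst_before 0 = int s1 * max k1 0 + int s2 * max k2 0"
    unfolding fst_before_def d by (rule dvec_sign_coherent(1)[OF bc(2,1)])
  then have Q: "of_int (max fst_before 0) = real s1 * of_int (max k1 0) + real s2 * of_int (max k2 0)"
    by simp
  have S: "real_of_int snd_before = real s1 * of_int m1 + real s2 * of_int m2"
    by (simp add: snd_before_def d)
  show ?thesis (is "?L \<longleftrightarrow> ?R")
  proof
    assume ?L
    then obtain t1 q1 t2 q2 where tq: "t = t1 + t2" "q = q1 + q2"
      "scaled_triangle s1 (k1, m1) t1 q1" "scaled_triangle s2 (k2, m2) t2 q2"
      unfolding minkowski_support_iff dv by blast
    note b1 = scaled_triangle_bounds[OF tq(3)] note b2 = scaled_triangle_bounds[OF tq(4)]
    obtain \<eta>1 where e1: "0 \<le> \<eta>1" "0 \<le> \<eta>1 + (real b * q1 - real s1 * of_int m1)"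
      "\<And>t. scaled_triangle (real s1) (k1, m1) t q1 \<longleftrightarrow> 0 \<le> t \<and> t \<le> \<eta>1"
      "\<And>u. scaled_triangle (real s1) (int b * max k1 0 - m1, k1) (real s1 * of_int (max k1 0) - q1) u \<longleftrightarrow>
        0 \<le> u \<and> u \<le> \<eta>1 + (real b * q1 - real s1 * of_int m1)"
      by (rule rows1[of q1]) (use b1 in auto)
    obtain \<eta>2 where e2: "0 \<le> \<eta>2" "0 \<le> \<eta>2 + (real b * q2 - real s2 * of_int m2)"
      "\<And>t. scaled_triangle (real s2) (k2, m2) t q2 \<longleftrightarrow> 0 \<le> t \<and> t \<le> \<eta>2"
      "\<And>u. scaled_triangle (real s2) (int b * max k2 0 - m2, k2) (real s2 * of_int (max k2 0) - q2) u \<longleftrightarrow>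
        0 \<le> u \<and> u \<le> \<eta>2 + (real b * q2 - real s2 * of_int m2)"
      by (rule rows2[of q2]) (use b2 in auto)
    have le: "t1 \<le> \<eta>1" "t2 \<le> \<eta>2" using tq e1 e2 by auto
    obtain u1 u2 where u: "t + (real b * q - of_int snd_before) = u1 + u2"
       "0 \<le> u1" "u1 \<le> \<eta>1 + (real b * q1 - real s1 * of_int m1)" "0 \<le> u2" "u2 \<le> \<eta>2 + (real b * q2 - real s2 * of_int m2)"
      by (rule split_interval_sum[OF e1(2) e2(2) ti]) (use le tq in \<open>auto simp: S algebra_simps\<close>)
    show ?R unfolding minkowski_support_iff dv'
      by (rule exI[of _ "real s1 * of_int (max k1 0) - q1"], rule exI[of _ u1],
          rule exI[of _ "real s2 * of_int (max k2 0) - q2"], rule exI[of _ u2])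
        (use u e1 e2 tq in \<open>simp add: Q\<close>)
  next
    assume ?R
    then obtain p1 u1 p2 u2 where pu: "of_int (max fst_before 0) - q = p1 + p2"
        "t + (real b * q - of_int snd_before) = u1 + u2"
      "scaled_triangle s1 (int b * max k1 0 - m1, k1) p1 u1" "scaled_triangle s2 (int b * max k2 0 - m2, k2) p2 u2"
      unfolding minkowski_support_iff dv' by blast
    define q1 q2 where "q1 = real s1 * of_int (max k1 0) - p1" and "q2 = real s2 * of_int (max k2 0) - p2"
    have p: "p1 = real s1 * of_int (max k1 0) - q1" "p2 = real s2 * of_int (max k2 0) - q2"
      by (simp_all add: q1_def q2_def)
    have q: "q = q1 + q2" using pu(1) unfolding Q q1_def q2_def by simp
    note b1 = scaled_triangle_bounds[OF pu(3)] note b2 = scaled_triangle_bounds[OF pu(4)]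
    obtain \<eta>1 where e1: "0 \<le> \<eta>1" "0 \<le> \<eta>1 + (real b * q1 - real s1 * of_int m1)"
      "\<And>t. scaled_triangle (real s1) (k1, m1) t q1 \<longleftrightarrow> 0 \<le> t \<and> t \<le> \<eta>1"
      "\<And>u. scaled_triangle (real s1) (int b * max k1 0 - m1, k1) (real s1 * of_int (max k1 0) - q1) u \<longleftrightarrow>
        0 \<le> u \<and> u \<le> \<eta>1 + (real b * q1 - real s1 * of_int m1)"
      by (rule rows1[of q1]) (use b1 q1_def in auto)
    obtain \<eta>2 where e2: "0 \<le> \<eta>2" "0 \<le> \<eta>2 + (real b * q2 - real s2 * of_int m2)"
      "\<And>t. scaled_triangle (real s2) (k2, m2) t q2 \<longleftrightarrow> 0 \<le> t \<and> t \<le> \<eta>2"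
      "\<And>u. scaled_triangle (real s2) (int b * max k2 0 - m2, k2) (real s2 * of_int (max k2 0) - q2) u \<longleftrightarrow>
        0 \<le> u \<and> u \<le> \<eta>2 + (real b * q2 - real s2 * of_int m2)"
      by (rule rows2[of q2]) (use b2 q2_def in auto)
    have "u1 \<le> \<eta>1 + (real b * q1 - real s1 * of_int m1)" "u2 \<le> \<eta>2 + (real b * q2 - real s2 * of_int m2)"
      using pu(3,4) e1(4) e2(4) unfolding p by blast+
    then have "t \<le> \<eta>1 + \<eta>2" using pu(2) by (simp add: S q algebra_simps)
    then obtain t1 t2 where t12: "t = t1 + t2" "0 \<le> t1" "t1 \<le> \<eta>1" "0 \<le> t2" "t2 \<le> \<eta>2"
      by (rule split_interval_sum[OF e1(1) e2(1) t])
    show ?L unfolding minkowski_support_iff dv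
      by (rule exI[of _ t1], rule exI[of _ q1], rule exI[of _ t2], rule exI[of _ q2])
        (use t12 e1 e2 q in simp)
  qed
qed

text \<open>The lattice points of a row before the exchange are \<open>0, \<dots>, h\<close>, those of the corresponding column
after the exchange are \<open>0, \<dots>, h + i\<close>, where the integer \<open>i\<close> is the exponent of the variable that is
exchanged.\<close>

lemma support_rows:
  fixes p :: int
  defines "q' \<equiv> max fst_before 0 - p"
  defines "i \<equiv> int b * q' - snd_before"
  assumes p: "0 \<le> p" "p \<le> max fst_before 0"
  obtains h where "0 \<le> h" "0 \<le> h + i"
    "\<And>t. (of_int t, of_int q') \<in> minkowski_support c b n s1 s2 \<longleftrightarrow> 0 \<le> t \<and> t \<le> h"
    "\<And>q. (of_int p, of_int q) \<in> minkowski_support b c (n + 1) s1 s2 \<longleftrightarrow> 0 \<le> q \<and> q \<le> h + i"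
proof -
  let ?S' = "minkowski_support c b n s1 s2" and ?S = "minkowski_support b c (n + 1) s1 s2"
  have q': "0 \<le> q'" "q' \<le> max fst_before 0" using p by (simp_all add: q'_def)
  define T where "T = {t::int. (of_int t, of_int q') \<in> ?S'}"
  have zero: "0 \<in> T" unfolding T_def
    using minkowski_support_axes(3)[OF bc(2,1), of "of_int q'" s1 n s2] q'
    by (simp add: fst_before_def)
  have "T \<subseteq> {0..max snd_before 0}"
    proof
    fix t assume "t \<in> T"
    then have "0 \<le> real_of_int t \<and> real_of_int t \<le> of_int (max snd_before 0)"
      using minkowski_support_axes(1)[OF bc(2,1), of "of_int t" "of_int q'" n s1 s2] by (simp add: T_def snd_before_def)
    then show "t \<in> {0..max snd_before 0}" by (simp only: of_int_0_le_iff of_int_le_iff atLeastAtMost_iff)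
  qed
  then have fin: "finite T" by (rule finite_subset) simp
  \<comment> \<open>The row is an initial segment of the nonnegative integers, so that its last point determines it.\<close>
  define h where "h = Max T"
  have hT: "h \<in> T" and hmax: "t \<in> T \<Longrightarrow> t \<le> h" for t
    unfolding h_def using Max_in[OF fin] Max_ge[OF fin] zero by blast+
  have rowT: "t \<in> T \<longleftrightarrow> 0 \<le> t \<and> t \<le> h" for t
  proof
    assume "t \<in> T"
    then show "0 \<le> t \<and> t \<le> h" using \<open>T \<subseteq> _\<close> hmax by auto
  next
    assume "0 \<le> t \<and> t \<le> h"
    then show "t \<in> T" using hT q' unfolding T_def
      by (auto intro: minkowski_support_shrink)
  qed
  have transfer: "t \<in> T \<longleftrightarrow> (of_int p, of_int (t + i)) \<in> ?S" if "0 \<le> t" "0 \<le> t + i" for t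
  proof -
    have eq: "of_int t + (real b * of_int q' - of_int snd_before) = (of_int (t + i) :: real)"
      "of_int (max fst_before 0) - of_int q' = (of_int p :: real)" by (simp_all add: i_def q'_def)
    have "0 \<le> (of_int (t + i) :: real)" "0 \<le> (of_int t :: real)"
      using that by (simp_all only: of_int_0_le_iff)
    then show ?thesis
      using minkowski_support_transfer[of "of_int t" "of_int q'"] unfolding eq T_def by blast
  qed
  have base: "(of_int p, 0) \<in> ?S"
  proof -
    have "max (int s1 * snd (dvec b c (n + 1)) + int s2 * snd (dvec b c (n + 1 + 1))) 0 = max fst_before 0"
      by (simp only: fst_before_def dvec_shift snd_conv)
    then show ?thesis
      using minkowski_support_axes(2)[OF bc, of "of_int p" s1 "n + 1" s2] p by simp
  qed
  have hi: "0 \<le> h + i"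
  proof (cases "i \<ge> 0")
    case False
    then have "- i \<in> T" using transfer[of "- i"] base by simp
    then show ?thesis using hmax by fastforce
  qed (use rowT zero in auto)
  have h0: "0 \<le> h" using rowT zero by auto
  have rowS: "(of_int p, of_int q) \<in> ?S \<longleftrightarrow> 0 \<le> q \<and> q \<le> h + i" for q
  proof
    assume S: "(of_int p, of_int q) \<in> ?S"
    then have q0: "0 \<le> q" using minkowski_support_axes(1)[OF bc, of "of_int p" "of_int q"] by fastforce
    show "0 \<le> q \<and> q \<le> h + i"
    proof (cases "q \<ge> i")
      case True
      then have "q - i \<in> T" using transfer[of "q - i"] q0 S by simp
      then show ?thesis using hmax[of "q - i"] q0 by simp
    qed (use q0 h0 in auto)
  next
    assume q: "0 \<le> q \<and> q \<le> h + i"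
    have "(of_int p, of_int (h + i)) \<in> ?S" using transfer[of h] hT h0 hi by simp
    then show "(of_int p, of_int q) \<in> ?S"
      using q p by (elim minkowski_support_shrink) auto
  qed
  show thesis by (rule that[OF h0 hi _ rowS]) (use rowT in \<open>simp add: T_def\<close>)
qed

end

section \<open>Sequences of cluster variables\<close>

text \<open>Laurent polynomials in \<open>v\<close> acting by central scalars on a division ring. Working in this generality
allows a change of the initial cluster and of the ring to its opposite.\<close>

locale central_scalars =
  fixes s :: "laurent \<Rightarrow> 'f::division_ring"
  assumes s_add: "s (f + g) = s f + s g"
    and s_mult: "s (f * g) = s f * s g"
    and s_1 [simp]: "s 1 = 1"
    and s_central: "s f * x = x * s f"
begin

definition V :: "int \<Rightarrow> 'f" where "V k = s (vpow k)"

lemma V_add: "V j * V k = V (j + k)" "V j * (V k * x) = V (j + k) * x"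
  by (simp_all add: V_def vpow_add s_mult mult.assoc)

lemma V_0 [simp]: "V 0 = 1"
  by (simp add: V_def vpow_0)

lemma V_left: "x * V k = V k * x"
  by (simp add: V_def s_central)

lemma V_left_assoc: "x * (V k * y) = V k * (x * y)"
  by (metis V_left mult.assoc)

lemma s_0 [simp]: "s 0 = 0"
  using s_add[of 0 0] by simp

lemma q_commute_powers:
  assumes "y * x = V 2 * (x * y)"
  shows "y ^ q * x ^ p = V (2 * int p * int q) * (x ^ p * y ^ q)"
proof -
  have 1: "y * x ^ p = V (2 * int p) * (x ^ p * y)" for p
  proof (induction p)
    case (Suc p)
    have "y * x ^ Suc p = (y * x) * x ^ p" by (simp add: mult.assoc)
    also have "\<dots> = V 2 * (x * (y * x ^ p))" by (simp add: assms mult.assoc)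
    also have "\<dots> = V (2 * int (Suc p)) * (x ^ Suc p * y)"
      by (simp add: Suc V_left_assoc[of x] V_add mult.assoc algebra_simps)
    finally show ?case .
  qed simp
  show ?thesis
  proof (induction q)
    case (Suc q)
    have "y ^ Suc q * x ^ p = y * (y ^ q * x ^ p)" by (simp add: mult.assoc)
    also have "\<dots> = V (2 * int p * int q) * ((y * x ^ p) * y ^ q)"
      by (simp only: Suc V_left_assoc[of y] mult.assoc)
    also have "\<dots> = V (2 * int p * int (Suc q)) * (x ^ p * y ^ Suc q)"
      by (simp add: 1 V_add mult.assoc algebra_simps)
    finally show ?case .
  qed simp
qed

end

locale cluster_sequence = central_scalars s for s :: "laurent \<Rightarrow> 'f::division_ring" +
  fixes b c :: nat and X :: "int \<Rightarrow> 'f"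
  assumes b_pos: "b > 0" and c_pos: "c > 0"
    and X_nonzero [simp]: "X m \<noteq> 0"
    and q_commute: "X (m + 1) * X m = V 2 * (X m * X (m + 1))"
    and exchange: "X (m + 1) * X (m - 1) = V (int (exch b c m)) * X m ^ exch b c m + 1"
begin

lemma X_commute_powers: "X (m + 1) ^ q * X m ^ p = V (2 * int p * int q) * (X m ^ p * X (m + 1) ^ q)"
  by (rule q_commute_powers[OF q_commute])

text \<open>Commuting \<open>X\<^bsub>m-1\<^esub>\<close> past the right hand side of the exchange relation inverts the power of \<open>v\<close>.\<close>

lemma exchange_opposite: "X (m - 1) * X (m + 1) = V (- int (exch b c m)) * X m ^ exch b c m + 1"
proof -
  let ?k = "exch b c m"
  have "X m ^ ?k * X (m - 1) = V (2 * int ?k) * (X (m - 1) * X m ^ ?k)"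
    using X_commute_powers[of "m - 1" ?k 1] by simp
  then have "V (- int ?k) * X m ^ ?k * X (m - 1) = X (m - 1) * (V (int ?k) * X m ^ ?k)"
    by (simp add: mult.assoc V_left_assoc[of "X (m - 1)"] V_add)
  then have "X (m - 1) * X (m + 1) * X (m - 1) = (V (- int ?k) * X m ^ ?k + 1) * X (m - 1)"
    by (simp add: mult.assoc exchange distrib_left distrib_right)
  then show ?thesis by simp
qed

lemma shift: "cluster_sequence s c b (\<lambda>m. X (m + 1))"
proof
  fix m
  show "X (m + 1 + 1) * X (m + 1) = V 2 * (X (m + 1) * X (m + 1 + 1))" by (rule q_commute)
  have "exch c b m = exch b c (m + 1)" by (simp add: exch_def)
  then show "X (m + 1 + 1) * X (m - 1 + 1) = V (int (exch c b m)) * X (m + 1) ^ exch c b m + 1"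
    using exchange[of "m + 1"] by simp
qed (simp_all add: b_pos c_pos)

lemma X31: "X 3 * X 1 = V (int c) * X 2 ^ c + 1"
  and X20: "X 2 * X 0 = V (int b) * X 1 ^ b + 1"
  and X42: "X 4 * X 2 = V (int b) * X 3 ^ b + 1"
  and X24: "X 2 * X 4 = V (- int b) * X 3 ^ b + 1"
  using exchange[of 2] exchange[of 1] exchange[of 3] exchange_opposite[of 3]
  by (simp_all add: exch_def)

lemma X10_powers: "X 1 ^ q * X 0 ^ p = V (2 * int p * int q) * (X 0 ^ p * X 1 ^ q)"
  and X21_powers: "X 2 ^ q * X 1 ^ p = V (2 * int p * int q) * (X 1 ^ p * X 2 ^ q)"
  and X32_powers: "X 3 ^ q * X 2 ^ p = V (2 * int p * int q) * (X 2 ^ p * X 3 ^ q)"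
  and X43_powers: "X 4 ^ q * X 3 ^ p = V (2 * int p * int q) * (X 3 ^ p * X 4 ^ q)"
  using X_commute_powers[of 0 q p] X_commute_powers[of 1 q p] X_commute_powers[of 2 q p] X_commute_powers[of 3 q p]
  by simp_all

text \<open>Modulo \<open>X\<^sub>2\<close>, the variable \<open>X\<^sub>3\<close> is the inverse of \<open>X\<^sub>1\<close>, and \<open>w i\<close> plays the role of \<open>X\<^sub>1\<^bsup>-i\<^esup>\<close>.\<close>

definition w :: "int \<Rightarrow> 'f" where "w i = X 3 ^ nat i * X 1 ^ nat (- i)"

definition M :: "int \<times> int \<Rightarrow> 'f" where
  "M a = V (fst a * snd a) * (w (fst a) * (X 2 ^ nat (- snd a) * X 0 ^ nat (snd a)))"

abbreviation N :: "int \<Rightarrow> nat \<Rightarrow> 'f" where "N i j \<equiv> M (i, - int j)"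

lemma N_eq: "N i j = V (- i * int j) * (w i * X 2 ^ j)"
  by (simp add: M_def)

lemma M_nonneg: "k \<ge> 0 \<Longrightarrow> M (i, k) = V (i * k) * (w i * X 0 ^ nat k)"
  by (simp add: M_def)

lemma w_nonneg: "w (int n) = X 3 ^ n" and w_nonpos: "w (- int n) = X 1 ^ n"
  by (simp_all add: w_def)

lemmas V_out =
  V_left_assoc[of "X m" for m] V_left_assoc[of "X m ^ n" for m n]
  V_left_assoc[of "w i" for i] V_left_assoc[of "M a" for a]
  V_left[of "X m" for m] V_left[of "X m ^ n" for m n]
  V_left[of "w i" for i] V_left[of "M a" for a]

lemma power_out: "x ^ n * (x * y) = x * (x ^ n * (y :: 'f))"
  by (simp add: power_commutes flip: mult.assoc)

lemma int_sign_cases: obtains n where "i = int (Suc n)" | n where "i = - int n"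
proof (cases "i > 0")
  case True then show ?thesis using that(1)[of "nat (i - 1)"] by auto
next
  case False then show ?thesis using that(2)[of "nat (- i)"] by auto
qed

lemma w_X2: "w i * X 2 ^ j = V (2 * i * int j) * (X 2 ^ j * w i)"
proof (cases i rule: int_sign_cases)
  case (1 n)
  then show ?thesis using X32_powers[of "Suc n" j] by (simp add: w_nonneg algebra_simps del: of_nat_Suc power_Suc)
next
  case (2 n)
  then show ?thesis using X21_powers[of j n]
    by (simp add: w_nonpos V_out V_add algebra_simps)
qed

lemma X2_w: "X 2 ^ j * w i = V (- 2 * i * int j) * (w i * X 2 ^ j)"
  by (simp add: w_X2 V_add)

section \<open>The lattice of standard monomials\<close>

text \<open>For \<open>d = 0\<close> this is the \<open>\<int>[v]\<close>-span of the standard monomials with index in \<open>P\<close>; for \<open>d = 1\<close> it is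
\<open>v\<close> times that span.\<close>

inductive_set lattice :: "int \<Rightarrow> (int \<times> int \<Rightarrow> bool) \<Rightarrow> 'f set" for d P where
  zero: "0 \<in> lattice d P"
| gen: "P a \<Longrightarrow> e \<ge> d \<Longrightarrow> V e * M a \<in> lattice d P"
| uminus: "x \<in> lattice d P \<Longrightarrow> - x \<in> lattice d P"
| add: "x \<in> lattice d P \<Longrightarrow> y \<in> lattice d P \<Longrightarrow> x + y \<in> lattice d P"

lemma lattice_diff: "x \<in> lattice d P \<Longrightarrow> y \<in> lattice d P \<Longrightarrow> x - y \<in> lattice d P"
  using lattice.add[OF _ lattice.uminus] by fastforce

text \<open>A two-sided multiplication commutes with the scalars, therefore it suffices to control it on standard
monomials.\<close>

lemma lattice_map:
  assumes "x \<in> lattice d P" "\<And>a. P a \<Longrightarrow> l * M a * r \<in> lattice d' P'" "d'' \<le> d + d'"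
  shows "l * x * r \<in> lattice d'' P'"
proof -
  have scale: "V e * y \<in> lattice d'' P'" if "y \<in> lattice d' P'" "e \<ge> d" for e y
    using that
  proof (induction y rule: lattice.induct)
    case (gen a e')
    then show ?case using assms(3) by (auto simp: V_add intro!: lattice.gen)
  qed (auto simp: distrib_left intro: lattice.intros)
  show ?thesis using assms(1)
  proof (induction x rule: lattice.induct)
    case (gen a e)
    have "l * (V e * M a) * r = V e * (l * M a * r)" by (simp add: V_left_assoc[of l] mult.assoc)
    then show ?case using scale assms(2) gen by simp
  qed (auto simp: distrib_left distrib_right intro: lattice.intros)
qed

lemma lattice_mono:
  assumes "x \<in> lattice d P" "\<And>a. P a \<Longrightarrow> P' a" "d' \<le> d"
  shows "x \<in> lattice d' P'"
  using lattice_map[OF assms(1), of 1 1 0 P' d'] assms(2,3) lattice.gen[of P' _ 0 0] by simp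

lemma lattice_scale:
  assumes "x \<in> lattice d P" "d' \<le> d + e"
  shows "V e * x \<in> lattice d' P"
  using lattice_map[OF assms(1), of "V e" 1 e P d'] assms(2) lattice.gen[of P _ e e] by simp

lemma lattice_M: "P a \<Longrightarrow> d \<le> 0 \<Longrightarrow> M a \<in> lattice d P"
  using lattice.gen[of P a d 0] by simp

text \<open>The second summand, present for \<open>i \<ge> 1\<close>, comes from the exchange relation for \<open>X\<^sub>3 X\<^sub>1\<close>. Both exponents
of \<open>v\<close> are nonnegative.\<close>

lemma N_X1:
  "N i j * X 1 = V (int j) * N (i - 1) j
     + (if i \<ge> 1 then V (int j + int c * i) * N (i - 1) (j + c) else 0)"
proof (cases i rule: int_sign_cases)
  case (2 n)
  have "X 2 ^ j * X 1 = V (2 * int j) * (X 1 * X 2 ^ j)" using X21_powers[of j 1] by simp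
  then have "N i j * X 1 = V (int n * int j + 2 * int j) * (X 1 ^ Suc n * X 2 ^ j)"
    unfolding N_eq 2 w_nonpos by (simp add: mult.assoc V_out V_add power_commutes power_out)
  also have "X 1 ^ Suc n = w (i - 1)"
  proof -
    have "i - 1 = - int (Suc n)" using 2 by simp
    then show ?thesis by (simp only: w_nonpos)
  qed
  finally show ?thesis using 2 by (simp add: N_eq V_add algebra_simps)
next
  case (1 n)
  have "X 2 ^ j * X 1 = V (2 * int j) * (X 1 * X 2 ^ j)" using X21_powers[of j 1] by simp
  then have "N i j * X 1 = V (- i * int j + 2 * int j) * (X 3 ^ n * (X 3 * X 1) * X 2 ^ j)"
    unfolding N_eq 1 w_nonneg by (simp add: mult.assoc V_out V_add power_commutes power_out)
  also have "X 3 ^ n * (X 3 * X 1) * X 2 ^ j = w (i - 1) * X 2 ^ j + V (int c) * (w (i - 1) * X 2 ^ (j + c))"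
    unfolding X31 using 1 w_nonneg[of n]
    by (simp add: distrib_left distrib_right V_out mult.assoc power_add add.commute[of j])
  finally show ?thesis unfolding N_eq using 1 by (simp add: distrib_left V_add algebra_simps)
qed

lemma X3_N:
  "X 3 * N i j = V (int j) * N (i + 1) j
     + (if i < 0 then V (int j - int c * i) * N (i + 1) (j + c) else 0)"
proof (cases "i < 0")
  case False
  then obtain n where n: "i = int n" by (metis nonneg_int_cases not_less)
  have "X 3 * N i j = V (- i * int j) * (X 3 ^ Suc n * X 2 ^ j)"
    unfolding N_eq n w_nonneg by (simp add: mult.assoc V_out)
  also have "X 3 ^ Suc n = w (i + 1)" using n w_nonneg[of "Suc n"] by (simp add: add.commute)
  finally show ?thesis using False by (simp add: N_eq V_add algebra_simps)
next
  case True
  then obtain n where n: "i = - int (Suc n)" by (metis int_cases neg_0_le_iff_le not_le of_nat_0_le_iff negD)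
  have w': "w (i + 1) = X 1 ^ n" using n w_nonpos[of n] by simp
  have "X 2 ^ c * (w (i + 1) * X 2 ^ j) = V (- 2 * (i + 1) * int c) * (w (i + 1) * X 2 ^ (j + c))"
    by (simp add: mult.assoc[symmetric] X2_w) (simp add: mult.assoc power_add[symmetric] add.commute)
  moreover have "X 3 * N i j = V (- i * int j) * ((X 3 * X 1) * (X 1 ^ n * X 2 ^ j))"
    unfolding N_eq n w_nonpos by (simp add: mult.assoc V_out)
  ultimately have "X 3 * N i j = V (- i * int j) * (w (i + 1) * X 2 ^ j
      + V (int c + (- 2 * (i + 1) * int c)) * (w (i + 1) * X 2 ^ (j + c)))"
    by (simp add: X31 w' distrib_right mult.assoc V_add)
  then show ?thesis unfolding N_eq using True by (simp add: distrib_left V_add algebra_simps)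
qed

lemma N_X0: "N i (Suc j) * X 0 = V (- i) * (N i j + V (int b) * (N i j * X 1 ^ b))"
proof -
  have "N i (Suc j) * X 0 = V (- i * int (Suc j)) * (w i * (X 2 ^ j * (X 2 * X 0)))"
    unfolding N_eq by (simp add: mult.assoc power_commutes power_out)
  also have "\<dots> = V (- i) * (V (- i * int j) * (w i * (X 2 ^ j * (X 2 * X 0))))"
    by (simp add: V_add algebra_simps)
  finally show ?thesis
    by (simp add: X20 N_eq distrib_left V_out V_add mult.assoc algebra_simps)
qed

lemma M_X0: "k \<ge> 0 \<Longrightarrow> M (i, k) * X 0 = V (- i) * M (i, k + 1)"
  by (simp add: M_nonneg nat_add_distrib mult.assoc V_add power_commutes power_out)
     (simp add: algebra_simps)

text \<open>Standard monomials without \<open>X\<^sub>0\<close>, with bounds for the index of \<open>w\<close>.\<close>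

definition lower :: "int \<Rightarrow> int \<Rightarrow> int \<times> int \<Rightarrow> bool" where
  "lower I m a \<longleftrightarrow> snd a \<le> 0 \<and> fst a \<le> I \<and> - fst a \<le> m"

text \<open>The second condition bounds the highest exponent of \<open>X\<^sub>1\<close> in the Laurent expansion of a standard
monomial.\<close>

definition region :: "int \<Rightarrow> int \<Rightarrow> int \<times> int \<Rightarrow> bool" where
  "region I m a \<longleftrightarrow> fst a \<le> I \<and> int b * max (snd a) 0 - fst a \<le> m"

lemma lower_cases:
  assumes "lower I m a"
  obtains i j where "a = (i, - int j)" "i \<le> I" "- i \<le> m"
  using assms that[of "fst a" "nat (- snd a)"] by (cases a) (auto simp: lower_def)

lemma lattice_X1:
  assumes "x \<in> lattice d (lower I m)"
  shows "x * X 1 ^ n \<in> lattice d (lower I (m + int n))"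
proof (induction n)
  case 0
  then show ?case using assms by simp
next
  case (Suc n)
  have "1 * (x * X 1 ^ n) * X 1 \<in> lattice d (lower I (m + int (Suc n)))"
  proof (rule lattice_map[OF Suc])
    fix a assume "lower I (m + int n) a"
    then obtain i j where a: "a = (i, - int j)" "i \<le> I" "- i \<le> m + int n" by (rule lower_cases)
    show "1 * M a * X 1 \<in> lattice 0 (lower I (m + int (Suc n)))"
      unfolding a using a by (auto simp: N_X1 lower_def intro!: lattice.intros)
  qed simp
  then show ?case by (simp add: mult.assoc power_commutes power_out)
qed

lemma lattice_X3:
  assumes "x \<in> lattice d (\<lambda>a. snd a \<le> 0 \<and> - fst a \<le> m)"
  shows "X 3 ^ n * x \<in> lattice d (\<lambda>a. snd a \<le> 0 \<and> - fst a \<le> m)"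
proof (induction n)
  case 0
  then show ?case using assms by simp
next
  case (Suc n)
  have "X 3 * (X 3 ^ n * x) * 1 \<in> lattice d (\<lambda>a. snd a \<le> 0 \<and> - fst a \<le> m)"
  proof (rule lattice_map[OF Suc])
    fix a :: "int \<times> int" assume "snd a \<le> 0 \<and> - fst a \<le> m"
    then obtain i j where a: "a = (i, - int j)" "- i \<le> m"
      by (cases a) (metis fst_conv minus_equation_iff neg_0_le_iff_le nonneg_int_cases snd_conv)
    show "X 3 * M a * 1 \<in> lattice 0 (\<lambda>a. snd a \<le> 0 \<and> - fst a \<le> m)"
      unfolding a using a mult_nonneg_nonpos[of "int c" i] by (auto simp: X3_N intro!: lattice.intros)
  qed simp
  then show ?case by (simp add: mult.assoc)
qed

text \<open>Multiplication of \<open>M (i, k)\<close> by \<open>X\<^sub>0\<close> produces the power \<open>v\<^bsup>-i\<^esup>\<close>, which a factor \<open>v\<^bsup>I\<^esup>\<close> compensates for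
all \<open>i \<le> I\<close>.\<close>

lemma lattice_X0:
  assumes "x \<in> lattice d (region I m)"
  shows "V (I * int k) * (x * X 0 ^ k) \<in> lattice d (region I (m + int b * int k))"
proof (induction k)
  case 0
  then show ?case using assms by simp
next
  case (Suc k)
  have "V I * (V (I * int k) * (x * X 0 ^ k)) * X 0 \<in> lattice d (region I (m + int b * int (Suc k)))"
  proof (rule lattice_map[OF Suc])
    fix a assume a: "region I (m + int b * int k) a"
    obtain i l where il: "a = (i, l)" by (cases a)
    have i: "i \<le> I" "int b * max l 0 - i \<le> m + int b * int k" using a il by (auto simp: region_def)
    show "V I * M a * X 0 \<in> lattice 0 (region I (m + int b * int (Suc k)))"
    proof (cases "l \<ge> 0")
      case True
      then have "V I * M a * X 0 = V (I - i) * M (i, l + 1)"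
        by (simp add: il mult.assoc M_X0 V_add)
      then show ?thesis using i True by (auto intro!: lattice.intros simp: region_def algebra_simps)
    next
      case False
      then obtain j where j: "l = - int (Suc j)" by (metis int_cases not_le of_nat_0_le_iff)
      have "N i j * X 1 ^ b \<in> lattice 0 (lower i (- i + int b))"
        by (rule lattice_X1) (auto intro!: lattice_M simp: lower_def)
      moreover have "N i j \<in> lattice 0 (lower i (- i + int b))" by (auto intro!: lattice_M simp: lower_def)
      ultimately have "V (I - i) * (N i j + V (int b) * (N i j * X 1 ^ b)) \<in> lattice 0 (lower i (- i + int b))"
        using i by (auto intro!: lattice_scale[where d = 0] lattice.add)
      moreover have "V I * M a * X 0 = V (I - i) * (N i j + V (int b) * (N i j * X 1 ^ b))"
        unfolding il j mult.assoc N_X0 by (simp add: V_add)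
      ultimately show ?thesis
        using i j by (auto elim!: lattice_mono simp: lower_def region_def algebra_simps)
    qed
  qed simp
  then show ?case by (simp add: mult.assoc V_out V_add power_commutes power_out algebra_simps)
qed

section \<open>Multiplication by the fourth cluster variable\<close>

inductive_set X2_polys :: "int \<Rightarrow> 'f set" for d where
  zero: "0 \<in> X2_polys d"
| gen: "e \<ge> d \<Longrightarrow> V e * X 2 ^ j \<in> X2_polys d"
| uminus: "x \<in> X2_polys d \<Longrightarrow> - x \<in> X2_polys d"
| add: "x \<in> X2_polys d \<Longrightarrow> y \<in> X2_polys d \<Longrightarrow> x + y \<in> X2_polys d"

lemma X2_polys_scale: "x \<in> X2_polys d \<Longrightarrow> e \<ge> 0 \<Longrightarrow> V e * (X 2 ^ j * x) \<in> X2_polys d"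
proof (induction x rule: X2_polys.induct)
  case (gen e' j')
  then show ?case by (auto simp: V_out V_add intro: X2_polys.gen simp flip: power_add)
qed (auto simp: distrib_left intro: X2_polys.intros)

text \<open>The recursion is chosen so that \<open>X\<^sub>3\<^bsup>n\<^esup> X\<^sub>1\<^bsup>n\<^esup> = 1 + X\<^sub>2 * excess n\<close>. This is the product
of the factors \<open>1 + v\<^bsup>c(2j-1)\<^esup> X\<^sub>2\<^bsup>c\<^esup>\<close> for \<open>1 \<le> j \<le> n\<close>, so that its nonconstant coefficients lie in
\<open>v \<int>[v]\<close>; this is where the lattice \<open>v L\<close> arises.\<close>

primrec excess :: "nat \<Rightarrow> 'f" where
  "excess 0 = 0"
| "excess (Suc n) = excess n + V (int c + 2 * int c * int n) * (X 2 ^ (c - 1) * (1 + X 2 * excess n))"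

lemma excess_X2_polys: "excess n \<in> X2_polys 1"
proof (induction n)
  case (Suc n)
  have "int c \<ge> 1" "2 * int c * int n \<ge> 0" using c_pos by simp_all
  then have "V (int c + 2 * int c * int n) * X 2 ^ (c - 1) \<in> X2_polys 1" by (intro X2_polys.gen) linarith
  moreover have "V (int c + 2 * int c * int n) * (X 2 ^ Suc (c - 1) * excess n) \<in> X2_polys 1"
    by (intro X2_polys_scale Suc) simp
  ultimately show ?case
    using Suc by (simp add: distrib_left mult.assoc power_commutes power_out X2_polys.add)
qed (simp add: X2_polys.zero)

lemma X3_X1_powers: "X 3 ^ n * X 1 ^ n = 1 + X 2 * excess n"
proof (induction n)
  case (Suc n)
  have "X 3 ^ Suc n * X 1 ^ Suc n = X 3 ^ n * (X 3 * X 1) * X 1 ^ n"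
    by (simp add: mult.assoc power_commutes power_out)
  also have "\<dots> = X 3 ^ n * X 1 ^ n + V (int c) * (X 3 ^ n * X 2 ^ c * X 1 ^ n)"
    by (simp add: X31 distrib_left distrib_right mult.assoc V_out)
  also have "X 3 ^ n * X 2 ^ c * X 1 ^ n = V (2 * int c * int n) * (X 2 ^ c * (X 3 ^ n * X 1 ^ n))"
    by (simp add: X32_powers mult.assoc)
  also have "X 2 ^ c = X 2 * X 2 ^ (c - 1)" using c_pos by (cases c) auto
  finally show ?case by (simp add: Suc distrib_left mult.assoc V_out V_add)
qed simp

text \<open>After multiplication by \<open>X\<^sub>2\<close> from the left, both sides are evaluated by the relations for
\<open>X\<^sub>2 X\<^sub>4\<close>, \<open>X\<^sub>2 X\<^sub>0\<close> and \<open>X\<^sub>3\<^bsup>n\<^esup> X\<^sub>1\<^bsup>n\<^esup>\<close>. The extreme cases \<open>m = 0\<close> and \<open>n = 0\<close> express \<open>X\<^sub>4\<close> and \<open>X\<^sub>4 X\<^sub>1\<^bsup>b\<^esup>\<close>.\<close>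

lemma X4_X1:
  assumes "n + m = b"
  shows "X 4 * X 1 ^ m = V (int b - 2 * int m) * (X 3 ^ n * (X 0 + excess m)) - excess n * X 1 ^ m"
proof -
  have b: "int b = int n + int m" using assms by simp
  have "X 2 * (X 4 * X 1 ^ m) = V (- int b) * (X 3 ^ n * (X 3 ^ m * X 1 ^ m)) + X 1 ^ m"
    by (simp add: X24 distrib_right assms mult.assoc[symmetric] power_add[symmetric])
  also have "\<dots> = V (- int b) * (X 3 ^ n * (1 + X 2 * excess m)) + X 1 ^ m"
    by (simp only: X3_X1_powers)
  finally have lhs: "X 2 * (X 4 * X 1 ^ m) = V (- int b) * (X 3 ^ n * (1 + X 2 * excess m)) + X 1 ^ m" .
  have "X 3 ^ n * X 2 = V (2 * int n) * (X 2 * X 3 ^ n)" using X32_powers[of n 1] by simp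
  then have X23: "X 2 * (X 3 ^ n * y) = V (- 2 * int n) * (X 3 ^ n * (X 2 * y))" for y
    by (simp add: V_add mult.assoc[symmetric])
  have "X 3 ^ n * X 1 ^ b = X 3 ^ n * X 1 ^ n * X 1 ^ m"
    by (simp add: mult.assoc assms flip: power_add)
  then have X31b: "X 3 ^ n * X 1 ^ b = X 1 ^ m + X 2 * (excess n * X 1 ^ m)"
    by (simp add: X3_X1_powers distrib_right mult.assoc)
  have "X 2 * (V (int b - 2 * int m) * (X 3 ^ n * (X 0 + excess m))) =
      V (- int b) * (X 3 ^ n * (X 2 * X 0 + X 2 * excess m))"
    by (simp add: V_out X23 V_add b distrib_left)
  also have "\<dots> = X 3 ^ n * X 1 ^ b + V (- int b) * (X 3 ^ n * (1 + X 2 * excess m))"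
    by (simp add: X20 distrib_left V_out V_add add.assoc)
  finally have "X 2 * (V (int b - 2 * int m) * (X 3 ^ n * (X 0 + excess m)) - excess n * X 1 ^ m) =
      V (- int b) * (X 3 ^ n * (1 + X 2 * excess m)) + X 1 ^ m"
    by (simp add: right_diff_distrib X31b)
  then have "X 2 * (X 4 * X 1 ^ m) = X 2 * (V (int b - 2 * int m) * (X 3 ^ n * (X 0 + excess m)) - excess n * X 1 ^ m)"
    using lhs by simp
  then show ?thesis by simp
qed

lemma w_X2_polys:
  assumes "x \<in> X2_polys d" "i \<ge> 0"
  shows "w i * x \<in> lattice d (\<lambda>a. snd a \<le> 0 \<and> fst a = i)"
  using assms(1)
proof (induction x rule: X2_polys.induct)
  case (gen e j)
  have "w i * (V e * X 2 ^ j) = V (e + i * int j) * N i j" by (simp add: N_eq V_out V_add)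
  then show ?case using gen assms(2) by (auto intro!: lattice.gen intro: add_increasing2)
qed (auto simp: distrib_left intro: lattice.intros)

lemma X2_polys_w:
  assumes "x \<in> X2_polys d" "i \<le> 0"
  shows "x * w i \<in> lattice d (\<lambda>a. snd a \<le> 0 \<and> fst a = i)"
  using assms(1)
proof (induction x rule: X2_polys.induct)
  case (gen e j)
  have "V e * X 2 ^ j * w i = V (e - i * int j) * N i j"
    by (simp add: N_eq X2_w V_add mult.assoc)
  moreover have "i * int j \<le> 0" using assms(2) by (simp add: mult_nonpos_nonneg)
  ultimately show ?case using gen by (auto intro!: lattice.gen)
qed (auto simp: distrib_right intro: lattice.intros)

text \<open>The bound \<open>i + 1\<close> on the error is what is needed for the error to stay in \<open>v L\<close> after a
multiplication by a power of \<open>X\<^sub>0\<close>.\<close>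

lemma X4_w:
  obtains err where "X 4 * w i = V (int b + 2 * i) * (w (i + int b) * X 0) + err"
    "err \<in> lattice (i + 1) (\<lambda>a. snd a \<le> 0 \<and> (fst a = i \<or> fst a = i + int b))"
proof -
  let ?P = "\<lambda>a::int \<times> int. snd a \<le> 0 \<and> (fst a = i \<or> fst a = i + int b)"
  consider n where "i = int n" | m where "i = - int m" "m \<le> b" | r where "i = - int (b + r)"
  proof -
    assume a: "\<And>n. i = int n \<Longrightarrow> thesis" "\<And>m. i = - int m \<Longrightarrow> m \<le> b \<Longrightarrow> thesis" "\<And>r. i = - int (b + r) \<Longrightarrow> thesis"
    show thesis using a(1)[of "nat i"] a(2)[of "nat (- i)"] a(3)[of "nat (- i) - b"] by linarith
  qed
  then show thesis
  proof cases
    case (1 n)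
    have "X 4 = V (int b) * (X 3 ^ b * X 0) - excess b" using X4_X1[of b 0] by simp
    then have "X 4 * w i = V (2 * int n) * (X 3 ^ n * (V (int b) * (X 3 ^ b * X 0) - excess b))"
      using X43_powers[of 1 n] by (simp add: 1 w_nonneg)
    also have "\<dots> = V (int b + 2 * i) * (w (i + int b) * X 0) + (- (V (2 * int n) * (w i * excess b)))"
    proof -
      have "w (i + int b) = X 3 ^ n * X 3 ^ b" using w_nonneg[of "n + b"] by (simp add: 1 power_add)
      then show ?thesis by (simp add: 1 w_nonneg right_diff_distrib V_out V_add mult.assoc add.commute)
    qed
    finally show thesis
    proof (rule that)
      have "V (2 * int n) * (w i * excess b) \<in> lattice (i + 1) (\<lambda>a. snd a \<le> 0 \<and> fst a = i)"
        by (rule lattice_scale[OF w_X2_polys[OF excess_X2_polys]]) (use 1 in auto)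
      then show "- (V (2 * int n) * (w i * excess b)) \<in> lattice (i + 1) ?P"
        by (intro lattice.uminus) (erule lattice_mono, auto)
    qed
  next
    case (2 m)
    define n where "n = b - m"
    have nm: "n + m = b" "i + int b = int n" using 2 by (auto simp: n_def)
    have "X 4 * w i = V (int b + 2 * i) * (w (i + int b) * X 0) +
        (V (int b - 2 * int m) * (w (i + int b) * excess m) - excess n * w i)"
      unfolding nm(2) w_nonneg using X4_X1[OF nm(1)] by (simp add: 2 w_nonpos distrib_left)
    then show thesis
    proof (rule that)
      have "V (int b - 2 * int m) * (w (i + int b) * excess m) \<in> lattice (i + 1) (\<lambda>a. snd a \<le> 0 \<and> fst a = i + int b)"
        by (rule lattice_scale[OF w_X2_polys[OF excess_X2_polys]]) (use 2 in auto)
      moreover have "excess n * w i \<in> lattice 1 (\<lambda>a. snd a \<le> 0 \<and> fst a = i)"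
        by (rule X2_polys_w[OF excess_X2_polys]) (use 2 in auto)
      ultimately show "V (int b - 2 * int m) * (w (i + int b) * excess m) - excess n * w i \<in> lattice (i + 1) ?P"
        by (intro lattice_diff) (erule lattice_mono; use 2 in auto)+
    qed
  next
    case (3 r)
    have "X 4 * X 1 ^ b = V (- int b) * (X 0 + excess b)" using X4_X1[of 0 b] by simp
    moreover have "w i = X 1 ^ b * X 1 ^ r" unfolding 3 w_nonpos by (simp add: power_add)
    ultimately have "X 4 * w i = V (- int b) * ((X 0 + excess b) * X 1 ^ r)"
      by (simp add: mult.assoc[symmetric]) 
    moreover have "X 0 * X 1 ^ r = V (- 2 * int r) * (X 1 ^ r * X 0)"
      using X10_powers[of r 1] by (simp add: V_add)
    moreover have wr: "w (i + int b) = X 1 ^ r" using w_nonpos[of r] by (simp add: 3)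
    ultimately have "X 4 * w i = V (int b + 2 * i) * (w (i + int b) * X 0) + V (- int b) * (excess b * w (i + int b))"
      by (simp add: distrib_left distrib_right V_add 3)
    then show thesis
    proof (rule that)
      have "V (- int b) * (excess b * w (i + int b)) \<in> lattice (i + 1) (\<lambda>a. snd a \<le> 0 \<and> fst a = i + int b)"
        by (rule lattice_scale[OF X2_polys_w[OF excess_X2_polys]]) (use 3 in auto)
      then show "V (- int b) * (excess b * w (i + int b)) \<in> lattice (i + 1) ?P"
        by (rule lattice_mono) auto
    qed
  qed
qed

text \<open>The highest exponent of \<open>X\<^sub>1\<close> in the Laurent expansion of \<open>M a\<close>. Multiplication by \<open>X\<^sub>4\<close> does not
raise it, which keeps the required power of \<open>v\<close> fixed in an induction.\<close>

definition weight :: "int \<times> int \<Rightarrow> int" where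
  "weight a = int b * max (snd a) 0 - fst a"

text \<open>The index moves to \<open>(i + b, k + 1)\<close>, the denominator vector of \<open>X\<^sub>4\<close> being \<open>(b, 1)\<close>.\<close>

lemma X4_M_nonneg:
  assumes "k \<ge> 0"
  shows "V (int b * k - i) * (X 4 * M (i, k)) - M (i + int b, k + 1) \<in> lattice 1 (\<lambda>a. weight a \<le> int b * k - i)"
proof -
  obtain n where n: "k = int n" using assms nonneg_int_cases by blast
  obtain err where err: "X 4 * w i = V (int b + 2 * i) * (w (i + int b) * X 0) + err"
    "err \<in> lattice (i + 1) (\<lambda>a. snd a \<le> 0 \<and> (fst a = i \<or> fst a = i + int b))"
    by (rule X4_w)
  have "X 4 * M (i, k) = V (i * k) * ((X 4 * w i) * X 0 ^ n)"
    by (simp add: n M_nonneg V_out mult.assoc)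
  then have "V (int b * k - i) * (X 4 * M (i, k)) =
      V ((i + int b) * (k + 1)) * (w (i + int b) * X 0 ^ Suc n) + V (- i) * (V ((i + int b) * k) * (err * X 0 ^ n))"
    unfolding err(1) by (simp add: distrib_left distrib_right mult.assoc V_add algebra_simps)
  moreover have "M (i + int b, k + 1) = V ((i + int b) * (k + 1)) * (w (i + int b) * X 0 ^ Suc n)"
    using M_nonneg[of "k + 1" "i + int b"] n by (simp add: nat_add_distrib)
  ultimately have eq: "V (int b * k - i) * (X 4 * M (i, k)) - M (i + int b, k + 1) =
      V (- i) * (V ((i + int b) * int n) * (err * X 0 ^ n))" by (simp add: n)
  have "err \<in> lattice (i + 1) (region (i + int b) (- i))"
    by (rule lattice_mono[OF err(2)]) (auto simp: region_def)
  then have "V ((i + int b) * int n) * (err * X 0 ^ n) \<in> lattice (i + 1) (region (i + int b) (- i + int b * int n))"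
    by (rule lattice_X0)
  then have "V (- i) * (V ((i + int b) * int n) * (err * X 0 ^ n)) \<in> lattice 1 (region (i + int b) (- i + int b * int n))"
    by (rule lattice_scale) simp
  then show ?thesis unfolding eq by (rule lattice_mono) (auto simp: region_def weight_def n)
qed

lemma X4_M_neg:
  assumes "k < 0"
  shows "V (- i) * (X 4 * M (i, k)) - M (i, k + 1) \<in> lattice 1 (\<lambda>a. weight a \<le> - i)"
proof -
  define j where "j = nat (- k - 1)"
  have j: "k = - int (Suc j)" "k + 1 = - int j" using assms by (auto simp: j_def)
  have N': "N i j = V (i * int j) * (X 2 ^ j * w i)" for j
    by (simp add: N_eq w_X2 V_add)
  have "X 4 * N i (Suc j) = V (i * int (Suc j)) * ((X 4 * X 2) * (X 2 ^ j * w i))"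
    unfolding N' by (simp add: V_out mult.assoc)
  then have "V (- i) * (X 4 * N i (Suc j)) - N i j = V (int b) * (X 3 ^ b * N i j)"
    unfolding X42 N' by (simp add: V_out V_add distrib_right mult.assoc distrib_left algebra_simps)
  moreover have "X 3 ^ b * N i j \<in> lattice 0 (\<lambda>a. snd a \<le> 0 \<and> - fst a \<le> - i)"
    by (intro lattice_X3 lattice_M) auto
  then have "V (int b) * (X 3 ^ b * N i j) \<in> lattice 1 (\<lambda>a. snd a \<le> 0 \<and> - fst a \<le> - i)"
    by (rule lattice_scale) (use b_pos in auto)
  ultimately show ?thesis unfolding j(2) unfolding j(1)
    by (metis (no_types, lifting) lattice_mono weight_def order_refl max_absorb2 mult_zero_right diff_0)
qed

lemma X4_lattice:
  assumes "x \<in> lattice d (\<lambda>a. weight a \<le> m)"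
  shows "V m * (X 4 * x) \<in> lattice d (\<lambda>a. weight a \<le> m)"
proof -
  have "V m * X 4 * x * 1 \<in> lattice d (\<lambda>a. weight a \<le> m)"
  proof (rule lattice_map[OF assms])
    fix a :: "int \<times> int" assume m: "weight a \<le> m"
    define a' where "a' = (if snd a \<ge> 0 then (fst a + int b, snd a + 1) else (fst a, snd a + 1))"
    have "V (weight a) * (X 4 * M a) - M a' \<in> lattice 1 (\<lambda>a'. weight a' \<le> weight a)"
      using X4_M_nonneg[of "snd a" "fst a"] X4_M_neg[of "snd a" "fst a"]
      by (auto simp: a'_def weight_def)
    moreover have "weight a' = weight a" by (auto simp: a'_def weight_def algebra_simps)
    then have "M a' \<in> lattice 0 (\<lambda>a'. weight a' \<le> weight a)" by (intro lattice_M) auto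
    ultimately have "(V (weight a) * (X 4 * M a) - M a') + M a' \<in> lattice 0 (\<lambda>a'. weight a' \<le> weight a)"
      by (intro lattice.add) (auto elim: lattice_mono)
    then have "V (weight a) * (X 4 * M a) \<in> lattice 0 (\<lambda>a'. weight a' \<le> weight a)" by simp
    then have "V (m - weight a) * (V (weight a) * (X 4 * M a)) \<in> lattice 0 (\<lambda>a'. weight a' \<le> weight a)"
      by (rule lattice_scale) (use m in simp)
    then show "V m * X 4 * M a * 1 \<in> lattice 0 (\<lambda>a. weight a \<le> m)"
      using m by (auto simp: V_add mult.assoc elim: lattice_mono)
  qed simp
  then show ?thesis by (simp add: mult.assoc)
qed

lemma X4_power_w:
  "V (int k * m) * (X 4 ^ k * w (- m)) - M (int b * int k - m, int k) \<in> lattice 1 (\<lambda>a. weight a \<le> m)"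
proof (induction k)
  case 0
  then show ?case by (simp add: M_def lattice.zero)
next
  case (Suc k)
  let ?x = "V (int k * m) * (X 4 ^ k * w (- m))" and ?a = "(int b * int k - m, int k)"
  have "V m * (X 4 * (?x - M ?a)) \<in> lattice 1 (\<lambda>a. weight a \<le> m)" by (rule X4_lattice[OF Suc])
  moreover have "V m * (X 4 * M ?a) - M (int b * int (Suc k) - m, int (Suc k)) \<in> lattice 1 (\<lambda>a. weight a \<le> m)"
    using X4_M_nonneg[of "int k" "int b * int k - m"] by (simp add: algebra_simps)
  ultimately have "V m * (X 4 * (?x - M ?a)) + (V m * (X 4 * M ?a) - M (int b * int (Suc k) - m, int (Suc k))) \<in> lattice 1 (\<lambda>a. weight a \<le> m)"
    by (rule lattice.add)
  moreover have "V m * (X 4 * ?x) = V (int (Suc k) * m) * (X 4 ^ Suc k * w (- m))"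
    by (simp add: V_out V_add mult.assoc algebra_simps)
  ultimately show ?case by (simp add: right_diff_distrib)
qed

text \<open>The standard monomials of two adjacent clusters agree modulo \<open>v L\<close>. For \<open>k \<le> 0\<close> they involve only
\<open>X\<^sub>1\<close>, \<open>X\<^sub>2\<close> and \<open>X\<^sub>3\<close> and are equal.\<close>

lemma shifted_M:
  "cluster_sequence.M s (\<lambda>m. X (m + 1)) (k, m) - M (int b * max k 0 - m, k) \<in> lattice 1 (\<lambda>_. True)"
proof -
  interpret sh: cluster_sequence s c b "\<lambda>m. X (m + 1)" by (rule shift)
  have sh: "sh.M (k, m) = V (k * m) * (X 4 ^ nat k * X 2 ^ nat (- k) * w (- m))"
    by (simp add: sh.M_def sh.w_def w_def mult.assoc)
  show ?thesis
  proof (cases "k \<ge> 0")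
    case True
    then obtain n where n: "k = int n" using nonneg_int_cases by blast
    show ?thesis using lattice_mono[OF X4_power_w[of n m], of "\<lambda>_. True" 1]
      unfolding sh by (simp add: n mult.assoc)
  next
    case False
    then obtain j where j: "k = - int j" by (metis int_cases2 of_nat_0_le_iff)
    have "sh.M (k, m) = M (- m, k)"
      unfolding sh by (simp add: j X2_w N_eq V_add)
    then show ?thesis using False by (simp add: lattice.zero)
  qed
qed

lemma shifted_lattice:
  assumes "x \<in> cluster_sequence.lattice s (\<lambda>m. X (m + 1)) d P"
  shows "x \<in> lattice d (\<lambda>_. True)"
proof -
  interpret sh: cluster_sequence s c b "\<lambda>m. X (m + 1)" by (rule shift)
  from assms show ?thesis
  proof (induction x rule: sh.lattice.induct)
    case (gen a e)
    obtain k m where a: "a = (k, m)" by (cases a)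
    have "(sh.M a - M (int b * max k 0 - m, k)) + M (int b * max k 0 - m, k) \<in> lattice 0 (\<lambda>_. True)"
    proof (rule lattice.add)
      show "sh.M a - M (int b * max k 0 - m, k) \<in> lattice 0 (\<lambda>_. True)"
        unfolding a by (rule lattice_mono[OF shifted_M]) auto
      show "M (int b * max k 0 - m, k) \<in> lattice 0 (\<lambda>_. True)" by (rule lattice_M) auto
    qed
    then have "sh.M a \<in> lattice 0 (\<lambda>_. True)" by simp
    then show ?case by (rule lattice_scale) (use gen in simp)
  qed (auto intro: lattice.intros)
qed

end

section \<open>Degrees of Laurent polynomials\<close>

text \<open>In contrast to \<open>ldeg\<close>, this also records that the Laurent polynomial is nonzero.\<close>

definition has_deg :: "laurent \<Rightarrow> int \<Rightarrow> bool" where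
  "has_deg f d \<longleftrightarrow> lookup f d \<noteq> 0 \<and> (\<forall>k>d. lookup f k = 0)"

lemma has_deg_ldeg: "has_deg f d \<Longrightarrow> ldeg f = d"
  unfolding ldeg_def has_deg_def
  by (intro Max_eqI) (auto simp: in_keys_iff not_less[symmetric])

lemma has_deg_nonzero: "has_deg f d \<Longrightarrow> f \<noteq> 0"
  by (auto simp: has_deg_def)

lemma lookup_single_times:
  fixes a :: "'a::comm_ring_1" and r :: "int \<Rightarrow>\<^sub>0 'a"
  shows "lookup (single k a * r) j = a * lookup r (j - k)"
proof (induction r rule: poly_mapping_single_induct)
  case (2 i f)
  then show ?case by (auto simp: mult_single lookup_single when_def)
qed (simp_all add: distrib_left lookup_add)

lemma vpow_nonzero [simp]: "vpow k \<noteq> 0"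
  by (metis vpow_def lookup_single_eq lookup_zero zero_neq_one)

lemma has_deg_vpow: "has_deg f d \<Longrightarrow> has_deg (vpow m * f) (m + d)"
  by (auto simp: has_deg_def vpow_def lookup_single_times)

lemma has_deg_uminus: "has_deg f d \<Longrightarrow> has_deg (- f) d"
  by (simp add: has_deg_def)

lemma has_deg_add:
  assumes "has_deg f d" "g = 0 \<or> (has_deg g d' \<and> d' < d)"
  shows "has_deg (f + g) d" "has_deg (g + f) d"
  using assms by (auto simp: has_deg_def lookup_add)

section \<open>Rows and their degrees\<close>

text \<open>Laurent polynomials in a variable \<open>\<tau>\<close>, to be replaced by \<open>X\<^sub>2\<close>, over the Laurent polynomials in \<open>v\<close>.\<close>

type_synonym row = "int \<Rightarrow>\<^sub>0 laurent"

text \<open>\<open>1 + v\<^bsup>-c(2t+1)\<^esup> \<tau>\<^bsup>c\<^esup>\<close>, the factor that appears when \<open>X\<^sub>3\<close> passes \<open>X\<^sub>1\<^bsup>-t\<^esup>\<close>.\<close>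

definition row_factor :: "nat \<Rightarrow> int \<Rightarrow> row" where
  "row_factor c t = 1 + single (int c) (vpow (- int c * (2 * t + 1)))"

lemma lookup_row_factor:
  "lookup (row_factor c t * r) j =
    lookup r j + vpow (- int c * (2 * t + 1)) * lookup r (j - int c)"
  by (simp add: row_factor_def distrib_right lookup_add lookup_single_times)

lemma row_factor_nonzero: "c > 0 \<Longrightarrow> row_factor c t \<noteq> 0"
proof
  assume "c > 0" "row_factor c t = 0"
  then have "lookup (row_factor c t * 1) 0 = 0" by simp
  then show False using \<open>c > 0\<close> unfolding lookup_row_factor by (simp add: lookup_one)
qed

text \<open>The exponents of the row are \<open>j0, j0 + c, \<dots>, j0 + c (hi - lo)\<close>, and the degrees in \<open>v\<close> along
them start with \<open>\<delta>\<close> and have the differences \<open>-c(2t+1)\<close> for \<open>t = lo, \<dots>, hi - 1\<close>. In tropical terms, these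
are the roots of the row.\<close>

definition row_degrees :: "nat \<Rightarrow> int \<Rightarrow> int \<Rightarrow> int \<Rightarrow> int \<Rightarrow> row \<Rightarrow> bool" where
  "row_degrees c j0 \<delta> lo hi r \<longleftrightarrow>
     (\<forall>q. 0 \<le> q \<and> q \<le> hi - lo \<longrightarrow>
        has_deg (lookup r (j0 + int c * q)) (\<delta> - int c * (q\<^sup>2 + 2 * lo * q))) \<and>
     (\<forall>j. (\<forall>q. 0 \<le> q \<and> q \<le> hi - lo \<longrightarrow> j \<noteq> j0 + int c * q) \<longrightarrow> lookup r j = 0)"

lemma row_degrees_has_deg:
  "row_degrees c j0 \<delta> lo hi r \<Longrightarrow> 0 \<le> q \<Longrightarrow> q \<le> hi - lo \<Longrightarrow>
    has_deg (lookup r (j0 + int c * q)) (\<delta> - int c * (q\<^sup>2 + 2 * lo * q))"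
  by (auto simp: row_degrees_def)

lemma row_degrees_zero:
  "row_degrees c j0 \<delta> lo hi r \<Longrightarrow> (\<And>q. 0 \<le> q \<Longrightarrow> q \<le> hi - lo \<Longrightarrow> j \<noteq> j0 + int c * q) \<Longrightarrow>
    lookup r j = 0"
  by (auto simp: row_degrees_def)

text \<open>The new difference is larger than all others, hence in each sum of two terms the shifted one has
the strictly larger degree.\<close>

lemma row_degrees_times:
  assumes c: "c > 0" and r: "row_degrees c j0 \<delta> (lo + 1) hi r" and "lo < hi"
  shows "row_degrees c j0 \<delta> lo hi (row_factor c lo * r)"
  unfolding row_degrees_def lookup_row_factor
proof (intro conjI allI impI)
  fix q assume q: "0 \<le> q \<and> q \<le> hi - lo"
  have prev: "j0 + int c * q - int c = j0 + int c * (q - 1)" by (simp add: algebra_simps)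
  let ?old = "\<lambda>q. \<delta> - int c * (q\<^sup>2 + 2 * (lo + 1) * q)" and ?new = "\<delta> - int c * (q\<^sup>2 + 2 * lo * q)"
  have zero: "lookup r (j0 + int c * k) = 0" if "k < 0 \<or> k > hi - (lo + 1)" for k
    by (rule row_degrees_zero[OF r]) (use that c in auto)
  have top: "has_deg (vpow (- int c * (2 * lo + 1)) * lookup r (j0 + int c * (q - 1))) ?new" if "q \<ge> 1"
  proof -
    have "- int c * (2 * lo + 1) + ?old (q - 1) = ?new" by (simp add: power2_eq_square algebra_simps)
    moreover have "has_deg (vpow (- int c * (2 * lo + 1)) * lookup r (j0 + int c * (q - 1)))
        (- int c * (2 * lo + 1) + ?old (q - 1))"
      by (intro has_deg_vpow row_degrees_has_deg[OF r]) (use that q in auto)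
    ultimately show ?thesis by (simp only:)
  qed
  show "has_deg (lookup r (j0 + int c * q) +
      vpow (- int c * (2 * lo + 1)) * lookup r (j0 + int c * q - int c)) ?new"
  proof (cases "q \<ge> 1")
    case False
    then have "q = 0" using q by simp
    then show ?thesis
      using zero[of "-1"] row_degrees_has_deg[OF r, of 0] \<open>lo < hi\<close> unfolding prev by simp
  next
    case True
    have "?old q < ?new" using True c by (simp add: algebra_simps)
    then show ?thesis unfolding prev
      using has_deg_add(2)[OF top[OF True], of "lookup r (j0 + int c * q)" "?old q"]
        zero[of q] row_degrees_has_deg[OF r, of q] q by (cases "q \<le> hi - (lo + 1)") auto
  qed
next
  fix j assume j: "\<forall>q. 0 \<le> q \<and> q \<le> hi - lo \<longrightarrow> j \<noteq> j0 + int c * q"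
  have "lookup r j = 0" by (rule row_degrees_zero[OF r]) (use j in auto)
  moreover have "lookup r (j - int c) = 0"
  proof (rule row_degrees_zero[OF r])
    fix q assume "0 \<le> q" "q \<le> hi - (lo + 1)"
    then show "j - int c \<noteq> j0 + int c * q" using j[rule_format, of "q + 1"] by (auto simp: algebra_simps)
  qed
  ultimately show "lookup r j + vpow (- int c * (2 * lo + 1)) * lookup r (j - int c) = 0"
    by simp
qed

lemma vpow_cancel: "vpow m * f = g \<longleftrightarrow> f = vpow (- m) * g"
  by (auto simp: mult.assoc[symmetric] simp flip: vpow_add) (simp_all add: vpow_0 flip: vpow_add mult.assoc)

text \<open>The coefficients of the quotient are computed from the top exponent downwards. In each step the coefficient
of the product has a larger degree than the coefficient of the quotient already known, so that no leading
terms cancel.\<close>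

lemma row_degrees_divide:
  assumes c: "c > 0" and r: "row_degrees c j0 \<delta> lo hi (row_factor c lo * r)" and "lo < hi"
  shows "row_degrees c j0 \<delta> (lo + 1) hi r"
proof -
  let ?m = "- int c * (2 * lo + 1)" and ?R = "row_factor c lo * r"
  have up: "lookup r j = 0"
    if U: "\<And>j. j \<in> U \<Longrightarrow> j + int c \<in> U" "\<And>j. j \<in> U \<Longrightarrow> lookup ?R (j + int c) = 0" "j \<in> U" for U j
  proof (rule ccontr)
    assume j: "lookup r j \<noteq> 0"
    define k where "k = Max (keys r \<inter> U)"
    have fin: "finite (keys r \<inter> U)" and ne: "keys r \<inter> U \<noteq> {}"
      using j U(3) by (auto simp: in_keys_iff)
    have k: "k \<in> keys r \<inter> U" unfolding k_def by (rule Max_in[OF fin ne])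
    have "k + int c \<notin> keys r \<inter> U"
      using Max_ge[OF fin, of "k + int c"] c unfolding k_def[symmetric] by auto
    then have "lookup r (k + int c) = 0" using U(1) k by (auto simp: in_keys_iff)
    then have "lookup ?R (k + int c) \<noteq> 0"
      using k by (simp add: lookup_row_factor in_keys_iff)
    then show False using U(2) k by auto
  qed
  have down: "lookup r j = 0"
    if U: "\<And>j. j \<in> U \<Longrightarrow> j - int c \<in> U" "\<And>j. j \<in> U \<Longrightarrow> lookup ?R j = 0" "j \<in> U" for U j
  proof (rule ccontr)
    assume j: "lookup r j \<noteq> 0"
    define k where "k = Min (keys r \<inter> U)"
    have fin: "finite (keys r \<inter> U)" and ne: "keys r \<inter> U \<noteq> {}"
      using j U(3) by (auto simp: in_keys_iff)
    have k: "k \<in> keys r \<inter> U" unfolding k_def by (rule Min_in[OF fin ne])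
    have "k - int c \<notin> keys r \<inter> U"
      using Min_le[OF fin, of "k - int c"] c unfolding k_def[symmetric] by auto
    then have "lookup r (k - int c) = 0" using U(1) k by (auto simp: in_keys_iff)
    then have "lookup ?R k \<noteq> 0"
      using k by (simp add: lookup_row_factor in_keys_iff)
    then show False using U(2) k by auto
  qed
  have prev: "j0 + int c * q - int c = j0 + int c * (q - 1)" for q by (simp add: algebra_simps)
  define n where "n = hi - lo"
  \<comment> \<open>If the quotient had a term beyond the claimed range, the outermost one would survive in the product.\<close>
  have zero_above: "lookup r j = 0" if "\<And>q. q < n \<Longrightarrow> j \<noteq> j0 + int c * q" for j
  proof (rule up[where U = "{j. \<forall>q<n. j \<noteq> j0 + int c * q}"])
    fix j assume "j \<in> {j. \<forall>q<n. j \<noteq> j0 + int c * q}"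
    then have j: "j \<noteq> j0 + int c * q" if "q < n" for q using that by auto
    have j1: "j + int c \<noteq> j0 + int c * q" if "q \<le> n" for q
      using j[of "q - 1"] that by (simp add: algebra_simps)
    then show "j + int c \<in> {j. \<forall>q<n. j \<noteq> j0 + int c * q}" by auto
    show "lookup ?R (j + int c) = 0"
      by (rule row_degrees_zero[OF r]) (use j1 in \<open>auto simp: n_def\<close>)
  qed (use that in auto)
  have zero_below: "lookup r (j0 + int c * q) = 0" if "q < 0" for q
  proof (rule down[where U = "{j0 + int c * q | q. q < 0}"])
    fix j assume "j \<in> {j0 + int c * q | q. q < 0}"
    then obtain q where q: "j = j0 + int c * q" "q < 0" by auto
    then show "j - int c \<in> {j0 + int c * q | q. q < 0}"
      by (auto intro!: exI[of _ "q - 1"] simp: algebra_simps)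
    show "lookup ?R j = 0"
      by (rule row_degrees_zero[OF r]) (use q c in auto)
  qed (use that in auto)
  have deg: "has_deg (lookup r (j0 + int c * (n - 1 - int k))) (\<delta> - int c * ((n - 1 - int k)\<^sup>2 + 2 * (lo + 1) * (n - 1 - int k)))"
    if "int k \<le> n - 1" for k
    using that
  proof (induction k)
    case 0
    have "lookup r (j0 + int c * n) = 0" by (rule zero_above) (use c in auto)
    then have "lookup ?R (j0 + int c * n) = vpow ?m * lookup r (j0 + int c * (n - 1))"
      by (simp only: lookup_row_factor prev) simp
    then have "lookup r (j0 + int c * (n - 1)) = vpow (- ?m) * lookup ?R (j0 + int c * n)"
      by (metis vpow_cancel)
    moreover have "has_deg (vpow (- ?m) * lookup ?R (j0 + int c * n)) (- ?m + (\<delta> - int c * (n\<^sup>2 + 2 * lo * n)))"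
      using \<open>lo < hi\<close> by (intro has_deg_vpow row_degrees_has_deg[OF r]) (simp_all add: n_def)
    ultimately show ?case by (simp add: power2_eq_square algebra_simps)
  next
    case (Suc k)
    define q where "q = n - 1 - int k"
    have q: "1 \<le> q" "q \<le> n - 1" "n - 1 - int (Suc k) = q - 1" using Suc.prems by (simp_all add: q_def)
    have IH: "has_deg (lookup r (j0 + int c * q)) (\<delta> - int c * (q\<^sup>2 + 2 * (lo + 1) * q))"
      using Suc by (simp add: q_def)
    have R: "has_deg (lookup ?R (j0 + int c * q)) (\<delta> - int c * (q\<^sup>2 + 2 * lo * q))"
      by (rule row_degrees_has_deg[OF r]) (use q in \<open>auto simp: n_def\<close>)
    have "lookup ?R (j0 + int c * q) = lookup r (j0 + int c * q) + vpow ?m * lookup r (j0 + int c * (q - 1))"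
      by (simp only: lookup_row_factor prev)
    then have "vpow ?m * lookup r (j0 + int c * (q - 1)) = lookup ?R (j0 + int c * q) + (- lookup r (j0 + int c * q))"
      by simp
    then have eq: "lookup r (j0 + int c * (q - 1)) = vpow (- ?m) * (lookup ?R (j0 + int c * q) + (- lookup r (j0 + int c * q)))"
      by (metis vpow_cancel)
    have "\<delta> - int c * (q\<^sup>2 + 2 * (lo + 1) * q) < \<delta> - int c * (q\<^sup>2 + 2 * lo * q)"
      using q c by (simp add: algebra_simps)
    then have "has_deg (lookup ?R (j0 + int c * q) + (- lookup r (j0 + int c * q))) (\<delta> - int c * (q\<^sup>2 + 2 * lo * q))"
      using has_deg_add(1)[OF R] has_deg_uminus[OF IH] by blast
    from has_deg_vpow[OF this, of "- ?m"] show ?case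
      unfolding q(3) eq by (simp add: power2_eq_square algebra_simps)
  qed
  show ?thesis unfolding row_degrees_def
  proof (intro conjI allI impI)
    fix q assume "0 \<le> q \<and> q \<le> hi - (lo + 1)"
    then show "has_deg (lookup r (j0 + int c * q)) (\<delta> - int c * (q\<^sup>2 + 2 * (lo + 1) * q))"
      using deg[of "nat (n - 1 - q)"] by (simp add: n_def)
  next
    fix j assume j: "\<forall>q. 0 \<le> q \<and> q \<le> hi - (lo + 1) \<longrightarrow> j \<noteq> j0 + int c * q"
    show "lookup r j = 0"
    proof (cases "\<exists>q<0. j = j0 + int c * q")
      case True then show ?thesis using zero_below by auto
    next
      case False
      show ?thesis
      proof (rule zero_above)
        fix q assume "q < n"
        then show "j \<noteq> j0 + int c * q" using False j by (cases "q < 0") (auto simp: n_def)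
      qed
    qed
  qed
qed

lemma row_degrees_prod_times:
  assumes "c > 0" "0 \<le> i" "i \<le> hi" "row_degrees c j0 \<delta> i hi r"
  shows "row_degrees c j0 \<delta> 0 hi ((\<Prod>t\<in>{0..<i}. row_factor c t) * r)"
proof -
  have "row_degrees c j0 \<delta> (i - int k) hi ((\<Prod>t\<in>{i - int k..<i}. row_factor c t) * r)" if "int k \<le> i" for k
    using that
  proof (induction k)
    case (Suc k)
    have "{i - int (Suc k)..<i} = insert (i - int (Suc k)) {i - int k..<i}" by auto
    then have "(\<Prod>t\<in>{i - int (Suc k)..<i}. row_factor c t) * r =
        row_factor c (i - int (Suc k)) * ((\<Prod>t\<in>{i - int k..<i}. row_factor c t) * r)"
      by (simp add: mult.assoc)
    moreover have "i - int (Suc k) + 1 = i - int k" by simp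
    moreover have "row_degrees c j0 \<delta> (i - int k) hi ((\<Prod>t\<in>{i - int k..<i}. row_factor c t) * r)"
      using Suc by simp
    ultimately show ?case
      using row_degrees_times[OF assms(1), of j0 \<delta> "i - int (Suc k)" hi] Suc.prems assms(3) by (simp only:)
  qed (use assms in simp)
  from this[of "nat i"] show ?thesis using assms(2) by simp
qed

lemma row_degrees_prod_divide:
  assumes "c > 0" "i \<le> 0" "0 \<le> hi" "row_degrees c j0 \<delta> i hi ((\<Prod>t\<in>{i..<0}. row_factor c t) * r)"
  shows "row_degrees c j0 \<delta> 0 hi r"
proof -
  have "row_degrees c j0 \<delta> (i + int k) hi ((\<Prod>t\<in>{i + int k..<0}. row_factor c t) * r)" if "int k \<le> - i" for k
    using that
  proof (induction k)
    case (Suc k)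
    have "{i + int k..<0} = insert (i + int k) {i + int (Suc k)..<0}" using Suc.prems by auto
    then have "(\<Prod>t\<in>{i + int k..<0}. row_factor c t) * r =
        row_factor c (i + int k) * ((\<Prod>t\<in>{i + int (Suc k)..<0}. row_factor c t) * r)"
      by (simp add: mult.assoc)
    moreover have "i + int k + 1 = i + int (Suc k)" by simp
    moreover have "row_degrees c j0 \<delta> (i + int k) hi ((\<Prod>t\<in>{i + int k..<0}. row_factor c t) * r)"
      using Suc by simp
    ultimately show ?case
      using row_degrees_divide[OF assms(1), of j0 \<delta> "i + int k" hi] Suc.prems assms(3) by (simp only:)
  qed (use assms in simp)
  from this[of "nat (- i)"] show ?thesis using assms(2) by simp
qed


section \<open>Independent pairs and the change of rows under an exchange\<close>

context central_scalars
begin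

definition evaluate :: "('i \<Rightarrow> 'f) \<Rightarrow> ('i \<Rightarrow>\<^sub>0 laurent) \<Rightarrow> 'f" where
  "evaluate G F = (\<Sum>a\<in>keys F. s (lookup F a) * G a)"

lemma evaluate_superset:
  "finite A \<Longrightarrow> keys F \<subseteq> A \<Longrightarrow> evaluate G F = (\<Sum>a\<in>A. s (lookup F a) * G a)"
  unfolding evaluate_def by (rule sum.mono_neutral_left) (auto simp: in_keys_iff)

lemma s_left_assoc: "x * (s f * y) = s f * (x * y)"
  by (metis s_central mult.assoc)

lemma evaluate_0 [simp]: "evaluate G 0 = 0"
  by (simp add: evaluate_def)

lemma evaluate_single [simp]: "evaluate G (single a f) = s f * G a"
  by (subst evaluate_superset[where A = "{a}"]) auto

lemma evaluate_add: "evaluate G (F + F') = evaluate G F + evaluate G F'"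
proof -
  let ?A = "keys F \<union> keys F'"
  have k: "keys (F + F') \<subseteq> ?A" by (rule Poly_Mapping.keys_add)
  show ?thesis
    by (subst (1 2 3) evaluate_superset[where A = ?A])
      (use k in \<open>auto simp: lookup_add s_add distrib_right sum.distrib\<close>)
qed

lemma evaluate_uminus: "evaluate G (- F) = - evaluate G F"
  using evaluate_add[of G F "- F"] by (simp add: eq_neg_iff_add_eq_0 add.commute)

lemma evaluate_diff: "evaluate G (F - F') = evaluate G F - evaluate G F'"
  using evaluate_add[of G F "- F'"] by (simp add: evaluate_uminus)

lemma evaluate_sum: "evaluate G (\<Sum>a\<in>A. F a) = (\<Sum>a\<in>A. evaluate G (F a))"
  by (induction A rule: infinite_finite_induct) (simp_all add: evaluate_add)

abbreviation row_eval :: "'f \<Rightarrow> row \<Rightarrow> 'f" where "row_eval y \<equiv> evaluate (\<lambda>j. y powi j)"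

lemma row_eval_1: "row_eval y 1 = 1"
  using evaluate_single[of "\<lambda>j. y powi j" 0 1] by simp

lemma row_eval_mult:
  assumes "y \<noteq> 0"
  shows "row_eval y (r * r') = row_eval y r * row_eval y r'"
proof (induction r rule: poly_mapping_single_induct)
  case (2 i f)
  show ?case
  proof (induction r' rule: poly_mapping_single_induct)
    case (2 j g)
    have "y powi i * (s g * y powi j) = s g * (y powi i * y powi j)"
      by (rule s_left_assoc)
    then show ?case by (simp add: mult_single s_mult power_int_add assms mult.assoc)
  qed (simp_all add: distrib_left evaluate_add)
qed (simp_all add: distrib_right evaluate_add)

lemma q_commute_powi:
  assumes xy: "y * x = V 2 * (x * y)" and nz: "x \<noteq> 0" "y \<noteq> 0"
  shows "y powi j * x powi i = V (2 * i * j) * (x powi i * y powi j)"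
proof -
  have inv: "u * inverse t = V (- e) * (inverse t * u)" if "u * t = V e * (t * u)" "t \<noteq> 0" for t u e
  proof -
    have "inverse t * (u * t) * inverse t = V e * (inverse t * (t * u) * inverse t)"
      unfolding that(1) by (simp add: V_left_assoc[of "inverse t"] mult.assoc)
    then have "inverse t * u = V e * (u * inverse t)"
      using that(2) by (simp add: mult.assoc) (simp add: mult.assoc[symmetric])
    then show ?thesis by (simp add: V_add)
  qed
  have right: "u * x powi i = V (e * i) * (x powi i * u)" if "u * x = V e * (x * u)" "x \<noteq> 0" for x u e i
  proof -
    have nat: "u * t ^ n = V (e * int n) * (t ^ n * u)" if "u * t = V e * (t * u)" for t e n
    proof (induction n)
      case (Suc n)
      have "u * t ^ Suc n = (u * t) * t ^ n" by (simp add: mult.assoc)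
      also have "\<dots> = V e * (t * (u * t ^ n))" by (simp add: that mult.assoc)
      also have "\<dots> = V (e * int (Suc n)) * (t ^ Suc n * u)"
        by (simp add: Suc V_left_assoc[of t] V_add mult.assoc algebra_simps)
      finally show ?case .
    qed simp
    show ?thesis
      using nat[OF that(1), of "nat i"] nat[OF inv[OF that], of "nat (- i)"]
      by (cases "i \<ge> 0") (simp_all add: power_int_def)
  qed
  have "x * y = V (- 2) * (y * x)" using xy by (simp add: V_add)
  from right[OF this nz(2), of j] have "x * y powi j = V (- 2 * j) * (y powi j * x)" .
  then have "y powi j * x = V (2 * j) * (x * y powi j)" by (simp add: V_add)
  from right[OF this nz(1), of i] show ?thesis by (simp add: algebra_simps)
qed

text \<open>Linear independence of the Laurent monomials over the Laurent polynomials in \<open>v\<close>.\<close>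

definition independent_monomials :: "'f \<Rightarrow> 'f \<Rightarrow> bool" where
  "independent_monomials x y \<longleftrightarrow>
     (\<forall>F. evaluate (\<lambda>a. x powi fst a * y powi snd a) F = 0 \<longrightarrow> F = 0)"

lemma independent_rows:
  assumes "independent_monomials x y" "finite I"
    and "(\<Sum>i\<in>I. x powi i * row_eval y (r i)) = 0" "i \<in> I"
  shows "r i = 0"
proof -
  define F where "F = (\<Sum>i\<in>I. \<Sum>j\<in>keys (r i). single (i, j) (lookup (r i) j))"
  have "evaluate (\<lambda>a. x powi fst a * y powi snd a) F = (\<Sum>i\<in>I. x powi i * row_eval y (r i))"
    unfolding F_def evaluate_sum
    by (auto intro!: sum.cong simp: evaluate_def sum_distrib_left s_left_assoc[of "x powi _"])
  then have "F = 0" using assms by (simp add: independent_monomials_def)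
  show ?thesis
  proof (rule poly_mapping_eqI)
    fix j
    have "lookup F (i, j) = (\<Sum>i'\<in>I. \<Sum>j'\<in>keys (r i'). (if i' = i \<and> j' = j then lookup (r i') j' else 0))"
      unfolding F_def by (simp add: lookup_sum lookup_single when_def)
    also have "\<dots> = (\<Sum>i'\<in>I. if i' = i then lookup (r i) j else 0)"
      by (intro sum.cong) (auto simp: in_keys_iff)
    also have "\<dots> = lookup (r i) j" using assms(2,4) by simp
    finally show "lookup (r i) j = lookup 0 j" using \<open>F = 0\<close> by simp
  qed
qed

lemma row_exchange:
  fixes x y z :: 'f
  assumes c: "c > 0" and nz: "x \<noteq> 0" "y \<noteq> 0" and yx: "y * x = V 2 * (x * y)"
    and xz: "x * z = V (- int c) * y ^ c + 1"
  shows "z ^ n * (x powi (- i) * row_eval y r) =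
    x powi (- (i + int n)) * row_eval y ((\<Prod>t\<in>{i..<i + int n}. row_factor c t) * r)"
proof -
  have one: "z * (x powi (- t) * row_eval y r) = x powi (- (t + 1)) * row_eval y (row_factor c t * r)" for t r
  proof -
    have z: "z = inverse x * (V (- int c) * y ^ c + 1)"
      unfolding xz[symmetric] using nz by (simp add: mult.assoc[symmetric])
    have "y ^ c * x powi (- t) = V (- 2 * t * int c) * (x powi (- t) * y ^ c)"
      using q_commute_powi[OF yx nz, of "int c" "- t"] by (simp add: algebra_simps)
    then have "(V (- int c) * y ^ c + 1) * x powi (- t) = x powi (- t) * (V (- int c * (2 * t + 1)) * y ^ c + 1)"
      by (simp add: distrib_left distrib_right mult.assoc V_add V_left_assoc[of "x powi _"] algebra_simps)
    moreover have "row_eval y (row_factor c t * r) = (V (- int c * (2 * t + 1)) * y ^ c + 1) * row_eval y r"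
      unfolding row_eval_mult[OF nz(2)]
      by (simp add: row_factor_def evaluate_add row_eval_1 V_def add.commute)
    moreover have "x powi (- (t + 1)) = inverse x * x powi (- t)"
    proof -
      have eq: "- (t + 1) = -1 + - t" by simp
      show ?thesis unfolding eq power_int_add[OF disjI1[OF nz(1)]] by simp
    qed
    moreover have "z * (x powi (- t) * row_eval y r) = inverse x * (((V (- int c) * y ^ c + 1) * x powi (- t)) * row_eval y r)"
      unfolding z by (simp only: mult.assoc)
    ultimately show ?thesis by (simp only: mult.assoc)
  qed
  show ?thesis
  proof (induction n)
    case (Suc n)
    have "z ^ Suc n * (x powi (- i) * row_eval y r) = z * (z ^ n * (x powi (- i) * row_eval y r))"
      by (simp add: mult.assoc)
    also have "\<dots> = x powi (- (i + int n + 1)) * row_eval y (row_factor c (i + int n) * ((\<Prod>t\<in>{i..<i + int n}. row_factor c t) * r))"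
      unfolding Suc by (rule one)
    also have "row_factor c (i + int n) * ((\<Prod>t\<in>{i..<i + int n}. row_factor c t) * r) = (\<Prod>t\<in>{i..<i + int (Suc n)}. row_factor c t) * r"
    proof -
      have "{i..<i + int (Suc n)} = insert (i + int n) {i..<i + int n}" by auto
      then show ?thesis by (simp add: mult.assoc)
    qed
    finally show ?case by (simp add: add.assoc add.commute[of 1])
  qed simp
qed

text \<open>Two expansions of one element, before and after an exchange, are compared row by row. The element is
multiplied by a power of \<open>z\<close> that makes all exponents of \<open>z\<close> nonnegative; then both sides expand in \<open>x\<close> and \<open>y\<close>,
and the common factors cancel.\<close>

lemma row_relation:
  assumes c: "c > 0" and nz: "x \<noteq> 0" "y \<noteq> 0" "z \<noteq> 0" and yx: "y * x = V 2 * (x * y)"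
    and xz: "x * z = V (- int c) * y ^ c + 1"
    and indep: "independent_monomials x y" and I: "finite I"
    and eq: "(\<Sum>i\<in>I. z powi i * row_eval y (r' i)) = (\<Sum>i\<in>I. x powi (- i) * row_eval y (r i))"
    and i: "i \<in> I"
  shows "i \<ge> 0 \<Longrightarrow> r i = (\<Prod>t\<in>{0..<i}. row_factor c t) * r' i"
    and "i \<le> 0 \<Longrightarrow> r' i = (\<Prod>t\<in>{i..<0}. row_factor c t) * r i"
proof -
  let ?A = "\<lambda>S. \<Prod>t\<in>S. row_factor c t"
  note ex = row_exchange[OF c nz(1,2) yx xz]
  \<comment> \<open>The least exponent of \<open>z\<close> becomes nonnegative after multiplication by \<open>z\<^bsup>n\<^esup>\<close>.\<close>
  define n where "n = nat (Max ((\<lambda>i. - i) ` I))"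
  have n: "0 \<le> int n + j" if "j \<in> I" for j
  proof -
    have "- j \<le> Max ((\<lambda>i. - i) ` I)" by (rule Max_ge) (use that I in auto)
    then show ?thesis unfolding n_def by linarith
  qed
  have left: "z ^ n * (z powi j * row_eval y (r' j)) = x powi (- (j + int n)) * row_eval y (?A {0..<j + int n} * r' j)" if "j \<in> I" for j
  proof -
    have "z ^ n * z powi j = z ^ nat (j + int n)"
      using n[OF that] power_int_add[of z "int n" j] nz by (simp add: power_int_def add.commute)
    then show ?thesis using ex[of "nat (j + int n)" 0 "r' j"] n[OF that] by (simp add: mult.assoc[symmetric])
  qed
  let ?R = "\<lambda>k. ?A {0..<- k} * r' (- k - int n) - ?A {- k - int n..<- k} * r (- k - int n)"
  have "0 = z ^ n * ((\<Sum>i\<in>I. z powi i * row_eval y (r' i)) - (\<Sum>i\<in>I. x powi (- i) * row_eval y (r i)))"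
    using eq by simp
  also have "\<dots> = (\<Sum>j\<in>I. x powi (- (j + int n)) * row_eval y (?A {0..<j + int n} * r' j - ?A {j..<j + int n} * r j))"
    by (simp add: right_diff_distrib sum_distrib_left left ex evaluate_diff sum_subtractf)
  also have "\<dots> = (\<Sum>k\<in>(\<lambda>j. - (j + int n)) ` I. x powi k * row_eval y (?R k))"
    by (subst sum.reindex) (auto simp: inj_on_def add.commute)
  finally have sum0: "(\<Sum>k\<in>(\<lambda>j. - (j + int n)) ` I. x powi k * row_eval y (?R k)) = 0" by simp
  have "?R k = 0" if "k \<in> (\<lambda>j. - (j + int n)) ` I" for k
    by (rule independent_rows[OF indep finite_imageI[OF I] sum0 that])
  from this[of "- (i + int n)"] have rel: "?A {0..<i + int n} * r' i = ?A {i..<i + int n} * r i"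
    using i by (simp add: add.commute)
  have A_nz: "?A S \<noteq> 0" for S
    by (cases "finite S") (simp_all add: row_factor_nonzero c)
  show "r i = ?A {0..<i} * r' i" if "i \<ge> 0"
  proof -
    have "{0..<i + int n} = {0..<i} \<union> {i..<i + int n}" using that by auto
    then have "?A {0..<i + int n} = ?A {0..<i} * ?A {i..<i + int n}"
      by (simp add: prod.union_disjoint)
    then have "?A {i..<i + int n} * (?A {0..<i} * r' i) = ?A {i..<i + int n} * r i"
      using rel by (simp only: mult_ac)
    then show ?thesis unfolding mult_left_cancel[OF A_nz] by (rule sym)
  qed
  show "r' i = ?A {i..<0} * r i" if "i \<le> 0"
  proof -
    have "{i..<i + int n} = {i..<0} \<union> {0..<i + int n}" using that n[OF i] by auto
    then have "?A {i..<i + int n} = ?A {i..<0} * ?A {0..<i + int n}"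
      by (simp add: prod.union_disjoint)
    then have "?A {0..<i + int n} * (?A {i..<0} * r i) = ?A {0..<i + int n} * r' i"
      using rel by (simp only: mult_ac)
    then show ?thesis unfolding mult_left_cancel[OF A_nz] by (rule sym)
  qed
qed

definition normal_monomial :: "'f \<Rightarrow> 'f \<Rightarrow> int \<Rightarrow> int \<Rightarrow> 'f" where
  "normal_monomial x y i j = V (i * j) * (x powi i * y powi j)"

text \<open>The power of \<open>v\<close> passes from normalized monomials to the products \<open>x\<^bsup>-i\<^esup> y\<^bsup>j\<^esup>\<close> and \<open>z\<^bsup>i\<^esup> y\<^bsup>j\<^esup>\<close>; it is the
same for both, so that one definition serves before and after an exchange.\<close>

definition row_of :: "int set \<Rightarrow> (int \<Rightarrow> int \<Rightarrow> laurent) \<Rightarrow> int \<Rightarrow> row" where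
  "row_of J f i = (\<Sum>j\<in>J. single j (vpow (- (i * j)) * f i j))"

lemma lookup_row_of:
  "finite J \<Longrightarrow> lookup (row_of J f i) j = (if j \<in> J then vpow (- (i * j)) * f i j else 0)"
  by (simp add: row_of_def lookup_sum lookup_single when_def)

lemma row_of_eval:
  "row_eval y (row_of J f i) = (\<Sum>j\<in>J. s (f i j) * (V (- (i * j)) * y powi j))"
  unfolding row_of_def evaluate_sum by (simp add: s_mult V_def s_central[of "vpow _"] mult.assoc)

lemma rows_first:
  "(\<Sum>j\<in>J. s (f i j) * normal_monomial x y (- i) j) = x powi (- i) * row_eval y (row_of J f i)"
  unfolding row_of_eval
  by (simp add: sum_distrib_left s_left_assoc[of "x powi _"] V_left_assoc[of "x powi _"] normal_monomial_def)

lemma rows_second: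
  assumes "z * y = V 2 * (y * z)" "y \<noteq> 0" "z \<noteq> 0"
  shows "(\<Sum>j\<in>J. s (f i j) * normal_monomial y z j i) = z powi i * row_eval y (row_of J f i)"
  unfolding row_of_eval
  by (simp add: sum_distrib_left s_left_assoc[of "z powi _"] V_left_assoc[of "z powi _"] normal_monomial_def
      q_commute_powi[OF assms] V_add mult.commute[of i])

section \<open>Supports under an exchange\<close>

text \<open>The coefficients of the pointed expansion are nonzero exactly on \<open>S\<close>, where their degrees are given
by \<open>D\<close>.\<close>

definition has_support :: "nat \<Rightarrow> nat \<Rightarrow> 'f \<Rightarrow> 'f \<Rightarrow> int \<Rightarrow> int \<Rightarrow> (int \<times> int) set \<Rightarrow> 'f \<Rightarrow> bool" where
  "has_support b c x y a1 a2 S z \<longleftrightarrow> (\<exists>e.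
     (\<forall>p q. ((p, q) \<in> S \<longrightarrow> has_deg (e p q) (Ddeg b c a1 a2 p q)) \<and> ((p, q) \<notin> S \<longrightarrow> e p q = 0)) \<and>
     z = (\<Sum>p\<in>{0..max a2 0}. \<Sum>q\<in>{0..max a1 0}.
       s (e p q) * normal_monomial x y (int b * p - a1) (int c * q - a2)))"

text \<open>A row before the exchange has degree differences indexed by \<open>i, \<dots>, i + h - 1\<close>. The factors that relate
it to the new row are indexed by \<open>0, \<dots>, i - 1\<close> or \<open>i, \<dots>, -1\<close>;
therefore the new differences are indexed by \<open>0, \<dots>, i + h - 1\<close>, which is the shape that \<open>D\<close> prescribes. The start of a row is common to both expansions.\<close>

lemma has_support_mutate:
  fixes b c :: nat and x y z u :: 'f and k m :: int
  defines "a1 \<equiv> int b * max k 0 - m"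
  assumes bc: "b > 0" "c > 0" and nz: "x \<noteq> 0" "y \<noteq> 0" "z \<noteq> 0"
    and yx: "y * x = V 2 * (x * y)" and zy: "z * y = V 2 * (y * z)"
    and xz: "x * z = V (- int c) * y ^ c + 1"
    and indep: "independent_monomials x y"
    and old: "has_support c b y z k m S' u"
    and laurent: "u = evaluate (\<lambda>a. normal_monomial x y (fst a) (snd a)) F"
    and old_box: "\<And>t q. (t, q) \<in> S' \<Longrightarrow> 0 \<le> t \<and> t \<le> max m 0 \<and> 0 \<le> q \<and> q \<le> max k 0"
    and new_box: "\<And>p q. (p, q) \<in> S \<Longrightarrow> 0 \<le> p \<and> p \<le> max k 0 \<and> 0 \<le> q \<and> q \<le> max a1 0"
    and rows: "\<And>p. 0 \<le> p \<Longrightarrow> p \<le> max k 0 \<Longrightarrow> \<exists>h. 0 \<le> h \<and> 0 \<le> h + (a1 - int b * p) \<and>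
      (\<forall>t. (t, max k 0 - p) \<in> S' \<longleftrightarrow> 0 \<le> t \<and> t \<le> h) \<and> (\<forall>q. (p, q) \<in> S \<longleftrightarrow> 0 \<le> q \<and> q \<le> h + (a1 - int b * p))"
  shows "has_support b c x y a1 k S u"
proof -
  obtain e' where e': "\<And>p q. (p, q) \<in> S' \<Longrightarrow> has_deg (e' p q) (Ddeg c b k m p q)"
      "\<And>p q. (p, q) \<notin> S' \<Longrightarrow> e' p q = 0"
    and u_old: "u = (\<Sum>p\<in>{0..max m 0}. \<Sum>q\<in>{0..max k 0}.
       s (e' p q) * normal_monomial y z (int c * p - k) (int b * q - m))"
    using old unfolding has_support_def by blast
  let ?P = "{0..max k 0}" and ?T = "{0..max m 0}"
  define gi gj where "gi = (\<lambda>q. int b * q - m)" and "gj = (\<lambda>t. int c * t - k)"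
  have inj: "inj_on gi A" "inj_on gj A" for A using bc by (auto simp: inj_on_def gi_def gj_def)
  define I J where "I = gi ` ?P \<union> (\<lambda>a. - fst a) ` keys F" and "J = gj ` ?T \<union> snd ` keys F"
  have fin: "finite I" "finite J" by (simp_all add: I_def J_def)
  define f' where "f' i j = (if i \<in> gi ` ?P \<and> j \<in> gj ` ?T then e' ((j + k) div int c) ((i + m) div int b) else 0)" for i j
  define f where "f i j = lookup F (- i, j)" for i j
  have f'_eq: "f' (gi q) (gj t) = e' t q" if "q \<in> ?P" "t \<in> ?T" for q t
    using that bc by (auto simp: f'_def gi_def gj_def)
  have u1: "u = (\<Sum>i\<in>I. z powi i * row_eval y (row_of J f' i))"
  proof -
    have "u = (\<Sum>q\<in>?P. \<Sum>t\<in>?T. s (f' (gi q) (gj t)) * normal_monomial y z (gj t) (gi q))"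
      unfolding u_old by (subst sum.swap, intro sum.cong refl, subst f'_eq) (simp_all add: gi_def gj_def)
    also have "\<dots> = (\<Sum>i\<in>gi ` ?P. \<Sum>j\<in>gj ` ?T. s (f' i j) * normal_monomial y z j i)"
      by (simp add: sum.reindex inj)
    also have "\<dots> = (\<Sum>i\<in>gi ` ?P. \<Sum>j\<in>J. s (f' i j) * normal_monomial y z j i)"
      using fin by (intro sum.cong sum.mono_neutral_left refl) (auto simp: J_def f'_def)
    also have "\<dots> = (\<Sum>i\<in>I. \<Sum>j\<in>J. s (f' i j) * normal_monomial y z j i)"
      using fin by (intro sum.mono_neutral_left) (auto simp: I_def f'_def intro!: sum.neutral)
    finally show ?thesis by (simp add: rows_second[OF zy nz(2,3)])
  qed
  have u2: "u = (\<Sum>i\<in>I. x powi (- i) * row_eval y (row_of J f i))"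
  proof -
    let ?A = "(\<lambda>(i, j). (- i, j)) ` (I \<times> J)"
    have "keys F \<subseteq> ?A"
      by (force simp: I_def J_def image_iff)
    then have "u = (\<Sum>a\<in>?A. s (lookup F a) * normal_monomial x y (fst a) (snd a))"
      unfolding laurent using fin by (intro evaluate_superset) auto
    also have "\<dots> = (\<Sum>(i, j)\<in>I \<times> J. s (f i j) * normal_monomial x y (- i) j)"
      by (subst sum.reindex) (auto simp: inj_on_def f_def intro!: sum.cong)
    also have "\<dots> = (\<Sum>i\<in>I. \<Sum>j\<in>J. s (f i j) * normal_monomial x y (- i) j)"
      by (rule sum.cartesian_product[symmetric])
    finally show ?thesis by (simp add: rows_first)
  qed
  note rel = row_relation[OF bc(2) nz yx xz indep fin(1) u1[symmetric, unfolded u2]]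
  have zero_rows: "row_of J f i = 0" if i: "i \<in> I" "i \<notin> gi ` ?P" for i
  proof -
    have z': "row_of J f' i = 0" using i by (simp add: row_of_def f'_def)
    show ?thesis
    proof (cases "i \<ge> 0")
      case True then show ?thesis using rel(1)[OF i(1)] z' by simp
    next
      case False
      then have "(\<Prod>t\<in>{i..<0}. row_factor c t) * row_of J f i = 0" using rel(2)[OF i(1)] z' by simp
      moreover have "(\<Prod>t\<in>{i..<0}. row_factor c t) \<noteq> 0" using row_factor_nonzero[OF bc(2)] by simp
      ultimately show ?thesis by simp
    qed
  qed
  define \<delta> where "\<delta> q = gi q * k + int b * k * q - int b * q\<^sup>2" for q
  have new_rows: "\<exists>h. 0 \<le> h + (a1 - int b * p) \<and> (\<forall>q. (p, q) \<in> S \<longleftrightarrow> 0 \<le> q \<and> q \<le> h + (a1 - int b * p)) \<and>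
      row_degrees c (- k) (\<delta> (max k 0 - p)) 0 (h + (a1 - int b * p)) (row_of J f (a1 - int b * p))"
    if p: "p \<in> ?P" for p
  proof -
    define q' i where "q' = max k 0 - p" and "i = a1 - int b * p"
    have q': "q' \<in> ?P" and i: "i = gi q'" using p by (auto simp: q'_def i_def a1_def gi_def algebra_simps)
    then have iI: "i \<in> I" by (auto simp: I_def)
    obtain h where h: "0 \<le> h" "0 \<le> h + i" "\<And>t. (t, q') \<in> S' \<longleftrightarrow> 0 \<le> t \<and> t \<le> h"
      "\<And>q. (p, q) \<in> S \<longleftrightarrow> 0 \<le> q \<and> q \<le> h + i"
    proof -
      have p': "0 \<le> p" "p \<le> max k 0" using p by simp_all
      show thesis using rows[OF p', folded q'_def i_def] that by (elim exE conjE) (rule that; blast)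
    qed
    have "row_degrees c (- k) (\<delta> q') i (i + h) (row_of J f' i)"
      unfolding row_degrees_def
    proof (intro conjI allI impI)
      fix t assume t: "0 \<le> t \<and> t \<le> i + h - i"
      then have tS: "(t, q') \<in> S'" using h by simp
      then have tT: "t \<in> ?T" using old_box by auto
      have j: "- k + int c * t = gj t" by (simp add: gj_def)
      have "gj t \<in> J" using tT by (auto simp: J_def)
      then have "lookup (row_of J f' i) (- k + int c * t) = vpow (- (i * gj t)) * e' t q'"
        unfolding j using f'_eq[OF q' tT] fin by (simp add: lookup_row_of i)
      moreover have "has_deg (vpow (- (i * gj t)) * e' t q') (- (i * gj t) + Ddeg c b k m t q')"
        by (intro has_deg_vpow e' tS)
      moreover have "- (i * gj t) + Ddeg c b k m t q' = \<delta> q' - int c * (t\<^sup>2 + 2 * i * t)"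
        by (simp add: i gi_def gj_def Ddeg_def \<delta>_def power2_eq_square algebra_simps)
      ultimately show "has_deg (lookup (row_of J f' i) (- k + int c * t)) (\<delta> q' - int c * (t\<^sup>2 + 2 * i * t))"
        by (simp only:)
    next
      fix j assume j: "\<forall>t. 0 \<le> t \<and> t \<le> i + h - i \<longrightarrow> j \<noteq> - k + int c * t"
      have "f' i j = 0"
      proof (cases "j \<in> gj ` ?T")
        case True
        then obtain t where t: "t \<in> ?T" "j = gj t" by auto
        then have "(t, q') \<notin> S'" using j h by (auto simp: gj_def)
        then show ?thesis using f'_eq[OF q' t(1)] e'(2) t i by simp
      qed (simp add: f'_def)
      then show "lookup (row_of J f' i) j = 0" using fin by (simp add: lookup_row_of)
    qed
    then have "row_degrees c (- k) (\<delta> q') 0 (i + h) (row_of J f i)"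
    proof (cases "i \<ge> 0")
      case True
      then show ?thesis
        using row_degrees_prod_times[OF bc(2) True _ \<open>row_degrees c (- k) (\<delta> q') i (i + h) (row_of J f' i)\<close>] rel(1)[OF iI True] h
        by simp
    next
      case False
      then have "i \<le> 0" by simp
      show ?thesis
        by (rule row_degrees_prod_divide[OF bc(2) \<open>i \<le> 0\<close>])
          (use \<open>row_degrees c (- k) (\<delta> q') i (i + h) (row_of J f' i)\<close> rel(2)[OF iI \<open>i \<le> 0\<close>] h in auto)
    qed
    then show ?thesis using h unfolding i_def[symmetric] q'_def[symmetric] by (auto simp: add.commute[of i])
  qed
  define e where "e p q = (if p \<in> ?P then vpow ((a1 - int b * p) * (int c * q - k)) *
      lookup (row_of J f (a1 - int b * p)) (int c * q - k) else 0)" for p q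
  \<comment> \<open>For \<open>k < 0\<close> the only row is \<open>p = 0\<close>, and the terms in which \<open>k\<close> differs from \<open>[k]\<^sub>+\<close> vanish.\<close>
  have e_deg: "has_deg (e p q) (Ddeg b c a1 k p q)" if S: "(p, q) \<in> S" for p q
  proof -
    have p: "p \<in> ?P" using new_box[OF S] by simp
    define i where "i = a1 - int b * p"
    obtain h where h: "0 \<le> q" "q \<le> h + i" "row_degrees c (- k) (\<delta> (max k 0 - p)) 0 (h + i) (row_of J f i)"
      using new_rows[OF p] S unfolding i_def by blast
    have "has_deg (lookup (row_of J f i) (int c * q - k)) (\<delta> (max k 0 - p) - int c * q\<^sup>2)"
      using row_degrees_has_deg[OF h(3,1)] h(2) by simp
    then have "has_deg (e p q) (i * (int c * q - k) + (\<delta> (max k 0 - p) - int c * q\<^sup>2))"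
      using p unfolding e_def i_def by (simp add: has_deg_vpow)
    moreover have "i * (int c * q - k) + (\<delta> (max k 0 - p) - int c * q\<^sup>2) = Ddeg b c a1 k p q"
    proof (cases "k \<ge> 0")
      case True
      then show ?thesis
        by (simp add: i_def \<delta>_def a1_def gi_def Ddeg_def power2_eq_square algebra_simps)
    next
      case False
      then have "p = 0" using p by simp
      then show ?thesis using False
        by (simp add: i_def \<delta>_def a1_def gi_def Ddeg_def power2_eq_square algebra_simps)
    qed
    ultimately show ?thesis by simp
  qed
  have row_zero: "lookup (row_of J f (a1 - int b * p)) j = 0"
    if p: "p \<in> ?P" and j: "\<And>q. (p, q) \<in> S \<Longrightarrow> j \<noteq> int c * q - k" for p j
  proof -
    obtain h where h: "\<And>q. (p, q) \<in> S \<longleftrightarrow> 0 \<le> q \<and> q \<le> h + (a1 - int b * p)"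
      "row_degrees c (- k) (\<delta> (max k 0 - p)) 0 (h + (a1 - int b * p)) (row_of J f (a1 - int b * p))"
      using new_rows[OF p] by blast
    show ?thesis
      by (rule row_degrees_zero[OF h(2)]) (use h(1) j in force)
  qed
  have e_zero: "e p q = 0" if "(p, q) \<notin> S" for p q
    using row_zero[of p "int c * q - k"] that bc by (auto simp: e_def)
  have P_image: "(\<lambda>p. a1 - int b * p) ` ?P = gi ` ?P"
  proof -
    have "gi ` ?P = gi ` ((\<lambda>p. max k 0 - p) ` ?P)" by simp
    also have "\<dots> = (\<lambda>p. a1 - int b * p) ` ?P"
      unfolding image_image by (intro image_cong) (auto simp: gi_def a1_def algebra_simps)
    finally show ?thesis by simp
  qed
  have "u = (\<Sum>i\<in>gi ` ?P. x powi (- i) * row_eval y (row_of J f i))"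
    unfolding u2
  proof (intro sum.mono_neutral_right ballI)
    show "gi ` ?P \<subseteq> I" by (simp add: I_def)
    fix i assume "i \<in> I - gi ` ?P"
    then show "x powi (- i) * row_eval y (row_of J f i) = 0" using zero_rows by simp
  qed (rule fin)
  also have "\<dots> = (\<Sum>p\<in>?P. x powi (int b * p - a1) * row_eval y (row_of J f (a1 - int b * p)))"
    unfolding P_image[symmetric] using bc by (subst sum.reindex) (auto simp: inj_on_def)
  also have "\<dots> = (\<Sum>p\<in>?P. \<Sum>q\<in>{0..max a1 0}. s (e p q) * normal_monomial x y (int b * p - a1) (int c * q - k))"
  proof (rule sum.cong[OF refl])
    fix p assume p: "p \<in> ?P"
    let ?r = "row_of J f (a1 - int b * p)"
    have "keys ?r \<subseteq> gj ` {0..max a1 0}"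
    proof
      fix j assume "j \<in> keys ?r"
      then obtain q where "(p, q) \<in> S" "j = int c * q - k" using row_zero[OF p, of j] by (auto simp: in_keys_iff)
      then show "j \<in> gj ` {0..max a1 0}" using new_box by (auto simp: gj_def)
    qed
    then have "row_eval y ?r = (\<Sum>q\<in>{0..max a1 0}. s (lookup ?r (gj q)) * y powi (gj q))"
      by (subst evaluate_superset[of "gj ` {0..max a1 0}"]) (simp_all add: sum.reindex inj)
    moreover have "s (e p q) * normal_monomial x y (int b * p - a1) (int c * q - k) =
        x powi (int b * p - a1) * (s (lookup ?r (gj q)) * y powi (gj q))" for q
    proof -
      have "s (e p q) = V ((a1 - int b * p) * (int c * q - k)) * s (lookup ?r (gj q))"
        using p by (simp add: e_def s_mult V_def gj_def)
      moreover have "(a1 - int b * p) * (int c * q - k) + (int b * p - a1) * (int c * q - k) = 0"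
        by (simp add: algebra_simps)
      ultimately show ?thesis
        by (simp add: normal_monomial_def V_left_assoc[of "s _"] V_add s_left_assoc[of "x powi _"] mult.assoc gj_def)
    qed
    ultimately show "x powi (int b * p - a1) * row_eval y ?r =
      (\<Sum>q\<in>{0..max a1 0}. s (e p q) * normal_monomial x y (int b * p - a1) (int c * q - k))"
      by (simp add: sum_distrib_left)
  qed
  finally show ?thesis unfolding has_support_def using e_deg e_zero by blast
qed

section \<open>Laurent expansions\<close>

definition laurent_ring :: "'f \<Rightarrow> 'f \<Rightarrow> 'f set" where
  "laurent_ring x y = range (evaluate (\<lambda>a. normal_monomial x y (fst a) (snd a)))"

lemma laurent_ring_add: "u \<in> laurent_ring x y \<Longrightarrow> u' \<in> laurent_ring x y \<Longrightarrow> u + u' \<in> laurent_ring x y"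
  unfolding laurent_ring_def by (auto simp flip: evaluate_add)

lemma laurent_ring_0: "0 \<in> laurent_ring x y"
  unfolding laurent_ring_def by (rule range_eqI[of _ _ 0]) simp

lemma laurent_ring_uminus: "u \<in> laurent_ring x y \<Longrightarrow> - u \<in> laurent_ring x y"
  unfolding laurent_ring_def by (auto simp flip: evaluate_uminus)

lemma laurent_ring_term: "s f * normal_monomial x y i j \<in> laurent_ring x y"
  unfolding laurent_ring_def by (rule range_eqI[of _ _ "single (i, j) f"]) simp

lemma laurent_ring_induct [consumes 1, case_names zero single add]:
  assumes "u \<in> laurent_ring x y" "P 0" "\<And>f i j. P (s f * normal_monomial x y i j)" "\<And>u v. P u \<Longrightarrow> P v \<Longrightarrow> P (u + v)"
  shows "P u"
proof -
  have "P (evaluate (\<lambda>a. normal_monomial x y (fst a) (snd a)) F)" for F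
    by (induction F rule: poly_mapping_single_induct) (simp_all add: assms evaluate_add)
  then show ?thesis using assms(1) by (auto simp: laurent_ring_def)
qed

lemma normal_monomial_mult:
  assumes "y * x = V 2 * (x * y)" "x \<noteq> 0" "y \<noteq> 0"
  shows "normal_monomial x y i j * normal_monomial x y k l = V (j * k - i * l) * normal_monomial x y (i + k) (j + l)"
proof -
  have "x powi i * y powi j * (x powi k * y powi l) = x powi i * (y powi j * x powi k) * y powi l"
    by (simp add: mult.assoc)
  also have "\<dots> = V (2 * k * j) * (x powi (i + k) * y powi (j + l))"
    by (simp add: q_commute_powi[OF assms] power_int_add assms(2,3) V_left_assoc[of "x powi _"] mult.assoc)
  finally show ?thesis
    by (simp add: normal_monomial_def V_left_assoc[of "x powi _"] V_left_assoc[of "y powi _"] V_add mult.assoc algebra_simps)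
qed

lemma laurent_ring_mult:
  assumes "y * x = V 2 * (x * y)" "x \<noteq> 0" "y \<noteq> 0"
    and "u \<in> laurent_ring x y" "u' \<in> laurent_ring x y"
  shows "u * u' \<in> laurent_ring x y"
  using assms(4)
proof (induction u rule: laurent_ring_induct)
  case (single f i j)
  show ?case using assms(5)
  proof (induction u' rule: laurent_ring_induct)
    case (single g k l)
    have "s f * normal_monomial x y i j * (s g * normal_monomial x y k l) =
        s (f * g * vpow (j * k - i * l)) * normal_monomial x y (i + k) (j + l)"
      by (simp add: s_left_assoc[of "normal_monomial _ _ _ _"] mult.assoc normal_monomial_mult[OF assms(1-3)] s_mult V_def)
    then show ?case by (simp add: laurent_ring_term)
  qed (auto simp: distrib_left intro: laurent_ring_0 laurent_ring_add)
qed (auto simp: distrib_right intro: laurent_ring_0 laurent_ring_add)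

lemma laurent_ring_powi:
  shows "x powi i \<in> laurent_ring x y" "y powi j \<in> laurent_ring x y" "V k \<in> laurent_ring x y" "1 \<in> laurent_ring x y"
  using laurent_ring_term[of 1 x y i 0] laurent_ring_term[of 1 x y 0 j]
    laurent_ring_term[of "vpow k" x y 0 0] laurent_ring_term[of 1 x y 0 0]
  by (simp_all add: normal_monomial_def V_def vpow_0)

lemma laurent_ring_power:
  assumes "y * x = V 2 * (x * y)" "x \<noteq> 0" "y \<noteq> 0" "u \<in> laurent_ring x y"
  shows "u ^ n \<in> laurent_ring x y"
  by (induction n) (auto intro: laurent_ring_powi laurent_ring_mult[OF assms(1-3)] assms(4))

text \<open>The new pair inherits the independence: by the comparison of rows, a relation between monomials in \<open>y\<close> and \<open>z\<close>
has trivial rows. In particular no cluster variable vanishes.\<close>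

lemma mutated_pair:
  assumes c: "c > 0" and nz: "x \<noteq> 0" "y \<noteq> 0" and yx: "y * x = V 2 * (x * y)"
    and indep: "independent_monomials x y" and zx: "z * x = V (int c) * y ^ c + 1"
  shows "z \<noteq> 0" and "z * y = V 2 * (y * z)" and "independent_monomials y z"
proof -
  have comm: "y ^ c * x = V (2 * int c) * (x * y ^ c)"
    using q_commute_powers[OF yx, of c 1] by simp
  have "x * z * x = (V (- int c) * y ^ c + 1) * x"
    by (simp add: zx mult.assoc distrib_left distrib_right comm V_left_assoc[of x] V_add)
  then have xz: "x * z = V (- int c) * y ^ c + 1" using nz by simp
  show z: "z \<noteq> 0"
  proof
    assume "z = 0"
    let ?F = "single (0, int c) (vpow (int c)) + single (0, 0) 1 :: int \<times> int \<Rightarrow>\<^sub>0 laurent"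
    have "evaluate (\<lambda>a. x powi fst a * y powi snd a) ?F = V (int c) * y ^ c + 1"
      by (simp add: evaluate_add V_def)
    also have "\<dots> = 0" using zx \<open>z = 0\<close> by simp
    finally have "?F = 0" using indep by (simp add: independent_monomials_def)
    then have "lookup ?F (0, 0) = 0" by simp
    then show False using c by (simp add: lookup_add lookup_single when_def)
  qed
  show zy: "z * y = V 2 * (y * z)"
  proof -
    have "x * (z * y) = (x * z) * y" by (simp add: mult.assoc)
    also have "\<dots> = y * (x * z)"
      by (simp add: xz distrib_left distrib_right V_left_assoc[of y] mult.assoc power_commutes)
    also have "\<dots> = (y * x) * z" by (simp add: mult.assoc)
    also have "\<dots> = x * (V 2 * (y * z))" by (simp add: V_left_assoc[of x] yx mult.assoc)
    finally show ?thesis using nz by simp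
  qed
  show "independent_monomials y z"
    unfolding independent_monomials_def
  proof (intro allI impI)
    fix F :: "int \<times> int \<Rightarrow>\<^sub>0 laurent" assume F: "evaluate (\<lambda>a. y powi fst a * z powi snd a) F = 0"
    define I J where "I = snd ` keys F" and "J = fst ` keys F"
    have fin: "finite I" "finite J" by (simp_all add: I_def J_def)
    define f where "f i j = vpow (- (i * j)) * lookup F (j, i)" for i j
    have coeff: "s (f i j) * normal_monomial y z j i = s (lookup F (j, i)) * (y powi j * z powi i)" for i j
      by (simp add: f_def s_mult normal_monomial_def V_left_assoc[of "s _"] V_add mult.assoc mult.commute[of j] flip: V_def)
    have sub: "keys F \<subseteq> J \<times> I" by (force simp: I_def J_def)
    have "0 = (\<Sum>a\<in>J \<times> I. s (lookup F a) * (y powi fst a * z powi snd a))"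
      using evaluate_superset[OF _ sub, of "\<lambda>a. y powi fst a * z powi snd a"] fin F by simp
    also have "\<dots> = (\<Sum>j\<in>J. \<Sum>i\<in>I. s (f i j) * normal_monomial y z j i)"
      by (simp add: coeff sum.cartesian_product case_prod_beta)
    also have "\<dots> = (\<Sum>i\<in>I. z powi i * row_eval y (row_of J f i))"
      by (subst sum.swap) (simp add: rows_second[OF zy nz(2) z])
    finally have sum: "(\<Sum>i\<in>I. z powi i * row_eval y (row_of J f i)) = (\<Sum>i\<in>I. x powi (- i) * row_eval y ((\<lambda>_. 0) i))"
      by simp
    have "row_of J f i = 0" if "i \<in> I" for i
    proof (cases "i \<ge> 0")
      case True
      have "(\<Prod>t\<in>{0..<i}. row_factor c t) \<noteq> 0" using row_factor_nonzero[OF c] by simp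
      then show ?thesis using row_relation(1)[OF c nz z yx xz indep fin(1) sum that True] by simp
    next
      case False
      then show ?thesis using row_relation(2)[OF c nz z yx xz indep fin(1) sum that] by simp
    qed
    then have "vpow (- (i * j)) * f i j = 0" if "i \<in> I" "j \<in> J" for i j
      using lookup_row_of[OF fin(2), of f i j] that by simp
    then have zero: "lookup F (j, i) = 0" if "i \<in> I" "j \<in> J" for i j
      using that by (force simp: f_def)
    show "F = 0"
    proof (rule poly_mapping_eqI)
      fix a :: "int \<times> int"
      show "lookup F a = lookup 0 a"
        using zero[of "snd a" "fst a"] by (cases "a \<in> keys F") (auto simp: I_def J_def in_keys_iff)
    qed
  qed
qed

end

section \<open>Cluster monomials to the right of the initial cluster\<close>

locale independent_cluster_sequence = cluster_sequence +
  assumes independent: "independent_monomials (X m) (X (m + 1))"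
begin

lemma shift_independent: "independent_cluster_sequence s c b (\<lambda>m. X (m + 1))"
proof -
  interpret sh: cluster_sequence s c b "\<lambda>m. X (m + 1)" by (rule shift)
  show ?thesis by unfold_locales (rule independent)
qed

lemma q_commute_initial: "X 2 * X 1 = V 2 * (X 1 * X 2)"
  using q_commute[of 1] by simp

lemmas laurent_closed = laurent_ring_mult[OF q_commute_initial X_nonzero X_nonzero]
  laurent_ring_power[OF q_commute_initial X_nonzero X_nonzero]

text \<open>The Laurent phenomenon, in the form needed here: the variables \<open>X\<^sub>0\<close>, \<open>X\<^sub>1\<close>, \<open>X\<^sub>2\<close>, \<open>X\<^sub>3\<close> that
occur in standard monomials are Laurent polynomials in \<open>X\<^sub>1\<close> and \<open>X\<^sub>2\<close>.\<close>

lemma lattice_laurent: "u \<in> lattice d P \<Longrightarrow> u \<in> laurent_ring (X 1) (X 2)"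
proof (induction u rule: lattice.induct)
  case (gen a e)
  let ?L = "laurent_ring (X 1) (X 2)"
  have X12: "X 1 \<in> ?L" "X 2 \<in> ?L"
    using laurent_ring_powi(1)[where i = 1] laurent_ring_powi(2)[where j = 1] by auto
  have inv: "inverse (X 1) \<in> ?L" "inverse (X 2) \<in> ?L"
    using laurent_ring_powi(1)[where i = "-1"] laurent_ring_powi(2)[where j = "-1"] by auto
  have "X 1 * X 3 = V (- int c) * X 2 ^ c + 1" using exchange_opposite[of 2] by (simp add: exch_def)
  then have "X 3 = inverse (X 1) * (V (- int c) * X 2 ^ c + 1)"
    by (metis X_nonzero left_inverse mult.assoc mult_1_left)
  then have X3: "X 3 \<in> ?L" using X12 inv by (auto intro!: laurent_closed laurent_ring_add laurent_ring_powi)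
  have "X 0 = inverse (X 2) * (V (int b) * X 1 ^ b + 1)"
    using X20 by (metis X_nonzero left_inverse mult.assoc mult_1_left)
  then have X0: "X 0 \<in> ?L" using X12 inv by (auto intro!: laurent_closed laurent_ring_add laurent_ring_powi)
  show ?case unfolding M_def w_def
    by (intro laurent_closed laurent_ring_powi X12 X3 X0)
qed (auto intro: laurent_ring_0 laurent_ring_add laurent_ring_uminus)

end

lemma in_cluster_cone_unique: "in_cluster_cone b c n s1 s2 a \<Longrightarrow> in_cluster_cone b c n s1 s2 a' \<Longrightarrow> a = a'"
  by (simp add: in_cluster_cone_def prod_eq_iff)


text \<open>The induction step applies the hypothesis to the cluster \<open>(X\<^sub>2, X\<^sub>3)\<close>, with \<open>b\<close> and \<open>c\<close> exchanged, and
translates the result by the comparison of standard monomials.\<close>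

lemma cluster_monomial_lattice:
  fixes s :: "laurent \<Rightarrow> 'f::division_ring"
  assumes "n \<ge> 1" "cluster_sequence s b c X" "in_cluster_cone b c n s1 s2 a"
  shows "central_scalars.V s (int s1 * int s2) * (X n ^ s1 * X (n + 1) ^ s2) - cluster_sequence.M s X a
    \<in> cluster_sequence.lattice s X 1 (\<lambda>_. True)"
  using assms
proof (induction n arbitrary: b c X a rule: int_ge_induct)
  case base
  interpret cluster_sequence s b c X by fact
  have "a = (- int s1, - int s2)" using base(2) by (simp add: in_cluster_cone_def dvec_initial prod_eq_iff)
  then show ?case by (simp add: M_def w_def lattice.zero)
next
  case (step n)
  interpret cluster_sequence s b c X by fact
  interpret sh: cluster_sequence s c b "\<lambda>m. X (m + 1)" by (rule shift)
  define a' where "a' = (int s1 * fst (dvec c b n) + int s2 * fst (dvec c b (n + 1)),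
      int s1 * snd (dvec c b n) + int s2 * snd (dvec c b (n + 1)))"
  have a': "in_cluster_cone c b n s1 s2 a'" by (simp add: a'_def in_cluster_cone_def)
  have a: "a = (int b * max (fst a') 0 - snd a', fst a')"
    by (rule in_cluster_cone_unique[OF step.prems(2) in_cluster_cone_shift[OF b_pos c_pos a']])
  let ?x = "V (int s1 * int s2) * (X (n + 1) ^ s1 * X (n + 1 + 1) ^ s2)"
  have "?x - sh.M a' \<in> sh.lattice 1 (\<lambda>_. True)"
    by (rule step.IH[OF sh.cluster_sequence_axioms a'])
  then have "?x - sh.M a' \<in> lattice 1 (\<lambda>_. True)" by (rule shifted_lattice)
  moreover have "sh.M a' - M a \<in> lattice 1 (\<lambda>_. True)"
    using shifted_M[of "fst a'" "snd a'"] unfolding a by simp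
  ultimately have "(?x - sh.M a') + (sh.M a' - M a) \<in> lattice 1 (\<lambda>_. True)" by (rule lattice.add)
  then show ?case by simp
qed

definition integer_support :: "nat \<Rightarrow> nat \<Rightarrow> int \<Rightarrow> nat \<Rightarrow> nat \<Rightarrow> (int \<times> int) set" where
  "integer_support b c n s1 s2 = {(p, q). (of_int p, of_int q) \<in> minkowski_support b c n s1 s2}"

lemma integer_support_box:
  assumes "b > 0" "c > 0" "in_cluster_cone b c n s1 s2 a" "(p, q) \<in> integer_support b c n s1 s2"
  shows "0 \<le> p \<and> p \<le> max (snd a) 0 \<and> 0 \<le> q \<and> q \<le> max (fst a) 0"
proof -
  have "0 \<le> real_of_int p \<and> real_of_int p \<le> of_int (max (snd a) 0) \<and> 0 \<le> real_of_int q \<and> real_of_int q \<le> of_int (max (fst a) 0)"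
    using minkowski_support_axes(1)[OF assms(1,2), of "of_int p" "of_int q" n s1 s2] assms(3,4)
    by (simp add: in_cluster_cone_def integer_support_def)
  then show ?thesis by (simp only: of_int_0_le_iff of_int_le_iff)
qed

text \<open>The induction follows the change of the initial cluster as well; the congruence with a standard
monomial guarantees that the element has a Laurent expansion in the new cluster.\<close>

lemma cluster_monomial_support:
  fixes s :: "laurent \<Rightarrow> 'f::division_ring"
  assumes "n \<ge> 1" "independent_cluster_sequence s b c X" "in_cluster_cone b c n s1 s2 a"
  shows "central_scalars.has_support s b c (X 1) (X 2) (fst a) (snd a) (integer_support b c n s1 s2)
    (central_scalars.V s (int s1 * int s2) * (X n ^ s1 * X (n + 1) ^ s2))"
  using assms
proof (induction n arbitrary: b c X a rule: int_ge_induct)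
  case base
  interpret independent_cluster_sequence s b c X by fact
  have a: "a = (- int s1, - int s2)" using base(2) by (simp add: in_cluster_cone_def dvec_initial prod_eq_iff)
  have "(0, 0) \<in> minkowski_support b c 1 s1 s2"
    by (rule minkowski_support_axes(2)[OF b_pos c_pos]) simp_all
  then have S: "integer_support b c 1 s1 s2 = {(0, 0)}"
  proof -
    have "p = 0 \<and> q = 0" if "(p, q) \<in> integer_support b c 1 s1 s2" for p q
      using integer_support_box[OF b_pos c_pos base(2) that] by (simp add: a)
    moreover have "(0, 0) \<in> integer_support b c 1 s1 s2"
      using \<open>(0, 0) \<in> minkowski_support b c 1 s1 s2\<close> by (simp add: integer_support_def)
    ultimately show ?thesis by auto
  qed
  define e :: "int \<Rightarrow> int \<Rightarrow> laurent" where "e p q = (if p = 0 \<and> q = 0 then 1 else 0)" for p q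
  have "has_deg 1 0" by (simp add: has_deg_def lookup_one)
  then show ?case unfolding has_support_def S
    by (intro exI[of _ e]) (simp add: e_def a Ddeg_def normal_monomial_def)
next
  case (step n)
  interpret independent_cluster_sequence s b c X by fact
  interpret sh: independent_cluster_sequence s c b "\<lambda>m. X (m + 1)" by (rule shift_independent)
  define k m where "k = int s1 * fst (dvec c b n) + int s2 * fst (dvec c b (n + 1))"
    and "m = int s1 * snd (dvec c b n) + int s2 * snd (dvec c b (n + 1))"
  have a': "in_cluster_cone c b n s1 s2 (k, m)" by (simp add: k_def m_def in_cluster_cone_def)
  have a: "fst a = int b * max k 0 - m" "snd a = k"
    using in_cluster_cone_unique[OF step.prems(2) in_cluster_cone_shift[OF b_pos c_pos a']] by simp_all
  let ?x = "V (int s1 * int s2) * (X (n + 1) ^ s1 * X (n + 1 + 1) ^ s2)"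
  have old: "has_support c b (X 2) (X 3) k m (integer_support c b n s1 s2) ?x"
    using step.IH[OF sh.independent_cluster_sequence_axioms a'] by simp
  have "?x - M a \<in> lattice 1 (\<lambda>_. True)"
    by (rule cluster_monomial_lattice[OF _ cluster_sequence_axioms step.prems(2)]) (use step.hyps in simp)
  then have "(?x - M a) + M a \<in> laurent_ring (X 1) (X 2)"
    by (intro laurent_ring_add lattice_laurent[where P = "\<lambda>_. True"] lattice_laurent[where d = 0 and P = "\<lambda>_. True"]) (auto intro: lattice_M lattice_laurent)
  then obtain F where F: "?x = evaluate (\<lambda>a. normal_monomial (X 1) (X 2) (fst a) (snd a)) F"
    by (auto simp: laurent_ring_def)
  have "has_support b c (X 1) (X 2) (int b * max k 0 - m) k (integer_support b c (n + 1) s1 s2) ?x"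
  proof (rule has_support_mutate[OF b_pos c_pos X_nonzero X_nonzero X_nonzero _ _ _ _ old F])
    show "X 2 * X 1 = V 2 * (X 1 * X 2)" "X 3 * X 2 = V 2 * (X 2 * X 3)"
      using q_commute[of 1] q_commute[of 2] by simp_all
    show "X 1 * X 3 = V (- int c) * X 2 ^ c + 1" using exchange_opposite[of 2] by (simp add: exch_def)
    show "independent_monomials (X 1) (X 2)" using independent[of 1] by simp
    show "0 \<le> t \<and> t \<le> max m 0 \<and> 0 \<le> q \<and> q \<le> max k 0" if "(t, q) \<in> integer_support c b n s1 s2" for t q
      using integer_support_box[OF c_pos b_pos a' that] by simp
    show "0 \<le> p \<and> p \<le> max k 0 \<and> 0 \<le> q \<and> q \<le> max (int b * max k 0 - m) 0"
      if "(p, q) \<in> integer_support b c (n + 1) s1 s2" for p q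
      using integer_support_box[OF b_pos c_pos step.prems(2) that] by (simp add: a)
    fix p assume p: "0 \<le> p" "p \<le> max k 0"
    have i: "int b * (max k 0 - p) - m = int b * max k 0 - m - int b * p" by (simp add: algebra_simps)
    have km: "fst_before b c n s1 s2 = k" "snd_before b c n s1 s2 = m"
      by (simp_all add: fst_before_def[OF b_pos c_pos] snd_before_def[OF b_pos c_pos] k_def m_def)
    show "\<exists>h. 0 \<le> h \<and> 0 \<le> h + (int b * max k 0 - m - int b * p) \<and>
      (\<forall>t. (t, max k 0 - p) \<in> integer_support c b n s1 s2 \<longleftrightarrow> 0 \<le> t \<and> t \<le> h) \<and>
      (\<forall>q. (p, q) \<in> integer_support b c (n + 1) s1 s2 \<longleftrightarrow> 0 \<le> q \<and> q \<le> h + (int b * max k 0 - m - int b * p))"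
      using support_rows[OF b_pos c_pos, of p n s1 s2] p unfolding km i integer_support_def mem_Collect_eq prod.case
      by (metis (no_types, lifting))
  qed
  then show ?case by (simp add: a)
qed

section \<open>The opposite ring and the remaining cluster monomials\<close>

text \<open>In the opposite ring the reversed sequence \<open>X\<^bsub>3-m\<^esub>\<close> satisfies the same relations with the same \<open>v\<close>,
whereas in the ring itself \<open>v\<close> would have to be inverted, which does not preserve the lattice.\<close>

typedef 'a opposite = "UNIV :: 'a set" morphisms unop op ..

setup_lifting type_definition_opposite

instantiation opposite :: (division_ring) division_ring
begin

lift_definition zero_opposite :: "'a opposite" is 0 .
lift_definition one_opposite :: "'a opposite" is 1 .
lift_definition plus_opposite :: "'a opposite \<Rightarrow> 'a opposite \<Rightarrow> 'a opposite" is "(+)" .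
lift_definition minus_opposite :: "'a opposite \<Rightarrow> 'a opposite \<Rightarrow> 'a opposite" is "(-)" .
lift_definition uminus_opposite :: "'a opposite \<Rightarrow> 'a opposite" is uminus .
lift_definition times_opposite :: "'a opposite \<Rightarrow> 'a opposite \<Rightarrow> 'a opposite" is "\<lambda>x y. y * x" .
lift_definition inverse_opposite :: "'a opposite \<Rightarrow> 'a opposite" is inverse .
definition divide_opposite :: "'a opposite \<Rightarrow> 'a opposite \<Rightarrow> 'a opposite" where
  "divide_opposite x y = x * inverse y"

instance
  by standard
    (transfer; simp add: mult.assoc distrib_left distrib_right divide_opposite_def)+

end

lemma op_eq_iff: "op x = op y \<longleftrightarrow> x = y"
  by (metis op_inverse UNIV_I)

lemma op_hom: "op x * op y = op (y * x)" "op x + op y = op (x + y)" "op x - op y = op (x - y)"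
  "- op x = op (- x)" "1 = op 1" "0 = op 0" "inverse (op x) = op (inverse x)"
  by (simp_all add: times_opposite.abs_eq plus_opposite.abs_eq minus_opposite.abs_eq uminus_opposite.abs_eq
      one_opposite_def zero_opposite_def inverse_opposite.abs_eq)

lemma op_power: "op x ^ n = op (x ^ n)"
  by (induction n) (simp_all add: op_hom power_commutes)

lemma op_powi: "op x powi i = op (x powi i)"
  by (simp add: power_int_def op_power op_hom)

lemma op_sum: "(\<Sum>a\<in>A. op (f a)) = op (\<Sum>a\<in>A. f a)"
  by (induction A rule: infinite_finite_induct) (simp_all add: op_hom)

context central_scalars
begin

lemma opposite_scalars: "central_scalars (\<lambda>f. op (s f))"
proof
  show "op (s f) * z = z * op (s f)" for f z
    by (cases z) (simp add: op_hom s_central)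
  show "op (s (f * g)) = op (s f) * op (s g)" for f g
    by (simp add: op_hom op_eq_iff s_mult) (rule s_central)
qed (simp_all add: op_hom s_add)

lemma V_opposite: "central_scalars.V (\<lambda>f. op (s f)) k = op (V k)"
  by (simp add: V_def central_scalars.V_def[OF opposite_scalars])

lemma evaluate_opposite: "central_scalars.evaluate (\<lambda>f. op (s f)) (\<lambda>a. op (G a)) F = op (evaluate G F)"
  by (simp add: evaluate_def central_scalars.evaluate_def[OF opposite_scalars] op_hom op_sum s_central)

definition swap_keys :: "(int \<times> int \<Rightarrow>\<^sub>0 laurent) \<Rightarrow> (int \<times> int \<Rightarrow>\<^sub>0 laurent)" where
  "swap_keys F = (\<Sum>a\<in>keys F. single (prod.swap a) (lookup F a))"

lemma evaluate_swap: "evaluate G (swap_keys F) = evaluate (\<lambda>a. G (prod.swap a)) F"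
  unfolding swap_keys_def evaluate_sum evaluate_single by (simp add: evaluate_def)

lemma lookup_swap_keys: "lookup (swap_keys F) a = lookup F (prod.swap a)"
proof -
  have "prod.swap x = a \<longleftrightarrow> x = prod.swap a" for x by (cases x; cases a) auto
  then show ?thesis unfolding swap_keys_def by (simp add: lookup_sum lookup_single when_def in_keys_iff)
qed

lemma swap_keys_swap_keys: "swap_keys (swap_keys F) = F"
  by (rule poly_mapping_eqI) (simp add: lookup_swap_keys)

lemma swap_keys_0: "swap_keys 0 = 0"
  by (simp add: swap_keys_def)

lemma independent_opposite:
  "central_scalars.independent_monomials (\<lambda>f. op (s f)) (op y) (op x) \<longleftrightarrow> independent_monomials x y"
proof -
  have "central_scalars.evaluate (\<lambda>f. op (s f)) (\<lambda>a. op y powi fst a * op x powi snd a) F =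
      op (evaluate (\<lambda>a. x powi fst a * y powi snd a) (swap_keys F))" for F
    unfolding evaluate_swap op_powi op_hom(1) evaluate_opposite by simp
  then show ?thesis
    unfolding central_scalars.independent_monomials_def[OF opposite_scalars] independent_monomials_def
    by (simp add: op_hom op_eq_iff) (metis swap_keys_swap_keys swap_keys_0)
qed

lemma has_support_opposite:
  assumes "central_scalars.has_support (\<lambda>f. op (s f)) c b (op y) (op x) a2 a1 S (op z)"
  shows "has_support b c x y a1 a2 {(p, q). (q, p) \<in> S} z"
proof -
  interpret r: central_scalars "\<lambda>f. op (s f)" by (rule opposite_scalars)
  have mon: "r.normal_monomial (op y) (op x) j i = op (normal_monomial x y i j)" for i j
    by (simp only: r.normal_monomial_def normal_monomial_def V_opposite op_powi op_hom(1) mult.commute[of i j] V_left)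
  obtain e where e: "\<And>p q. (p, q) \<in> S \<Longrightarrow> has_deg (e p q) (Ddeg c b a2 a1 p q)" "\<And>p q. (p, q) \<notin> S \<Longrightarrow> e p q = 0"
    and z: "op z = (\<Sum>p\<in>{0..max a1 0}. \<Sum>q\<in>{0..max a2 0}.
       op (s (e p q)) * r.normal_monomial (op y) (op x) (int c * p - a2) (int b * q - a1))"
    using assms unfolding r.has_support_def by blast
  have "z = (\<Sum>p\<in>{0..max a1 0}. \<Sum>q\<in>{0..max a2 0}. s (e p q) * normal_monomial x y (int b * q - a1) (int c * p - a2))"
    using z by (simp only: mon op_hom(1) op_sum op_eq_iff s_central)
  then have "z = (\<Sum>p\<in>{0..max a2 0}. \<Sum>q\<in>{0..max a1 0}. s (e q p) * normal_monomial x y (int b * p - a1) (int c * q - a2))"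
    by (subst sum.swap)
  moreover have "Ddeg c b a2 a1 q p = Ddeg b c a1 a2 p q" for p q
    by (simp add: Ddeg_def algebra_simps)
  ultimately show ?thesis
    unfolding has_support_def using e by (intro exI[of _ "\<lambda>p q. e q p"]) auto
qed

end

context independent_cluster_sequence
begin

text \<open>The reflection \<open>m \<mapsto> 3 - m\<close> exchanges the two initial variables and, as it changes the parity, also \<open>b\<close> and \<open>c\<close>.\<close>

lemma reflect: "independent_cluster_sequence (\<lambda>f. op (s f)) c b (\<lambda>m. op (X (3 - m)))"
proof -
  interpret r: central_scalars "\<lambda>f. op (s f)" by (rule opposite_scalars)
  show ?thesis
  proof unfold_locales
    fix m
    show "op (X (3 - m)) \<noteq> 0" by (simp add: op_hom op_eq_iff)
    show "op (X (3 - (m + 1))) * op (X (3 - m)) = r.V 2 * (op (X (3 - m)) * op (X (3 - (m + 1))))"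
    proof -
      have "X (3 - m) * X (3 - (m + 1)) = V 2 * (X (3 - (m + 1)) * X (3 - m))" using q_commute[of "2 - m"] by simp
      then show ?thesis by (simp only: V_opposite op_hom(1) V_left)
    qed
    have "exch c b m = exch b c (3 - m)" by (simp add: exch_def)
    then have "X (3 - (m - 1)) * X (3 - (m + 1)) = V (int (exch c b m)) * X (3 - m) ^ exch c b m + 1"
      using exchange[of "3 - m"] by simp
    then show "op (X (3 - (m + 1))) * op (X (3 - (m - 1))) = r.V (int (exch c b m)) * op (X (3 - m)) ^ exch c b m + 1"
      by (simp only: V_opposite op_hom(1,2,5) op_power V_left)
    show "r.independent_monomials (op (X (3 - m))) (op (X (3 - (m + 1))))"
      using independent[of "2 - m"] by (simp add: independent_opposite)
  qed (use b_pos c_pos in auto)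
qed

lemma reflected_M:
  "cluster_sequence.M (\<lambda>f. op (s f)) (\<lambda>m. op (X (3 - m))) a = op (M (prod.swap a))"
proof -
  interpret r: independent_cluster_sequence "\<lambda>f. op (s f)" c b "\<lambda>m. op (X (3 - m))" by (rule reflect)
  show ?thesis
    by (simp add: r.M_def r.w_def V_opposite op_hom(1) op_power op_eq_iff)
      (simp add: M_def w_def mult.assoc mult.commute[of "fst a"] V_out)
qed

lemma reflected_lattice:
  assumes "u \<in> cluster_sequence.lattice (\<lambda>f. op (s f)) (\<lambda>m. op (X (3 - m))) d (\<lambda>_. True)"
  shows "unop u \<in> lattice d (\<lambda>_. True)"
proof -
  interpret r: independent_cluster_sequence "\<lambda>f. op (s f)" c b "\<lambda>m. op (X (3 - m))" by (rule reflect)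
  have unop: "unop (op z) = z" for z by (rule op_inverse) simp
  from assms show ?thesis
  proof (induction u rule: r.lattice.induct)
    case zero
    then show ?case by (simp add: op_hom unop lattice.zero)
  next
    case (gen a e)
    then show ?case by (simp add: reflected_M V_opposite op_hom(1) unop V_left[of "M _"] lattice.gen)
  next
    case (uminus x)
    then show ?case by (simp add: uminus_opposite.rep_eq lattice.uminus)
  next
    case (add x y)
    then show ?case by (simp add: plus_opposite.rep_eq lattice.add)
  qed
qed

abbreviation cluster_mon :: "int \<Rightarrow> nat \<Rightarrow> nat \<Rightarrow> 'a" where
  "cluster_mon n s1 s2 \<equiv> V (int s1 * int s2) * (X n ^ s1 * X (n + 1) ^ s2)"

lemma reflected_cluster_mon:
  "central_scalars.V (\<lambda>f. op (s f)) (int s2 * int s1) * (op (X (3 - (2 - n))) ^ s2 * op (X (3 - (2 - n + 1))) ^ s1) =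
    op (cluster_mon n s1 s2)"
proof -
  have "3 - (2 - n) = n + 1" "3 - (2 - n + 1) = n" by simp_all
  then show ?thesis
    by (simp only: V_opposite op_hom(1) op_power mult.commute[of "int s2" "int s1"] V_left)
qed

theorem cluster_monomials_in_lattice:
  assumes "in_cluster_cone b c n s1 s2 a"
  shows "cluster_mon n s1 s2 - M a \<in> lattice 1 (\<lambda>_. True)"
proof (cases "n \<ge> 1")
  case True
  then show ?thesis by (rule cluster_monomial_lattice[OF _ cluster_sequence_axioms assms])
next
  case False
  interpret r: independent_cluster_sequence "\<lambda>f. op (s f)" c b "\<lambda>m. op (X (3 - m))" by (rule reflect)
  have "op (cluster_mon n s1 s2) - r.M (prod.swap a) \<in> r.lattice 1 (\<lambda>_. True)"
    using cluster_monomial_lattice[OF _ r.cluster_sequence_axioms in_cluster_cone_reflect[OF assms]] False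
    unfolding reflected_cluster_mon by simp
  from reflected_lattice[OF this] show ?thesis
    by (simp add: reflected_M op_hom op_inverse)
qed

theorem cluster_monomials_support:
  assumes "in_cluster_cone b c n s1 s2 (a1, a2)"
  shows "has_support b c (X 1) (X 2) a1 a2 (integer_support b c n s1 s2) (cluster_mon n s1 s2)"
proof (cases "n \<ge> 1")
  case True
  then show ?thesis using cluster_monomial_support[OF _ independent_cluster_sequence_axioms assms] by simp
next
  case False
  interpret r: independent_cluster_sequence "\<lambda>f. op (s f)" c b "\<lambda>m. op (X (3 - m))" by (rule reflect)
  have "r.has_support c b (op (X 2)) (op (X 1)) a2 a1 (integer_support c b (2 - n) s2 s1) (op (cluster_mon n s1 s2))"
    using cluster_monomial_support[OF _ r.independent_cluster_sequence_axioms in_cluster_cone_reflect[OF assms]] False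
    unfolding reflected_cluster_mon by simp
  then have "has_support b c (X 1) (X 2) a1 a2 {(p, q). (q, p) \<in> integer_support c b (2 - n) s2 s1} (cluster_mon n s1 s2)"
    by (rule has_support_opposite)
  then show ?thesis by (simp add: integer_support_def minkowski_support_reflect)
qed

end

section \<open>The quantum torus and its bar-involution\<close>

lemma QTorus_mult: "QTorus F * QTorus G = QTorus (twisted_mult F G)"
  by (simp add: times_qtorus.abs_eq)

lemma QTorus_add: "QTorus F + QTorus G = QTorus (F + G)"
  by (simp add: plus_qtorus.abs_eq)

lemma QTorus_0: "0 = QTorus 0" and QTorus_1: "1 = QTorus (single 0 1)"
  by (simp_all add: zero_qtorus_def one_qtorus_def)

lemma QTorus_coeffs: "qcoeffs (QTorus F) = F"
  by (simp add: QTorus_inverse)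

lemma QTorus_single_mult:
  "QTorus (single a f) * QTorus (single b g) =
    QTorus (single (a + b) (vpow (2 * snd a * fst b) * f * g))"
  by (simp add: QTorus_mult twisted_mult_single twisted_term_def)

lemma qtorus_induct [case_names zero single add]:
  assumes "P 0" "\<And>a f. P (QTorus (single a f))" "\<And>x y. P x \<Longrightarrow> P y \<Longrightarrow> P (x + y)"
  shows "P x"
proof -
  have "P (QTorus F)" for F
    by (induction F rule: poly_mapping_single_induct) (use assms in \<open>auto simp: QTorus_0 simp flip: QTorus_add\<close>)
  then show ?thesis by (metis qcoeffs_inverse)
qed

lemma qscal_hom: "qscal (f + g) = qscal f + qscal g" "qscal (f * g) = qscal f * qscal g" "qscal 1 = 1"
  unfolding qscal_def QTorus_single_mult QTorus_add
  by (simp_all add: single_add vpow_0 QTorus_1 zero_prod_def)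

lemma qscal_central: "qscal f * x = x * qscal f"
  by (induction x rule: qtorus_induct)
    (simp_all add: qscal_def QTorus_single_mult distrib_left distrib_right vpow_0 mult.commute flip: zero_prod_def)

lemma qscal_qmon: "qscal f * qmon i j = QTorus (single (i, j) f)"
  by (simp add: qscal_def qmon_def QTorus_single_mult vpow_0)

lemma qmon_mult: "qmon i j * qmon k l = qscal (vpow (2 * j * k)) * qmon (i + k) (j + l)"
  unfolding qscal_qmon unfolding qmon_def QTorus_single_mult by simp

lemma lookup_lbar: "lookup (lbar f) k = lookup f (- k)"
proof -
  have "- x = k \<longleftrightarrow> x = - k" for x :: int by auto
  then show ?thesis by (simp add: lbar_def lookup_sum lookup_single when_def in_keys_iff)
qed

lemma lbar_0: "lbar 0 = 0" and lbar_add: "lbar (f + g) = lbar f + lbar g"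
  and lbar_single: "lbar (single k n) = single (- k) n"
  by (rule poly_mapping_eqI, auto simp: lookup_lbar lookup_add lookup_single when_def)+

lemma lbar_vpow: "lbar (vpow k) = vpow (- k)"
  by (simp add: vpow_def lbar_single)

lemma lbar_mult: "lbar (f * g) = lbar f * lbar g"
proof (induction f rule: poly_mapping_single_induct)
  case (2 i m)
  show ?case
    by (induction g rule: poly_mapping_single_induct)
      (simp_all add: lbar_0 lbar_add lbar_single mult_single distrib_left)
qed (simp_all add: lbar_0 lbar_add distrib_right)

text \<open>Reordering \<open>X\<^sub>2\<^bsup>j\<^esup> X\<^sub>1\<^bsup>i\<^esup>\<close> contributes \<open>v\<^bsup>2ij\<^esup>\<close>.\<close>

lemma lookup_qbar:
  "lookup (qcoeffs (qbar x)) a =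
    vpow (2 * fst a * snd a) * lbar (lookup (qcoeffs x) a)"
proof -
  have one: "qscal (lbar f) * qmon 0 j * qmon i 0 = QTorus (single (i, j) (vpow (2 * i * j) * lbar f))" for f i j
    unfolding qscal_qmon unfolding qmon_def QTorus_single_mult by (simp add: mult.commute mult.left_commute)
  have sum: "(\<Sum>a\<in>A. QTorus (g a)) = QTorus (\<Sum>a\<in>A. g a)" for A :: "(int \<times> int) set" and g
    by (induction A rule: infinite_finite_induct) (simp_all add: QTorus_0 QTorus_add)
  have "qbar x = QTorus (\<Sum>a\<in>keys (qcoeffs x).
      single a (vpow (2 * fst a * snd a) * lbar (lookup (qcoeffs x) a)))"
    unfolding qbar_def sum[symmetric] by (auto simp: one intro!: sum.cong)
  then show ?thesis
    by (simp add: QTorus_coeffs lookup_sum lookup_single when_def in_keys_iff lbar_0)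
qed

lemma qtorus_eqI: "(\<And>a. lookup (qcoeffs x) a = lookup (qcoeffs y) a) \<Longrightarrow> x = y"
  by (metis poly_mapping_eqI qcoeffs_inject)

lemma qcoeffs_add: "qcoeffs (x + y) = qcoeffs x + qcoeffs y"
  by (simp add: plus_qtorus.rep_eq)

lemma qbar_add: "qbar (x + y) = qbar x + qbar y"
  by (rule qtorus_eqI) (simp add: lookup_qbar qcoeffs_add lookup_add lbar_add distrib_left)

lemma qbar_single:
  "qbar (QTorus (single a f)) = QTorus (single a (vpow (2 * fst a * snd a) * lbar f))"
  by (rule qtorus_eqI) (simp add: lookup_qbar QTorus_coeffs lookup_single when_def lbar_0)

lemma qbar_0: "qbar 0 = 0"
  by (simp add: qbar_def zero_qtorus.rep_eq)

lemma qbar_mult: "qbar (x * y) = qbar y * qbar x"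
proof (induction x rule: qtorus_induct)
  case (single a f)
  show ?case
  proof (induction y rule: qtorus_induct)
    case (single b g)
    have E: "vpow (2 * fst (a + b) * snd (a + b)) * (vpow (- (2 * snd a * fst b)) * lbar f * lbar g) =
        vpow (2 * snd b * fst a) * (vpow (2 * fst b * snd b) * lbar g) * (vpow (2 * fst a * snd a) * lbar f)"
      by (simp add: algebra_simps vpow_add)
        (simp add: mult.assoc[symmetric] vpow_0 flip: vpow_add)
    show ?case
      by (simp only: QTorus_single_mult qbar_single lbar_mult lbar_vpow E add.commute[of b a])
  qed (simp_all add: distrib_left distrib_right qbar_add qbar_0)
qed (simp_all add: distrib_left distrib_right qbar_add qbar_0)

lemma qbar_1: "qbar 1 = 1"
proof -
  have "lbar 1 = 1" using lbar_single[of 0 1] by simp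
  then show ?thesis unfolding QTorus_1 qbar_single by (simp add: vpow_0)
qed

lemma qbar_qscal: "qbar (qscal f) = qscal (lbar f)"
  by (simp add: qscal_def qbar_single vpow_0)

lemma qbar_power: "qbar (x ^ n) = qbar x ^ n"
  by (induction n) (simp_all add: qbar_1 qbar_mult power_commutes)

lemma qbar_qmon: "qbar (qmon i 0) = qmon i 0" "qbar (qmon 0 j) = qmon 0 j"
proof -
  have "lbar 1 = 1" using lbar_single[of 0 1] by simp
  then show "qbar (qmon i 0) = qmon i 0" "qbar (qmon 0 j) = qmon 0 j"
    by (simp_all add: qmon_def qbar_single vpow_0)
qed

section \<open>Lowest terms\<close>

text \<open>All exponents are componentwise at least \<open>u\<close>, and the coefficient at \<open>u\<close> itself is \<open>\<alpha>\<close>, which may vanish.\<close>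

definition lowest_term :: "int \<times> int \<Rightarrow> laurent \<Rightarrow> qtorus \<Rightarrow> bool" where
  "lowest_term u \<alpha> x \<longleftrightarrow> lookup (qcoeffs x) u = \<alpha> \<and>
     (\<forall>a. lookup (qcoeffs x) a \<noteq> 0 \<longrightarrow> fst u \<le> fst a \<and> snd u \<le> snd a)"

lemma lookup_twisted_mult:
  assumes "finite A" "finite B" "keys F \<subseteq> A" "keys G \<subseteq> B"
  shows "lookup (twisted_mult F G) d = (\<Sum>a\<in>A. \<Sum>b\<in>B.
    if a + b = d then vpow (2 * snd a * fst b) * lookup F a * lookup G b else 0)"
  by (simp add: twisted_mult_superset[OF assms] lookup_sum twisted_term_def lookup_single when_def)

lemma lowest_term_mult:
  assumes x: "lowest_term u \<alpha> x" and y: "lowest_term u' \<beta> y"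
  shows "lowest_term (u + u') (vpow (2 * snd u * fst u') * \<alpha> * \<beta>) (x * y)"
  unfolding lowest_term_def times_qtorus.rep_eq
proof (intro conjI allI impI)
  let ?F = "qcoeffs x" and ?G = "qcoeffs y"
  define A B where "A = insert u (keys ?F)" and "B = insert u' (keys ?G)"
  have AB: "finite A" "finite B" "keys ?F \<subseteq> A" "keys ?G \<subseteq> B"
    by (auto simp: A_def B_def)
  have ge: "fst u \<le> fst a \<and> snd u \<le> snd a" if "a \<in> A" for a
  proof -
    have "lookup ?F a \<noteq> 0 \<Longrightarrow> fst u \<le> fst a \<and> snd u \<le> snd a"
      using x unfolding lowest_term_def by blast
    then show ?thesis using that by (auto simp: A_def in_keys_iff)
  qed
  have ge': "fst u' \<le> fst a \<and> snd u' \<le> snd a" if "a \<in> B" for a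
  proof -
    have "lookup ?G a \<noteq> 0 \<Longrightarrow> fst u' \<le> fst a \<and> snd u' \<le> snd a"
      using y unfolding lowest_term_def by blast
    then show ?thesis using that by (auto simp: B_def in_keys_iff)
  qed
  have only: "a + b = u + u' \<longleftrightarrow> a = u \<and> b = u'" if "a \<in> A" "b \<in> B" for a b
    using ge[OF that(1)] ge'[OF that(2)] by (auto simp: prod_eq_iff)
  have "lookup (twisted_mult ?F ?G) (u + u') = (\<Sum>a\<in>A. \<Sum>b\<in>B.
      if b = u' then (if a = u then vpow (2 * snd a * fst b) * lookup ?F a * lookup ?G b else 0) else 0)"
    unfolding lookup_twisted_mult[OF AB] by (intro sum.cong refl) (auto simp: only)
  also have "\<dots> = vpow (2 * snd u * fst u') * lookup ?F u * lookup ?G u'"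
    using AB(1,2) by (simp add: A_def B_def)
  finally show "lookup (twisted_mult ?F ?G) (u + u') = vpow (2 * snd u * fst u') * \<alpha> * \<beta>"
    using x y by (simp add: lowest_term_def)
  fix d assume "lookup (twisted_mult ?F ?G) d \<noteq> 0"
  then have nz: "(\<Sum>a\<in>A. \<Sum>b\<in>B. if a + b = d then vpow (2 * snd a * fst b) *
      lookup ?F a * lookup ?G b else 0) \<noteq> 0"
    unfolding lookup_twisted_mult[OF AB] .
  have "\<exists>a\<in>A. \<exists>b\<in>B. a + b = d"
  proof (rule ccontr)
    assume "\<not> ?thesis"
    then show False using nz by (auto intro!: sum.neutral)
  qed
  then obtain a b where ab: "a \<in> A" "b \<in> B" "a + b = d" by blast
  then show "fst (u + u') \<le> fst d" "snd (u + u') \<le> snd d"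
    using ge[OF ab(1)] ge'[OF ab(2)] ab(3) by auto
qed

lemma lowest_term_qmon: "lowest_term (i, j) 1 (qmon i j)"
  by (auto simp: lowest_term_def qmon_def QTorus_coeffs lookup_single when_def)

lemma lowest_term_qscal: "lowest_term (0, 0) f (qscal f)"
  by (auto simp: lowest_term_def qscal_def QTorus_coeffs lookup_single when_def)

lemma lowest_term_power:
  assumes "lowest_term u 1 x" "fst u = 0 \<or> snd u = 0"
  shows "lowest_term (int n * fst u, int n * snd u) 1 (x ^ n)"
proof (induction n)
  case 0
  then show ?case using lowest_term_qscal[of 1] by (simp add: qscal_hom)
next
  case (Suc n)
  from lowest_term_mult[OF assms(1) Suc] show ?case
    using assms(2) by (auto simp: vpow_0 algebra_simps prod_eq_iff plus_prod_def)
qed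

lemma lowest_term_binomial:
  assumes "i \<ge> 0" "j \<ge> 0" "(i, j) \<noteq> (0, 0)"
  shows "lowest_term (0, 0) 1 (qscal f * qmon i j + 1)"
  using assms unfolding lowest_term_def qscal_qmon QTorus_1 QTorus_add QTorus_coeffs
  by (auto simp: lookup_add lookup_single when_def zero_prod_def split: if_splits)


section \<open>Cluster variables in the skew-field of fractions\<close>

locale torus_fractions =
  fixes \<iota> :: "qtorus \<Rightarrow> 'f::division_ring"
  assumes fractions: "skew_field_of_fractions \<iota>"
begin

lemma iota_hom: "\<iota> 1 = 1" "\<iota> (x + y) = \<iota> x + \<iota> y" "\<iota> (x * y) = \<iota> x * \<iota> y"
  using fractions by (simp_all add: skew_field_of_fractions_def)

lemma iota_eq_iff: "\<iota> x = \<iota> y \<longleftrightarrow> x = y"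
  using fractions by (auto simp: skew_field_of_fractions_def inj_eq)

lemma iota_0: "\<iota> 0 = 0"
  using iota_hom(2)[of 0 0] by simp

lemma iota_power: "\<iota> (x ^ n) = \<iota> x ^ n"
  by (induction n) (simp_all add: iota_hom)

abbreviation s :: "laurent \<Rightarrow> 'f" where "s f \<equiv> \<iota> (qscal f)"

lemma scalar_central: "s f * z = z * s f"
proof -
  have xy: "s f * \<iota> x = \<iota> x * s f" for x by (simp only: iota_hom(3)[symmetric] qscal_central)
  obtain x y where z: "y \<noteq> 0" "z = \<iota> x * inverse (\<iota> y)"
    using fractions unfolding skew_field_of_fractions_def by blast
  have y: "\<iota> y \<noteq> 0" using z(1) iota_eq_iff[of y 0] iota_0 by simp
  have "inverse (\<iota> y) * s f = inverse (\<iota> y) * (s f * \<iota> y) * inverse (\<iota> y)"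
    using y by (simp add: mult.assoc)
  also have "\<dots> = inverse (\<iota> y) * (\<iota> y * s f) * inverse (\<iota> y)"
    by (simp only: xy)
  also have "\<dots> = s f * inverse (\<iota> y)"
    using y by (simp flip: mult.assoc)
  finally have "\<iota> x * inverse (\<iota> y) * s f = \<iota> x * s f * inverse (\<iota> y)" by (simp add: mult.assoc)
  then show ?thesis unfolding z(2) xy[symmetric] by (simp add: mult.assoc)
qed

sublocale central_scalars s
  by standard (simp_all add: qscal_hom iota_hom, rule scalar_central)

lemma iota_qmon: "\<iota> (qmon i j) = \<iota> (qmon 1 0) powi i * \<iota> (qmon 0 1) powi j"
proof -
  have nat: "\<iota> (qmon (int n) 0) = \<iota> (qmon 1 0) ^ n" "\<iota> (qmon 0 (int n)) = \<iota> (qmon 0 1) ^ n" for n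
  proof (induction n)
    case 0
    have "qmon 0 0 = 1" by (simp add: qmon_def QTorus_1 zero_prod_def)
    then show "\<iota> (qmon (int 0) 0) = \<iota> (qmon 1 0) ^ 0" "\<iota> (qmon 0 (int 0)) = \<iota> (qmon 0 1) ^ 0"
      by (simp_all add: iota_hom)
  next
    case (Suc n)
    then show "\<iota> (qmon (int (Suc n)) 0) = \<iota> (qmon 1 0) ^ Suc n" "\<iota> (qmon 0 (int (Suc n))) = \<iota> (qmon 0 1) ^ Suc n"
      using arg_cong[OF qmon_mult[of 1 0 "int n" 0], of \<iota>] arg_cong[OF qmon_mult[of 0 1 0 "int n"], of \<iota>]
      by (simp_all add: iota_hom vpow_0 qscal_hom)
  qed
  have inv: "u = inverse t" if "u * t = 1" for t u :: 'f using that by (metis inverse_unique inverse_inverse_eq)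
  have unit: "qmon 0 0 = 1" by (simp add: qmon_def QTorus_1 zero_prod_def)
  have neg: "\<iota> (qmon (- int n) 0) = inverse (\<iota> (qmon (int n) 0))" "\<iota> (qmon 0 (- int n)) = inverse (\<iota> (qmon 0 (int n)))" for n
    by (rule inv, simp add: iota_hom(3)[symmetric] qmon_mult vpow_0 qscal_hom unit iota_hom(1))+
  have 1: "\<iota> (qmon i 0) = \<iota> (qmon 1 0) powi i" for i
    using nat(1)[of "nat i"] nat(1)[of "nat (- i)"] neg(1)[of "nat (- i)"]
    by (cases "i \<ge> 0") (simp_all add: power_int_def power_inverse)
  have 2: "\<iota> (qmon 0 j) = \<iota> (qmon 0 1) powi j" for j
    using nat(2)[of "nat j"] nat(2)[of "nat (- j)"] neg(2)[of "nat (- j)"]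
    by (cases "j \<ge> 0") (simp_all add: power_int_def power_inverse)
  have "qmon i j = qmon i 0 * qmon 0 j" by (simp add: qmon_mult vpow_0 qscal_hom)
  then show ?thesis by (simp add: iota_hom 1[symmetric] 2[symmetric])
qed

abbreviation x1 :: 'f where "x1 \<equiv> \<iota> (qmon 1 0)"
abbreviation x2 :: 'f where "x2 \<equiv> \<iota> (qmon 0 1)"

lemma evaluate_monomials: "evaluate (\<lambda>a. x1 powi fst a * x2 powi snd a) F = \<iota> (QTorus F)"
proof (induction F rule: poly_mapping_single_induct)
  case (2 a f)
  have "s f * (x1 powi fst a * x2 powi snd a) = \<iota> (QTorus (single a f))"
    by (simp add: iota_qmon[symmetric] iota_hom(3)[symmetric] qscal_qmon)
  then show ?case by simp
next
  case 1
  then show ?case by (simp add: iota_0 flip: QTorus_0)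
next
  case (3 x y)
  then show ?case by (simp add: evaluate_add iota_hom flip: QTorus_add)
qed

lemma iota_qX: "\<iota> (qX (i, j)) = normal_monomial x1 x2 i j"
  by (simp add: qX_def iota_hom iota_qmon[of i j] normal_monomial_def V_def)

lemma initial_pair:
  "x1 \<noteq> 0" "x2 \<noteq> 0" "x2 * x1 = V 2 * (x1 * x2)" "independent_monomials x1 x2"
proof -
  have "x1 * \<iota> (qmon (-1) 0) = 1" "x2 * \<iota> (qmon 0 (-1)) = 1"
    by (simp_all add: iota_hom(3)[symmetric] qmon_inverse iota_hom(1))
  then show "x1 \<noteq> 0" "x2 \<noteq> 0" by auto
  show "x2 * x1 = V 2 * (x1 * x2)"
    using arg_cong[OF qtorus_relation, of \<iota>] by (simp add: iota_hom V_def)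
  have "F = 0" if "\<iota> (QTorus F) = 0" for F
  proof -
    have "QTorus F = 0" using that iota_eq_iff iota_0 by metis
    then show ?thesis by (metis QTorus_0 QTorus_coeffs)
  qed
  then show "independent_monomials x1 x2"
    by (simp add: independent_monomials_def evaluate_monomials)
qed

text \<open>The part of the structure of two consecutive cluster variables that is passed on by an exchange.\<close>

definition good_pair :: "'f \<Rightarrow> 'f \<Rightarrow> bool" where
  "good_pair x y \<longleftrightarrow> x \<noteq> 0 \<and> y \<noteq> 0 \<and> y * x = V 2 * (x * y) \<and> independent_monomials x y"

lemma good_pair_next:
  assumes "k > 0" "good_pair x y" "z * x = V (int k) * y ^ k + 1"
  shows "good_pair y z"
  using mutated_pair[OF assms(1) _ _ _ _ assms(3)] assms(2) by (simp add: good_pair_def)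

text \<open>A step to the left is a step to the right in the opposite ring.\<close>

lemma good_pair_prev:
  assumes k: "k > 0" and xy: "good_pair x y" and yz: "y * z = V (int k) * x ^ k + 1"
  shows "good_pair z x"
proof -
  interpret r: central_scalars "\<lambda>f. op (s f)" by (rule opposite_scalars)
  have "op x * op y = r.V 2 * (op y * op x)"
    using xy unfolding good_pair_def V_opposite op_hom(1) by (simp only: V_left)
  moreover have "op z * op y = r.V (int k) * op x ^ k + 1"
    by (simp only: V_opposite op_hom(1,2,5) op_power yz V_left)
  ultimately have "op z \<noteq> 0" "op z * op x = r.V 2 * (op x * op z)" "r.independent_monomials (op x) (op z)"
    using r.mutated_pair[OF k, of "op y" "op x" "op z"] xy by (simp_all add: good_pair_def independent_opposite op_hom(6) op_eq_iff)
  then show ?thesis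
    using xy unfolding good_pair_def independent_opposite V_opposite op_hom(1,6) op_eq_iff by (simp only: V_left) simp
qed

end

section \<open>The triangular basis\<close>

locale torus_cluster = torus_fractions \<iota> for \<iota> :: "qtorus \<Rightarrow> 'f::division_ring" +
  fixes b c :: nat
  assumes b_pos: "b > 0" and c_pos: "c > 0"
begin

abbreviation X :: "int \<Rightarrow> 'f" where "X \<equiv> cluster_var \<iota> b c"

lemma X_initial: "X 1 = x1" "X 2 = x2"
  by (simp_all add: cluster_var.simps)

lemma exch_pos: "exch b c m > 0"
  using b_pos c_pos by (simp add: exch_def)

lemma good_pairs: "good_pair (X m) (X (m + 1))"
proof (cases "m \<ge> 1")
  case True
  then show ?thesis
  proof (induction m rule: int_ge_induct)
    case base
    then show ?case using initial_pair by (simp add: good_pair_def X_initial)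
  next
    case (step m)
    have nz: "X m \<noteq> 0" using step.IH by (simp add: good_pair_def)
    have "X (m + 1 + 1) = (V (int (exch b c (m + 1))) * X (m + 1) ^ exch b c (m + 1) + 1) * inverse (X m)"
      using step.hyps by (subst cluster_var.simps) (simp add: V_def add.commute[of 1])
    then have "X (m + 1 + 1) * X m = V (int (exch b c (m + 1))) * X (m + 1) ^ exch b c (m + 1) + 1"
      using nz by (simp add: mult.assoc)
    then show ?case by (rule good_pair_next[OF exch_pos step.IH])
  qed
next
  case False
  then have "m \<le> 1" by simp
  then show ?thesis
  proof (induction m rule: int_le_induct)
    case base
    then show ?case using initial_pair by (simp add: good_pair_def X_initial)
  next
    case (step m)
    have nz: "X (m + 1) \<noteq> 0" using step.IH by (simp add: good_pair_def)
    have "X (m - 1) = inverse (X (m + 1)) * (V (int (exch b c m)) * X m ^ exch b c m + 1)"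
      using step.hyps by (subst cluster_var.simps) (simp add: V_def add.commute[of 1])
    then have "X (m + 1) * X (m - 1) = V (int (exch b c m)) * X m ^ exch b c m + 1"
      using nz by (simp flip: mult.assoc)
    then have "good_pair (X (m - 1)) (X m)" by (rule good_pair_prev[OF exch_pos step.IH])
    then show ?case by simp
  qed
qed

sublocale independent_cluster_sequence s b c X
proof
  fix m
  show nz: "X m \<noteq> 0" for m using good_pairs[of m] by (simp add: good_pair_def)
  show "X (m + 1) * X m = V 2 * (X m * X (m + 1))" "independent_monomials (X m) (X (m + 1))"
    using good_pairs[of m] by (simp_all add: good_pair_def)
  show "X (m + 1) * X (m - 1) = V (int (exch b c m)) * X m ^ exch b c m + 1"
    using cluster_var_exchange[OF nz nz, of m] by (simp add: V_def)
qed (rule b_pos c_pos)+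

lemma lattice_range:
  assumes "u \<in> lattice d P"
  shows "u \<in> range \<iota>"
proof -
  have "u \<in> laurent_ring x1 x2" using lattice_laurent[OF assms] by (simp only: X_initial)
  then show ?thesis
  proof (induction u rule: laurent_ring_induct)
    case zero
    then show ?case using iota_0 by (metis rangeI)
  next
    case (single f i j)
    then show ?case by (simp flip: iota_qX iota_hom(3))
  next
    case (add u v)
    then show ?case by (auto simp flip: iota_hom(2))
  qed
qed

lemma cluster_mon_range:
  assumes "in_cluster_cone b c n s1 s2 a"
  shows "cluster_mon n s1 s2 \<in> range \<iota>"
proof -
  have "(cluster_mon n s1 s2 - M a) + M a \<in> lattice 0 (\<lambda>_. True)"
    using cluster_monomials_in_lattice[OF assms]
    by (intro lattice.add lattice_M) (auto elim: lattice_mono)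
  then show ?thesis using lattice_range by simp
qed

lemma X_range: "X m \<in> range \<iota>"
  using cluster_mon_range[of m 1 0 "dvec b c m"] by (simp add: in_cluster_cone_def)

text \<open>The bar-involution reverses products and turns the exchange relation into its opposite form, hence the
bar-invariance of \<open>X\<^bsub>m-1\<^esub>\<close> and of \<open>X\<^bsub>m+1\<^esub>\<close> are equivalent if \<open>X\<^sub>m\<close> is bar-invariant.\<close>

lemma X_bar_invariant: "bar_invariant \<iota> (X m)"
proof -
  have exch_bar: "bar_invariant \<iota> t \<longleftrightarrow> bar_invariant \<iota> u"
    if tu0: "t * u = V (int k) * y ^ k + 1" "u * t = V (- int k) * y ^ k + 1" "bar_invariant \<iota> y"
      "t \<in> range \<iota>" "u \<in> range \<iota>" "t \<noteq> 0" "u \<noteq> 0" for t u y k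
  proof -
    obtain t' u' y' where t': "t = \<iota> t'" and u': "u = \<iota> u'" and y': "y = \<iota> y'" "qbar y' = y'"
      using tu0(3-5) unfolding bar_invariant_def by blast
    have nz: "\<iota> t' \<noteq> 0" "\<iota> u' \<noteq> 0" using tu0(6,7) t' u' by auto
    have tu: "t' * u' = qscal (vpow (int k)) * y' ^ k + 1" and ut: "u' * t' = qscal (vpow (- int k)) * y' ^ k + 1"
      using tu0(1,2) unfolding t' u' y'
      by (simp_all add: V_def iota_eq_iff iota_power[symmetric] iota_hom(3)[symmetric] iota_hom(2)[symmetric] flip: iota_hom(1))
    have "qbar u' * qbar t' = u' * t'"
      unfolding qbar_mult[symmetric] tu ut
      by (simp add: qbar_add qbar_mult qbar_power y' qbar_qscal lbar_vpow qbar_1 qscal_central)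
    then have prod: "\<iota> (qbar u') * \<iota> (qbar t') = \<iota> u' * \<iota> t'" by (simp add: iota_eq_iff flip: iota_hom(3))
    have "qbar t' = t' \<longleftrightarrow> qbar u' = u'"
      using prod nz by (metis iota_eq_iff mult_left_cancel mult_right_cancel)
    then show ?thesis unfolding bar_invariant_def t' u' iota_eq_iff by auto
  qed
  have step: "bar_invariant \<iota> (X (m + 1)) \<longleftrightarrow> bar_invariant \<iota> (X (m - 1))" if "bar_invariant \<iota> (X m)" for m
    by (rule exch_bar[OF exchange exchange_opposite that X_range X_range]) simp_all
  have "bar_invariant \<iota> (X m) \<and> bar_invariant \<iota> (X (m + 1))"
  proof (induction m rule: two_sided_induct)
    case 1
    then show ?case unfolding bar_invariant_def using qbar_qmon X_initial by auto
  next
    case (2 n)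
    then show ?case using step[of "n + 1"] by simp
  next
    case (3 n)
    then show ?case using step[of n] by simp
  qed
  then show ?thesis by simp
qed

lemma cluster_mon_bar_invariant: "bar_invariant \<iota> (cluster_mon n s1 s2)"
proof -
  obtain x y where x: "X n = \<iota> x" "qbar x = x" and y: "X (n + 1) = \<iota> y" "qbar y = y"
    using X_bar_invariant[of n] X_bar_invariant[of "n + 1"] by (auto simp: bar_invariant_def)
  let ?z = "qscal (vpow (int s1 * int s2)) * (x ^ s1 * y ^ s2)"
  have z: "cluster_mon n s1 s2 = \<iota> ?z" by (simp add: V_def iota_hom iota_power x y)
  have "y ^ s2 * x ^ s1 = qscal (vpow (2 * int s1 * int s2)) * (x ^ s1 * y ^ s2)"
    using X_commute_powers[of n s2 s1] unfolding x y V_def iota_power[symmetric] iota_hom(3)[symmetric] iota_eq_iff .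
  then have "qbar ?z = qscal (vpow (2 * int s1 * int s2)) * (x ^ s1 * y ^ s2) * qscal (vpow (- (int s1 * int s2)))"
    by (simp add: qbar_mult qbar_power x y qbar_qscal lbar_vpow)
  also have "\<dots> = qscal (vpow (- (int s1 * int s2))) * (qscal (vpow (2 * int s1 * int s2)) * (x ^ s1 * y ^ s2))"
    by (rule qscal_central[symmetric])
  also have "\<dots> = (qscal (vpow (- (int s1 * int s2))) * qscal (vpow (2 * int s1 * int s2))) * (x ^ s1 * y ^ s2)"
    by (simp only: mult.assoc)
  also have "qscal (vpow (- (int s1 * int s2))) * qscal (vpow (2 * int s1 * int s2)) = qscal (vpow (int s1 * int s2))"
    by (simp flip: qscal_hom(2) vpow_add)
  finally show ?thesis unfolding bar_invariant_def z by auto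
qed

lemma vZv_iff: "f \<in> vZv \<longleftrightarrow> (\<forall>k\<le>0. lookup f k = 0)"
  by (auto simp: vZv_def in_keys_iff not_less[symmetric])

lemma lattice_evaluate:
  assumes "u \<in> lattice 1 P"
  obtains g where "u = evaluate M g" "\<And>a. lookup g a \<in> vZv"
proof -
  have "\<exists>g. u = evaluate M g \<and> (\<forall>a. lookup g a \<in> vZv)"
    using assms
  proof (induction u rule: lattice.induct)
    case zero
    show ?case by (rule exI[of _ 0]) (simp add: vZv_iff)
  next
    case (gen a e)
    then show ?case
      by (intro exI[of _ "single a (vpow e)"]) (auto simp: V_def vZv_iff lookup_single when_def vpow_def)
  next
    case (uminus x)
    then obtain g where "x = evaluate M g" "\<forall>a. lookup g a \<in> vZv" by blast
    then show ?case by (intro exI[of _ "- g"]) (simp add: evaluate_uminus vZv_iff)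
  next
    case (add x y)
    then obtain g h where "x = evaluate M g" "\<forall>a. lookup g a \<in> vZv"
      "y = evaluate M h" "\<forall>a. lookup h a \<in> vZv" by blast
    then show ?case by (intro exI[of _ "g + h"]) (simp add: evaluate_add vZv_iff lookup_add)
  qed
  then show thesis using that by blast
qed

text \<open>The normalization of the standard monomials makes \<open>X\<^bsup>-a\<^esup>\<close> occur in \<open>M a\<close> with coefficient \<open>1\<close>.\<close>

lemma M_lowest_term:
  obtains t where "M a = \<iota> t" "lowest_term (- fst a, - snd a) (vpow (fst a * snd a)) t"
proof -
  have pair: "u + u' = (fst u + fst u', snd u + snd u')" for u u' :: "int \<times> int" by (simp add: plus_prod_def)
  let ?x3 = "qmon (-1) 0 * (qscal (vpow (- int c)) * qmon 0 (int c) + 1)"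
  let ?x0 = "qmon 0 (-1) * (qscal (vpow (int b)) * qmon (int b) 0 + 1)"
  have "X 1 * X 3 = V (- int c) * X 2 ^ c + 1" using exchange_opposite[of 2] by (simp add: exch_def)
  then have "X 3 = inverse (X 1) * (V (- int c) * X 2 ^ c + 1)"
    by (metis X_nonzero left_inverse mult.assoc mult_1_left)
  then have x3: "X 3 = \<iota> ?x3"
    using iota_qmon[of "-1" 0] iota_qmon[of 0 "int c"] by (simp add: X_initial V_def iota_hom)
  have "X 0 = inverse (X 2) * (V (int b) * X 1 ^ b + 1)"
    using X20 by (metis X_nonzero left_inverse mult.assoc mult_1_left)
  then have x0: "X 0 = \<iota> ?x0"
    using iota_qmon[of 0 "-1"] iota_qmon[of "int b" 0] by (simp add: X_initial V_def iota_hom)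
  have l3: "lowest_term (-1, 0) 1 ?x3"
    using lowest_term_mult[OF lowest_term_qmon[of "-1" 0] lowest_term_binomial[of 0 "int c"]] c_pos
    by (simp add: vpow_0)
  have l0: "lowest_term (0, -1) 1 ?x0"
    using lowest_term_mult[OF lowest_term_qmon[of 0 "-1"] lowest_term_binomial[of "int b" 0]] b_pos
    by (simp add: vpow_0)
  let ?w = "?x3 ^ nat (fst a) * qmon 1 0 ^ nat (- fst a)" and ?u = "qmon 0 1 ^ nat (- snd a) * ?x0 ^ nat (snd a)"
  have "lowest_term (- fst a, 0) 1 ?w"
    using lowest_term_mult[OF lowest_term_power[OF l3, of "nat (fst a)"] lowest_term_power[OF lowest_term_qmon[of 1 0], of "nat (- fst a)"]]
    by (cases "fst a \<ge> 0") (simp_all add: vpow_0 pair)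
  moreover have "lowest_term (0, - snd a) 1 ?u"
    using lowest_term_mult[OF lowest_term_power[OF lowest_term_qmon[of 0 1], of "nat (- snd a)"] lowest_term_power[OF l0, of "nat (snd a)"]]
    by (cases "snd a \<ge> 0") (simp_all add: vpow_0 pair)
  ultimately have "lowest_term (- fst a, - snd a) 1 (?w * ?u)"
    using lowest_term_mult[of "(- fst a, 0)" 1 ?w "(0, - snd a)" 1 ?u] by (simp add: vpow_0 pair)
  then have "lowest_term (- fst a, - snd a) (vpow (fst a * snd a)) (qscal (vpow (fst a * snd a)) * (?w * ?u))"
    using lowest_term_mult[OF lowest_term_qscal[of "vpow (fst a * snd a)"], of "(- fst a, - snd a)" 1 "?w * ?u"]
    by (simp add: vpow_0 pair)
  moreover have "M a = \<iota> (qscal (vpow (fst a * snd a)) * (?w * ?u))"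
    by (simp only: M_def w_def V_def x3 x0 X_initial iota_hom(3) iota_power)
  ultimately show thesis using that by blast
qed

text \<open>An index \<open>a\<close> with maximal sum of coordinates is the only one that contributes to the exponent \<open>-a\<close>.
The coefficient there is bar-invariant, but has only positive exponents.\<close>

lemma bar_invariant_combination_zero:
  fixes G :: "int \<times> int \<Rightarrow>\<^sub>0 laurent"
  assumes "bar_invariant \<iota> (evaluate M G)" "\<And>a. lookup G a \<in> vZv"
  shows "G = 0"
proof (rule ccontr)
  assume G: "G \<noteq> 0"
  obtain t where t: "evaluate M G = \<iota> t" "qbar t = t" using assms(1) by (auto simp: bar_invariant_def)
  have "\<exists>m. \<forall>a. M a = \<iota> (m a) \<and> lowest_term (- fst a, - snd a) (vpow (fst a * snd a)) (m a)"
    by (rule choice) (use M_lowest_term in metis)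
  then obtain m where m: "\<And>a. M a = \<iota> (m a)" "\<And>a. lowest_term (- fst a, - snd a) (vpow (fst a * snd a)) (m a)"
    by blast
  let ?K = "keys G"
  have sum: "(\<Sum>a\<in>A. \<iota> (f a)) = \<iota> (\<Sum>a\<in>A. f a)" for A :: "(int \<times> int) set" and f
    by (induction A rule: infinite_finite_induct) (simp_all add: iota_0 iota_hom)
  have "\<iota> t = \<iota> (\<Sum>a\<in>?K. qscal (lookup G a) * m a)"
    unfolding t(1)[symmetric] evaluate_def m(1) iota_hom(3)[symmetric] sum ..
  then have t_sum: "t = (\<Sum>a\<in>?K. qscal (lookup G a) * m a)" by (simp only: iota_eq_iff)
  have K: "finite ?K" "?K \<noteq> {}" using G by auto
  obtain a where a: "a \<in> ?K" "\<And>a'. a' \<in> ?K \<Longrightarrow> fst a' + snd a' \<le> fst a + snd a"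
  proof -
    have "Max ((\<lambda>a. fst a + snd a) ` ?K) \<in> (\<lambda>a. fst a + snd a) ` ?K" using K by (intro Max_in) auto
    then obtain a where "a \<in> ?K" "Max ((\<lambda>a. fst a + snd a) ` ?K) = fst a + snd a" by auto
    then show thesis using that[of a] Max_ge[of "(\<lambda>a. fst a + snd a) ` ?K"] K by fastforce
  qed
  let ?u = "(- fst a, - snd a)"
  have scaled: "lowest_term (- fst a', - snd a') (lookup G a' * vpow (fst a' * snd a'))
      (qscal (lookup G a') * m a')" for a'
    using lowest_term_mult[OF lowest_term_qscal m(2)[of a'], of "lookup G a'"] by (simp add: vpow_0)
  have other: "lookup (qcoeffs (qscal (lookup G a') * m a')) ?u = 0"
    if "a' \<in> ?K" "a' \<noteq> a" for a'
  proof (rule ccontr)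
    assume "lookup (qcoeffs (qscal (lookup G a') * m a')) ?u \<noteq> 0"
    then have "- fst a' \<le> - fst a \<and> - snd a' \<le> - snd a"
      using scaled[of a'] unfolding lowest_term_def by (metis fst_conv snd_conv)
    then have "a' = a" using a(2)[OF that(1)] by (simp add: prod_eq_iff)
    then show False using that(2) by simp
  qed
  have coeffs_sum: "qcoeffs (\<Sum>a\<in>A. f a) = (\<Sum>a\<in>A. qcoeffs (f a))" for A :: "(int \<times> int) set" and f
    by (induction A rule: infinite_finite_induct) (simp_all add: zero_qtorus.rep_eq plus_qtorus.rep_eq)
  have "lookup (qcoeffs t) ?u = (\<Sum>a'\<in>?K. lookup (qcoeffs (qscal (lookup G a') * m a')) ?u)"
    unfolding t_sum coeffs_sum lookup_sum ..
  also have "\<dots> = lookup (qcoeffs (qscal (lookup G a) * m a)) ?u"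
  proof -
    have "(\<Sum>a'\<in>?K - {a}. lookup (qcoeffs (qscal (lookup G a') * m a')) ?u) = 0"
      by (intro sum.neutral ballI other) auto
    then show ?thesis unfolding sum.remove[OF K(1) a(1)] by simp
  qed
  also have "\<dots> = lookup G a * vpow (fst a * snd a)"
    using scaled[of a] by (simp add: lowest_term_def)
  finally have coeff: "lookup (qcoeffs t) ?u = lookup G a * vpow (fst a * snd a)" .
  have "lookup (qcoeffs (qbar t)) ?u = vpow (2 * fst a * snd a) * lbar (lookup (qcoeffs t) ?u)"
    by (simp add: lookup_qbar)
  then have "lookup G a * vpow (fst a * snd a) =
      vpow (2 * fst a * snd a) * (lbar (lookup G a) * vpow (- (fst a * snd a)))"
    unfolding t(2) coeff by (simp add: lbar_mult lbar_vpow)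
  also have "\<dots> = lbar (lookup G a) * (vpow (2 * fst a * snd a) * vpow (- (fst a * snd a)))"
    by (simp only: mult.left_commute)
  also have "vpow (2 * fst a * snd a) * vpow (- (fst a * snd a)) = vpow (fst a * snd a)"
    by (simp flip: vpow_add)
  finally have bar: "lookup G a = lbar (lookup G a)" by simp
  obtain k where k: "lookup (lookup G a) k \<noteq> 0"
    using a(1) by (metis in_keys_iff lookup_zero poly_mapping_eqI)
  then have "lookup (lookup G a) (- k) \<noteq> 0"
    using bar lookup_lbar by metis
  with k assms(2)[of a] show False unfolding vZv_iff by (metis linorder_le_cases neg_le_0_iff_le)
qed

lemma standard_monomial_M: "standard_monomial \<iota> b c a = M a"
proof -
  have "nat (max k 0) = nat k" for k by simp
  then show ?thesis by (simp add: standard_monomial_def case_prod_beta M_def w_def V_def mult.assoc)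
qed

lemma cluster_monomial_cluster_mon: "cluster_monomial \<iota> b c n s1 s2 = cluster_mon n s1 s2"
  by (simp add: cluster_monomial_def V_def mult.assoc)

text \<open>Both elements are bar-invariant and congruent to the same standard monomial modulo \<open>v L\<close>.\<close>

theorem triangular_basis_cluster_monomial:
  assumes "triangular_basis \<iota> b c C" "in_cluster_cone b c n s1 s2 a"
  shows "C a = cluster_mon n s1 s2"
proof -
  have inv: "bar_invariant \<iota> (C a)" and low: "C a - M a \<in> lower_part \<iota> b c a"
    using assms(1) unfolding triangular_basis_def standard_monomial_M by blast+
  obtain S f where S: "finite S" "\<forall>a'\<in>S. f a' \<in> vZv" "C a - M a = (\<Sum>a'\<in>S. s (f a') * M a')"
    using low unfolding lower_part_def standard_monomial_M by blast
  define g1 where "g1 = (\<Sum>a'\<in>S. single a' (f a'))"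
  have g1: "C a - M a = evaluate M g1" by (simp add: g1_def evaluate_sum S(3))
  have g1_pos: "lookup g1 a' \<in> vZv" for a'
    using S(1,2) by (auto simp: g1_def lookup_sum lookup_single when_def vZv_iff)
  obtain g2 where g2: "cluster_mon n s1 s2 - M a = evaluate M g2" "\<And>a. lookup g2 a \<in> vZv"
    by (rule lattice_evaluate[OF cluster_monomials_in_lattice[OF assms(2)]]) blast
  have diff: "C a - cluster_mon n s1 s2 = evaluate M (g1 - g2)"
    unfolding evaluate_diff g1[symmetric] g2(1)[symmetric] by simp
  have "bar_invariant \<iota> (C a - cluster_mon n s1 s2)"
  proof -
    obtain x y where "C a = \<iota> x" "qbar x = x" "cluster_mon n s1 s2 = \<iota> y" "qbar y = y"
      using inv cluster_mon_bar_invariant unfolding bar_invariant_def by metis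
    moreover have "\<iota> (x - y) = \<iota> x - \<iota> y" using iota_hom(2)[of "x - y" y] by simp
    moreover have "qbar (x - y) = qbar x - qbar y" using qbar_add[of "x - y" y] by simp
    ultimately show ?thesis unfolding bar_invariant_def by metis
  qed
  then have "g1 - g2 = 0"
    using g1_pos g2(2) unfolding diff
    by (intro bar_invariant_combination_zero) (auto simp: vZv_iff lookup_minus)
  then show ?thesis using diff by simp
qed

lemma pointed_coeffs_unique:
  assumes "pointed_coeffs \<iota> b c a1 a2 z e" "pointed_coeffs \<iota> b c a1 a2 z e'"
  shows "e = e'"
proof (intro ext)
  fix p q
  let ?B = "\<lambda>e p q. qscal (e p q) * qX (int b * p - a1, int c * q - a2)"
  let ?P = "{0..max a2 0}" and ?Q = "{0..max a1 0}"
  have eq: "(\<Sum>p\<in>?P. \<Sum>q\<in>?Q. ?B e p q) = (\<Sum>p\<in>?P. \<Sum>q\<in>?Q. ?B e' p q)"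
    using assms unfolding pointed_coeffs_def by (metis (no_types, lifting) iota_eq_iff)
  have coeffs_sum: "qcoeffs (\<Sum>a\<in>A. f a) = (\<Sum>a\<in>A. qcoeffs (f a))" for A :: "int set" and f
    by (induction A rule: infinite_finite_induct) (simp_all add: zero_qtorus.rep_eq plus_qtorus.rep_eq)
  have coeff: "lookup (qcoeffs (\<Sum>p\<in>?P. \<Sum>q\<in>?Q. ?B e p q)) (int b * p - a1, int c * q - a2) =
      e p q * vpow ((int b * p - a1) * (int c * q - a2))" if "p \<in> ?P" "q \<in> ?Q" for e
  proof -
    have one: "lookup (qcoeffs (?B e p' q')) (int b * p - a1, int c * q - a2) =
        (if q' = q then (if p' = p then e p q * vpow ((int b * p - a1) * (int c * q - a2)) else 0) else 0)" for p' q'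
    proof -
      have "?B e p' q' = QTorus (single (int b * p' - a1, int c * q' - a2) (e p' q' * vpow ((int b * p' - a1) * (int c * q' - a2))))"
        by (simp add: qX_def qscal_qmon) (simp add: qscal_def QTorus_single_mult vpow_0)
      then show ?thesis using b_pos c_pos by (auto simp: QTorus_coeffs lookup_single when_def)
    qed
    show ?thesis using that by (simp add: coeffs_sum lookup_sum one)
  qed
  show "e p q = e' p q"
  proof (cases "p \<in> ?P \<and> q \<in> ?Q")
    case True
    then have "e p q * vpow ((int b * p - a1) * (int c * q - a2)) = e' p q * vpow ((int b * p - a1) * (int c * q - a2))"
      using coeff[of e] coeff[of e'] eq by metis
    then show ?thesis by simp
  next
    case False
    then have "\<not> (0 \<le> p \<and> p \<le> max a2 0 \<and> 0 \<le> q \<and> q \<le> max a1 0)" by simp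
    then show ?thesis using assms unfolding pointed_coeffs_def by metis
  qed
qed

lemma cluster_mon_pointed_coeffs:
  assumes "in_cluster_cone b c n s1 s2 (a1, a2)"
  shows "\<exists>e. pointed_coeffs \<iota> b c a1 a2 (cluster_mon n s1 s2) e \<and>
    (\<forall>p q. ((p, q) \<in> integer_support b c n s1 s2 \<longrightarrow> has_deg (e p q) (Ddeg b c a1 a2 p q)) \<and>
      ((p, q) \<notin> integer_support b c n s1 s2 \<longrightarrow> e p q = 0))"
proof -
  obtain e where e: "\<And>p q. (p, q) \<in> integer_support b c n s1 s2 \<Longrightarrow> has_deg (e p q) (Ddeg b c a1 a2 p q)"
    "\<And>p q. (p, q) \<notin> integer_support b c n s1 s2 \<Longrightarrow> e p q = 0"
    "cluster_mon n s1 s2 = (\<Sum>p\<in>{0..max a2 0}. \<Sum>q\<in>{0..max a1 0}.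
       s (e p q) * normal_monomial x1 x2 (int b * p - a1) (int c * q - a2))"
    using cluster_monomials_support[OF assms] unfolding has_support_def X_initial by blast
  have sum: "(\<Sum>a\<in>A. \<iota> (f a)) = \<iota> (\<Sum>a\<in>A. f a)" for A :: "int set" and f
    by (induction A rule: infinite_finite_induct) (simp_all add: iota_0 iota_hom)
  have "pointed_coeffs \<iota> b c a1 a2 (cluster_mon n s1 s2) e"
    unfolding pointed_coeffs_def
  proof (intro conjI allI impI)
    fix p q assume "\<not> (0 \<le> p \<and> p \<le> max a2 0 \<and> 0 \<le> q \<and> q \<le> max a1 0)"
    then have "(p, q) \<notin> integer_support b c n s1 s2"
      using integer_support_box[OF b_pos c_pos assms, of p q] by auto
    then show "e p q = 0" by (rule e(2))
  next
    show "cluster_mon n s1 s2 = \<iota> (\<Sum>p\<in>{0..max a2 0}. \<Sum>q\<in>{0..max a1 0}.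
       qscal (e p q) * qX (int b * p - a1, int c * q - a2))"
      unfolding e(3) sum[symmetric] iota_hom(3) iota_qX ..
  qed
  then show ?thesis using e(1,2) by blast
qed

end

theorem theorem3p1:
  fixes b c :: nat and \<iota> :: "qtorus \<Rightarrow> 'f::division_ring"
    and C :: "int \<times> int \<Rightarrow> 'f" and a1 a2 :: int
  assumes "b > 0" and "c > 0"
    and "skew_field_of_fractions \<iota>"
    and "triangular_basis \<iota> b c C"
    and "(a1, a2) \<notin> Phi_im_plus b c"
  shows "(\<exists>n s1 s2.
        a1 = int s1 * fst (dvec b c n) + int s2 * fst (dvec b c (n + 1)) \<and>
        a2 = int s1 * snd (dvec b c n) + int s2 * snd (dvec b c (n + 1))) \<and>
    (\<exists>!e. pointed_coeffs \<iota> b c a1 a2 (C (a1, a2)) e) \<and>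
    (\<forall>n s1 s2 e.
        a1 = int s1 * fst (dvec b c n) + int s2 * fst (dvec b c (n + 1)) \<longrightarrow>
        a2 = int s1 * snd (dvec b c n) + int s2 * snd (dvec b c (n + 1)) \<longrightarrow>
        pointed_coeffs \<iota> b c a1 a2 (C (a1, a2)) e \<longrightarrow>
          C (a1, a2) = cluster_monomial \<iota> b c n s1 s2 \<and>
          (\<forall>p q. (e p q \<noteq> 0 \<longleftrightarrow> (of_int p, of_int q) \<in> minkowski_support b c n s1 s2) \<and>
                 ((of_int p, of_int q) \<in> minkowski_support b c n s1 s2 \<longrightarrow>
                    ldeg (e p q) = Ddeg b c a1 a2 p q)))"
proof -
  interpret torus_cluster \<iota> b c
    using assms by unfold_locales
  have cone: "in_cluster_cone b c n s1 s2 (a1, a2) \<longleftrightarrow>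
      a1 = int s1 * fst (dvec b c n) + int s2 * fst (dvec b c (n + 1)) \<and>
      a2 = int s1 * snd (dvec b c n) + int s2 * snd (dvec b c (n + 1))" for n s1 s2
    by (simp add: in_cluster_cone_def)
  obtain n s1 s2 where n: "in_cluster_cone b c n s1 s2 (a1, a2)"
    using cluster_cones_cover[OF assms(1,2,5)] by blast
  obtain e where "pointed_coeffs \<iota> b c a1 a2 (C (a1, a2)) e"
    using cluster_mon_pointed_coeffs[OF n] triangular_basis_cluster_monomial[OF assms(4) n] by metis
  then have unique: "\<exists>!e. pointed_coeffs \<iota> b c a1 a2 (C (a1, a2)) e"
    using pointed_coeffs_unique by blast
  have main: "C (a1, a2) = cluster_monomial \<iota> b c n s1 s2 \<and>
      (\<forall>p q. (e p q \<noteq> 0 \<longleftrightarrow> (of_int p, of_int q) \<in> minkowski_support b c n s1 s2) \<and>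
         ((of_int p, of_int q) \<in> minkowski_support b c n s1 s2 \<longrightarrow> ldeg (e p q) = Ddeg b c a1 a2 p q))"
    if n: "in_cluster_cone b c n s1 s2 (a1, a2)" and e: "pointed_coeffs \<iota> b c a1 a2 (C (a1, a2)) e" for n s1 s2 e
  proof -
    have C: "C (a1, a2) = cluster_mon n s1 s2" by (rule triangular_basis_cluster_monomial[OF assms(4) n])
    obtain e' where e': "pointed_coeffs \<iota> b c a1 a2 (cluster_mon n s1 s2) e'"
      "\<And>p q. (p, q) \<in> integer_support b c n s1 s2 \<Longrightarrow> has_deg (e' p q) (Ddeg b c a1 a2 p q)"
      "\<And>p q. (p, q) \<notin> integer_support b c n s1 s2 \<Longrightarrow> e' p q = 0"
      using cluster_mon_pointed_coeffs[OF n] by blast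
    have "e = e'" using pointed_coeffs_unique e e'(1) unfolding C by blast
    then show ?thesis
      using e'(2,3) has_deg_ldeg has_deg_nonzero unfolding C cluster_monomial_cluster_mon integer_support_def by blast
  qed
  show ?thesis
    using n unique main unfolding cone by blast
qed

end
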